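(* Let $k$ be a field, $\mathcal D$ an additive Karoubian $k$-linear rigid symmetric monoidal category, $\mathcal V$ a tensor category over $k$, and $I:\mathcal D\to\mathcal V$ a $k$-linear symmetric monoidal functor. Assume that $I$ is fully faithful and that $\mathrm{Ext}^1_{\mathcal V}(T_1,T_2)=0$ for all $T_1,T_2\in I(\mathcal D)$. Then the conjunction of the two conditions (2) any $X\in\mathcal V$ can be presented as the image of a map $I(f)$ for some morphism $f:P\to Q$ in $\mathcal D$; (3) for any epimorphism $X\to Y$ in $\mathcal V$ there exists a nonzero $T\in\mathcal D$ such that the epimorphism $X\otimes I(T)\to Y\otimes I(T)$ splits; is equivalent to the following condition: for any simple object $X\in\mathcal V$ there exists a nonzero $T\in I(\mathcal D)$ such that $X\otimes T\in I(\mathcal D)$.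
   Context: A $k$-linear symmetric monoidal category is a tensor category over $k$ if it is abelian, $k\to\mathrm{End}(\mathbb 1)$ is an isomorphism, it is rigid (every object has a dual), and every object has finite length. $I(\mathcal D)$ denotes the essential image of $I$, i.e. the objects of $\mathcal V$ isomorphic to some $I(D)$, $D\in\mathcal D$. *)

theory Defs
  imports Main
begin

section \<open>Categories\<close>

text \<open>
  Categories are given by carrier sets of objects and arrows. Only the values of the
  operations on the carriers matter; composition is written in the usual order
  (\<open>g \<cdot> f\<close> is \<open>f\<close> followed by \<open>g\<close>).
\<close>

record ('o, 'm) category =
  Obj :: "'o set"
  Arr :: "'m set"
  Dom :: "'m \<Rightarrow> 'o"
  Cod :: "'m \<Rightarrow> 'o"
  Ident :: "'o \<Rightarrow> 'm" ("\<i>\<d>\<index>")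
  Comp :: "'m \<Rightarrow> 'm \<Rightarrow> 'm" (infixr "\<cdot>\<index>" 65)

definition hom :: "('o, 'm, 'z) category_scheme \<Rightarrow> 'o \<Rightarrow> 'o \<Rightarrow> 'm set" where
  "hom C X Y = {f \<in> Arr C. Dom C f = X \<and> Cod C f = Y}"

locale category =
  fixes C :: "('o, 'm, 'z) category_scheme" (structure)
  assumes dom_obj: "f \<in> Arr C \<Longrightarrow> Dom C f \<in> Obj C"
    and cod_obj: "f \<in> Arr C \<Longrightarrow> Cod C f \<in> Obj C"
    and id_hom: "X \<in> Obj C \<Longrightarrow> \<i>\<d> X \<in> hom C X X"
    and comp_hom: "\<lbrakk>f \<in> hom C X Y; g \<in> hom C Y Z\<rbrakk> \<Longrightarrow> g \<cdot> f \<in> hom C X Z"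
    and comp_assoc: "\<lbrakk>f \<in> hom C W X; g \<in> hom C X Y; h \<in> hom C Y Z\<rbrakk>
      \<Longrightarrow> (h \<cdot> g) \<cdot> f = h \<cdot> (g \<cdot> f)"
    and comp_id_left: "f \<in> hom C X Y \<Longrightarrow> \<i>\<d> Y \<cdot> f = f"
    and comp_id_right: "f \<in> hom C X Y \<Longrightarrow> f \<cdot> \<i>\<d> X = f"

definition inverse_arrows :: "('o, 'm, 'z) category_scheme \<Rightarrow> 'm \<Rightarrow> 'm \<Rightarrow> bool" where
  "inverse_arrows C f g \<longleftrightarrow> (\<exists>X Y. f \<in> hom C X Y \<and> g \<in> hom C Y X \<and>
     g \<cdot> f = \<i>\<d> X \<and> f \<cdot> g = \<i>\<d> Y)" for C (structure)

definition iso_arr :: "('o, 'm, 'z) category_scheme \<Rightarrow> 'm \<Rightarrow> bool" where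
  "iso_arr C f \<longleftrightarrow> (\<exists>g. inverse_arrows C f g)"

definition inv_arr :: "('o, 'm, 'z) category_scheme \<Rightarrow> 'm \<Rightarrow> 'm" where
  "inv_arr C f = (THE g. inverse_arrows C f g)"

definition isomorphic :: "('o, 'm, 'z) category_scheme \<Rightarrow> 'o \<Rightarrow> 'o \<Rightarrow> bool" where
  "isomorphic C X Y \<longleftrightarrow> (\<exists>f \<in> hom C X Y. iso_arr C f)"

definition monic :: "('o, 'm, 'z) category_scheme \<Rightarrow> 'm \<Rightarrow> bool" where
  "monic C f \<longleftrightarrow> f \<in> Arr C \<and>
     (\<forall>W \<in> Obj C. \<forall>g \<in> hom C W (Dom C f). \<forall>h \<in> hom C W (Dom C f).
        f \<cdot> g = f \<cdot> h \<longrightarrow> g = h)" for C (structure)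

definition epic :: "('o, 'm, 'z) category_scheme \<Rightarrow> 'm \<Rightarrow> bool" where
  "epic C f \<longleftrightarrow> f \<in> Arr C \<and>
     (\<forall>W \<in> Obj C. \<forall>g \<in> hom C (Cod C f) W. \<forall>h \<in> hom C (Cod C f) W.
        g \<cdot> f = h \<cdot> f \<longrightarrow> g = h)" for C (structure)

definition split_epi :: "('o, 'm, 'z) category_scheme \<Rightarrow> 'm \<Rightarrow> bool" where
  "split_epi C f \<longleftrightarrow> f \<in> Arr C \<and>
     (\<exists>s \<in> hom C (Cod C f) (Dom C f). f \<cdot> s = \<i>\<d> (Cod C f))" for C (structure)

definition zero_obj :: "('o, 'm, 'z) category_scheme \<Rightarrow> 'o \<Rightarrow> bool" where
  "zero_obj C Z \<longleftrightarrow> Z \<in> Obj C \<and>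
     (\<forall>X \<in> Obj C. (\<exists>!f. f \<in> hom C Z X) \<and> (\<exists>!f. f \<in> hom C X Z))"

locale karoubian_category = category +
  assumes idempotents_split: "\<lbrakk>e \<in> hom C X X; e \<cdot> e = e\<rbrakk> \<Longrightarrow>
    \<exists>Y \<in> Obj C. \<exists>r \<in> hom C X Y. \<exists>s \<in> hom C Y X. s \<cdot> r = e \<and> r \<cdot> s = \<i>\<d> Y"


section \<open>Linear, additive and abelian categories\<close>

text \<open>
  The ground field is the type \<open>'k\<close>. Each set of arrows \<open>hom C X Y\<close> is a vector space
  over it, with zero vector \<open>ZeroArr C X Y\<close>.
\<close>

record ('k, 'o, 'm) linear_category = "('o, 'm) category" +
  ZeroArr :: "'o \<Rightarrow> 'o \<Rightarrow> 'm" ("\<zero>\<index>")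
  AddArr :: "'m \<Rightarrow> 'm \<Rightarrow> 'm" (infixl "\<oplus>\<index>" 60)
  ScaleArr :: "'k \<Rightarrow> 'm \<Rightarrow> 'm" (infixr "*\<^sub>k\<index>" 70)

locale linear_category = category C
  for C :: "('k::field, 'o, 'm, 'z) linear_category_scheme" (structure) +
  assumes zero_hom: "\<lbrakk>X \<in> Obj C; Y \<in> Obj C\<rbrakk> \<Longrightarrow> \<zero> X Y \<in> hom C X Y"
    and add_hom: "\<lbrakk>f \<in> hom C X Y; g \<in> hom C X Y\<rbrakk> \<Longrightarrow> f \<oplus> g \<in> hom C X Y"
    and scale_hom: "f \<in> hom C X Y \<Longrightarrow> a *\<^sub>k f \<in> hom C X Y"
    and add_assoc: "\<lbrakk>f \<in> hom C X Y; g \<in> hom C X Y; h \<in> hom C X Y\<rbrakk>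
      \<Longrightarrow> (f \<oplus> g) \<oplus> h = f \<oplus> (g \<oplus> h)"
    and add_commute: "\<lbrakk>f \<in> hom C X Y; g \<in> hom C X Y\<rbrakk> \<Longrightarrow> f \<oplus> g = g \<oplus> f"
    and add_zero: "f \<in> hom C X Y \<Longrightarrow> f \<oplus> \<zero> X Y = f"
    and add_inverse: "f \<in> hom C X Y \<Longrightarrow> \<exists>g \<in> hom C X Y. f \<oplus> g = \<zero> X Y"
    and scale_one: "f \<in> hom C X Y \<Longrightarrow> 1 *\<^sub>k f = f"
    and scale_scale: "f \<in> hom C X Y \<Longrightarrow> a *\<^sub>k (b *\<^sub>k f) = (a * b) *\<^sub>k f"
    and scale_add_left: "f \<in> hom C X Y \<Longrightarrow> (a + b) *\<^sub>k f = (a *\<^sub>k f) \<oplus> (b *\<^sub>k f)"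
    and scale_add_right: "\<lbrakk>f \<in> hom C X Y; g \<in> hom C X Y\<rbrakk>
      \<Longrightarrow> a *\<^sub>k (f \<oplus> g) = (a *\<^sub>k f) \<oplus> (a *\<^sub>k g)"
    and comp_add_left: "\<lbrakk>f \<in> hom C X Y; g \<in> hom C Y Z; h \<in> hom C Y Z\<rbrakk>
      \<Longrightarrow> (g \<oplus> h) \<cdot> f = (g \<cdot> f) \<oplus> (h \<cdot> f)"
    and comp_add_right: "\<lbrakk>f \<in> hom C X Y; g \<in> hom C X Y; h \<in> hom C Y Z\<rbrakk>
      \<Longrightarrow> h \<cdot> (f \<oplus> g) = (h \<cdot> f) \<oplus> (h \<cdot> g)"
    and comp_scale_left: "\<lbrakk>f \<in> hom C X Y; g \<in> hom C Y Z\<rbrakk>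
      \<Longrightarrow> (a *\<^sub>k g) \<cdot> f = a *\<^sub>k (g \<cdot> f)"
    and comp_scale_right: "\<lbrakk>f \<in> hom C X Y; g \<in> hom C Y Z\<rbrakk>
      \<Longrightarrow> g \<cdot> (a *\<^sub>k f) = a *\<^sub>k (g \<cdot> f)"

definition biproduct ::
  "('k, 'o, 'm, 'z) linear_category_scheme \<Rightarrow> 'o \<Rightarrow> 'o \<Rightarrow> 'o
    \<Rightarrow> 'm \<Rightarrow> 'm \<Rightarrow> 'm \<Rightarrow> 'm \<Rightarrow> bool" where
  "biproduct C X Y B i j p q \<longleftrightarrow> B \<in> Obj C \<and>
     i \<in> hom C X B \<and> j \<in> hom C Y B \<and> p \<in> hom C B X \<and> q \<in> hom C B Y \<and>
     p \<cdot> i = \<i>\<d> X \<and> q \<cdot> j = \<i>\<d> Y \<and> q \<cdot> i = \<zero> X Y \<and> p \<cdot> j = \<zero> Y X \<and>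
     (i \<cdot> p) \<oplus> (j \<cdot> q) = \<i>\<d> B" for C (structure)

locale additive_category = linear_category +
  assumes ex_zero_obj: "\<exists>Z. zero_obj C Z"
    and ex_biproduct: "\<lbrakk>X \<in> Obj C; Y \<in> Obj C\<rbrakk> \<Longrightarrow> \<exists>B i j p q. biproduct C X Y B i j p q"

text \<open>\<open>is_kernel C f m\<close>: the arrow \<open>m\<close> (with its domain) is a kernel of \<open>f\<close>; dually for
  \<open>is_cokernel C f c\<close>.\<close>

definition is_kernel :: "('k, 'o, 'm, 'z) linear_category_scheme \<Rightarrow> 'm \<Rightarrow> 'm \<Rightarrow> bool" where
  "is_kernel C f m \<longleftrightarrow> (\<exists>K X Y. f \<in> hom C X Y \<and> m \<in> hom C K X \<and> f \<cdot> m = \<zero> K Y \<and>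
     (\<forall>W \<in> Obj C. \<forall>h \<in> hom C W X. f \<cdot> h = \<zero> W Y \<longrightarrow> (\<exists>!u. u \<in> hom C W K \<and> m \<cdot> u = h)))"
  for C (structure)

definition is_cokernel :: "('k, 'o, 'm, 'z) linear_category_scheme \<Rightarrow> 'm \<Rightarrow> 'm \<Rightarrow> bool" where
  "is_cokernel C f c \<longleftrightarrow> (\<exists>X Y Q. f \<in> hom C X Y \<and> c \<in> hom C Y Q \<and> c \<cdot> f = \<zero> X Q \<and>
     (\<forall>W \<in> Obj C. \<forall>h \<in> hom C Y W. h \<cdot> f = \<zero> X W \<longrightarrow> (\<exists>!u. u \<in> hom C Q W \<and> u \<cdot> c = h)))"
  for C (structure)

definition is_image :: "('k, 'o, 'm, 'z) linear_category_scheme \<Rightarrow> 'm \<Rightarrow> 'm \<Rightarrow> bool" where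
  "is_image C f m \<longleftrightarrow> (\<exists>c. is_cokernel C f c \<and> is_kernel C c m)"

locale abelian_category = additive_category +
  assumes ex_kernel: "f \<in> Arr C \<Longrightarrow> \<exists>m. is_kernel C f m"
    and ex_cokernel: "f \<in> Arr C \<Longrightarrow> \<exists>c. is_cokernel C f c"
    and monic_normal: "monic C m \<Longrightarrow> \<exists>f. is_kernel C f m"
    and epic_normal: "epic C c \<Longrightarrow> \<exists>f. is_cokernel C f c"

definition short_exact :: "('k, 'o, 'm, 'z) linear_category_scheme \<Rightarrow> 'm \<Rightarrow> 'm \<Rightarrow> bool" where
  "short_exact C i q \<longleftrightarrow> is_kernel C q i \<and> is_cokernel C i q"

definition simple_obj :: "('o, 'm, 'z) category_scheme \<Rightarrow> 'o \<Rightarrow> bool" where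
  "simple_obj C X \<longleftrightarrow> X \<in> Obj C \<and> \<not> zero_obj C X \<and>
     (\<forall>m. monic C m \<and> Cod C m = X \<longrightarrow> zero_obj C (Dom C m) \<or> iso_arr C m)"

text \<open>Existence of a composition series
  \<open>0 = F 0 \<hookrightarrow> F 1 \<hookrightarrow> \<dots> \<hookrightarrow> F n = X\<close> with simple subquotients.\<close>

definition finite_length :: "('k, 'o, 'm, 'z) linear_category_scheme \<Rightarrow> 'o \<Rightarrow> bool" where
  "finite_length C X \<longleftrightarrow> (\<exists>n (F :: nat \<Rightarrow> 'o) (i :: nat \<Rightarrow> 'm) (q :: nat \<Rightarrow> 'm).
     zero_obj C (F 0) \<and> F n = X \<and>
     (\<forall>j < n. i j \<in> hom C (F j) (F (Suc j)) \<and> short_exact C (i j) (q j) \<and>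
              simple_obj C (Cod C (q j))))"


subsection \<open>Yoneda Ext\<close>

text \<open>An element of \<open>extensions C A B\<close> is a short exact sequence
  \<open>0 \<rightarrow> B \<rightarrow> E \<rightarrow> A \<rightarrow> 0\<close>, recorded as the pair of its two arrows; \<open>Ext1 C A B\<close> is the
  set of equivalence classes, and its zero element for the Baer sum is the class of
  \<open>0 \<rightarrow> B \<rightarrow> B \<oplus> A \<rightarrow> A \<rightarrow> 0\<close>.\<close>

definition extensions ::
  "('k, 'o, 'm, 'z) linear_category_scheme \<Rightarrow> 'o \<Rightarrow> 'o \<Rightarrow> ('m \<times> 'm) set" where
  "extensions C A B = {(i, q). short_exact C i q \<and> Dom C i = B \<and> Cod C q = A}"

definition ext_rel ::
  "('k, 'o, 'm, 'z) linear_category_scheme \<Rightarrow> 'o \<Rightarrow> 'o \<Rightarrow> (('m \<times> 'm) \<times> ('m \<times> 'm)) set" where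
  "ext_rel C A B = {((i, q), (i', q')).
     (i, q) \<in> extensions C A B \<and> (i', q') \<in> extensions C A B \<and>
     (\<exists>f \<in> hom C (Cod C i) (Cod C i'). iso_arr C f \<and> f \<cdot> i = i' \<and> q' \<cdot> f = q)}"
  for C (structure)

definition Ext1 ::
  "('k, 'o, 'm, 'z) linear_category_scheme \<Rightarrow> 'o \<Rightarrow> 'o \<Rightarrow> ('m \<times> 'm) set set" where
  "Ext1 C A B = extensions C A B // ext_rel C A B"

definition Ext1_zero ::
  "('k, 'o, 'm, 'z) linear_category_scheme \<Rightarrow> 'o \<Rightarrow> 'o \<Rightarrow> ('m \<times> 'm) set" where
  "Ext1_zero C A B = {e. \<exists>E i j p q. biproduct C B A E i j p q \<and> ((i, q), e) \<in> ext_rel C A B}"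


section \<open>Linear symmetric monoidal categories\<close>

record ('k, 'o, 'm) monoidal_category = "('k, 'o, 'm) linear_category" +
  TensorObj :: "'o \<Rightarrow> 'o \<Rightarrow> 'o" (infixr "\<otimes>\<index>" 75)
  TensorArr :: "'m \<Rightarrow> 'm \<Rightarrow> 'm" (infixr "\<boxtimes>\<index>" 75)
  UnitObj :: "'o" ("\<one>\<index>")
  Assoc :: "'o \<Rightarrow> 'o \<Rightarrow> 'o \<Rightarrow> 'm" ("\<a>\<index>")
  LUnit :: "'o \<Rightarrow> 'm" ("\<l>\<index>")
  RUnit :: "'o \<Rightarrow> 'm" ("\<r>\<index>")
  Braid :: "'o \<Rightarrow> 'o \<Rightarrow> 'm" ("\<c>\<index>")

locale linear_symmetric_monoidal_category = linear_category C
  for C :: "('k::field, 'o, 'm, 'z) monoidal_category_scheme" (structure) +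
  assumes unit_obj: "\<one> \<in> Obj C"
    and tensor_obj: "\<lbrakk>X \<in> Obj C; Y \<in> Obj C\<rbrakk> \<Longrightarrow> X \<otimes> Y \<in> Obj C"
    and tensor_hom: "\<lbrakk>f \<in> hom C X X'; g \<in> hom C Y Y'\<rbrakk> \<Longrightarrow> f \<boxtimes> g \<in> hom C (X \<otimes> Y) (X' \<otimes> Y')"
    and tensor_id: "\<lbrakk>X \<in> Obj C; Y \<in> Obj C\<rbrakk> \<Longrightarrow> \<i>\<d> X \<boxtimes> \<i>\<d> Y = \<i>\<d> (X \<otimes> Y)"
    and tensor_comp:
      "\<lbrakk>f \<in> hom C X X'; f' \<in> hom C X' X''; g \<in> hom C Y Y'; g' \<in> hom C Y' Y''\<rbrakk>
        \<Longrightarrow> (f' \<cdot> f) \<boxtimes> (g' \<cdot> g) = (f' \<boxtimes> g') \<cdot> (f \<boxtimes> g)"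
    and tensor_add_left: "\<lbrakk>f \<in> hom C X X'; f' \<in> hom C X X'; g \<in> hom C Y Y'\<rbrakk>
      \<Longrightarrow> (f \<oplus> f') \<boxtimes> g = (f \<boxtimes> g) \<oplus> (f' \<boxtimes> g)"
    and tensor_add_right: "\<lbrakk>f \<in> hom C X X'; g \<in> hom C Y Y'; g' \<in> hom C Y Y'\<rbrakk>
      \<Longrightarrow> f \<boxtimes> (g \<oplus> g') = (f \<boxtimes> g) \<oplus> (f \<boxtimes> g')"
    and tensor_scale_left: "\<lbrakk>f \<in> hom C X X'; g \<in> hom C Y Y'\<rbrakk>
      \<Longrightarrow> (a *\<^sub>k f) \<boxtimes> g = a *\<^sub>k (f \<boxtimes> g)"
    and tensor_scale_right: "\<lbrakk>f \<in> hom C X X'; g \<in> hom C Y Y'\<rbrakk>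
      \<Longrightarrow> f \<boxtimes> (a *\<^sub>k g) = a *\<^sub>k (f \<boxtimes> g)"
    and assoc_hom: "\<lbrakk>X \<in> Obj C; Y \<in> Obj C; Z \<in> Obj C\<rbrakk>
      \<Longrightarrow> \<a> X Y Z \<in> hom C ((X \<otimes> Y) \<otimes> Z) (X \<otimes> (Y \<otimes> Z))"
    and assoc_iso: "\<lbrakk>X \<in> Obj C; Y \<in> Obj C; Z \<in> Obj C\<rbrakk> \<Longrightarrow> iso_arr C (\<a> X Y Z)"
    and assoc_natural: "\<lbrakk>f \<in> hom C X X'; g \<in> hom C Y Y'; h \<in> hom C Z Z'\<rbrakk>
      \<Longrightarrow> \<a> X' Y' Z' \<cdot> ((f \<boxtimes> g) \<boxtimes> h) = (f \<boxtimes> (g \<boxtimes> h)) \<cdot> \<a> X Y Z"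
    and lunit_hom: "X \<in> Obj C \<Longrightarrow> \<l> X \<in> hom C (\<one> \<otimes> X) X"
    and lunit_iso: "X \<in> Obj C \<Longrightarrow> iso_arr C (\<l> X)"
    and lunit_natural: "f \<in> hom C X Y \<Longrightarrow> \<l> Y \<cdot> (\<i>\<d> \<one> \<boxtimes> f) = f \<cdot> \<l> X"
    and runit_hom: "X \<in> Obj C \<Longrightarrow> \<r> X \<in> hom C (X \<otimes> \<one>) X"
    and runit_iso: "X \<in> Obj C \<Longrightarrow> iso_arr C (\<r> X)"
    and runit_natural: "f \<in> hom C X Y \<Longrightarrow> \<r> Y \<cdot> (f \<boxtimes> \<i>\<d> \<one>) = f \<cdot> \<r> X"
    and pentagon: "\<lbrakk>W \<in> Obj C; X \<in> Obj C; Y \<in> Obj C; Z \<in> Obj C\<rbrakk>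
      \<Longrightarrow> \<a> W X (Y \<otimes> Z) \<cdot> \<a> (W \<otimes> X) Y Z =
          (\<i>\<d> W \<boxtimes> \<a> X Y Z) \<cdot> \<a> W (X \<otimes> Y) Z \<cdot> (\<a> W X Y \<boxtimes> \<i>\<d> Z)"
    and triangle: "\<lbrakk>X \<in> Obj C; Y \<in> Obj C\<rbrakk>
      \<Longrightarrow> (\<i>\<d> X \<boxtimes> \<l> Y) \<cdot> \<a> X \<one> Y = \<r> X \<boxtimes> \<i>\<d> Y"
    and braid_hom: "\<lbrakk>X \<in> Obj C; Y \<in> Obj C\<rbrakk> \<Longrightarrow> \<c> X Y \<in> hom C (X \<otimes> Y) (Y \<otimes> X)"
    and braid_natural: "\<lbrakk>f \<in> hom C X X'; g \<in> hom C Y Y'\<rbrakk>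
      \<Longrightarrow> \<c> X' Y' \<cdot> (f \<boxtimes> g) = (g \<boxtimes> f) \<cdot> \<c> X Y"
    and braid_symmetric: "\<lbrakk>X \<in> Obj C; Y \<in> Obj C\<rbrakk> \<Longrightarrow> \<c> Y X \<cdot> \<c> X Y = \<i>\<d> (X \<otimes> Y)"
    and hexagon: "\<lbrakk>X \<in> Obj C; Y \<in> Obj C; Z \<in> Obj C\<rbrakk>
      \<Longrightarrow> \<a> Y Z X \<cdot> \<c> X (Y \<otimes> Z) \<cdot> \<a> X Y Z =
          (\<i>\<d> Y \<boxtimes> \<c> X Z) \<cdot> \<a> Y X Z \<cdot> (\<c> X Y \<boxtimes> \<i>\<d> Z)"

text \<open>The triangle identities for \<open>ev : Y \<otimes> X \<rightarrow> \<one>\<close> and \<open>coev : \<one> \<rightarrow> X \<otimes> Y\<close>, with the unit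
  isomorphisms moved to the right-hand sides.\<close>

definition is_dual ::
  "('k, 'o, 'm, 'z) monoidal_category_scheme \<Rightarrow> 'o \<Rightarrow> 'o \<Rightarrow> 'm \<Rightarrow> 'm \<Rightarrow> bool" where
  "is_dual C X Y ev coev \<longleftrightarrow> X \<in> Obj C \<and> Y \<in> Obj C \<and>
     ev \<in> hom C (Y \<otimes> X) \<one> \<and> coev \<in> hom C \<one> (X \<otimes> Y) \<and>
     \<r> X \<cdot> (\<i>\<d> X \<boxtimes> ev) \<cdot> \<a> X Y X \<cdot> (coev \<boxtimes> \<i>\<d> X) = \<l> X \<and>
     \<l> Y \<cdot> (ev \<boxtimes> \<i>\<d> Y) \<cdot> inv_arr C (\<a> Y X Y) \<cdot> (\<i>\<d> Y \<boxtimes> coev) = \<r> Y"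
  for C (structure)

text \<open>In a symmetric monoidal category left and right duals agree, via the braiding.\<close>

locale rigid_symmetric_monoidal_category = linear_symmetric_monoidal_category +
  assumes ex_dual: "X \<in> Obj C \<Longrightarrow> \<exists>Y ev coev. is_dual C X Y ev coev"

text \<open>The map \<open>a \<mapsto> a *\<^sub>k id\<close> from the ground field to \<open>End(\<one>)\<close> is a ring homomorphism in any
  linear category, so it is an isomorphism as soon as it is bijective.\<close>

locale tensor_category =
  abelian_category C + rigid_symmetric_monoidal_category C
  for C :: "('k::field, 'o, 'm, 'z) monoidal_category_scheme" (structure) +
  assumes end_unit: "bij_betw (\<lambda>a :: 'k. a *\<^sub>k \<i>\<d> \<one>) UNIV (hom C \<one> \<one>)"
    and objects_finite_length: "X \<in> Obj C \<Longrightarrow> finite_length C X"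


section \<open>Linear symmetric monoidal functors\<close>

text \<open>
  Monoidal functors are strong: a functor together with natural isomorphisms
  \<open>FMult F X Y : F X \<otimes> F Y \<rightarrow> F (X \<otimes> Y)\<close> and an isomorphism \<open>FUnit F : \<one> \<rightarrow> F \<one>\<close>.
\<close>

record ('o, 'm, 'p, 'n) monoidal_functor =
  FObj :: "'o \<Rightarrow> 'p"
  FArr :: "'m \<Rightarrow> 'n"
  FMult :: "'o \<Rightarrow> 'o \<Rightarrow> 'n"
  FUnit :: "'n"

locale linear_symmetric_monoidal_functor =
  D: linear_symmetric_monoidal_category D + V: linear_symmetric_monoidal_category V
  for D :: "('k::field, 'o, 'm, 'y) monoidal_category_scheme"
    and V :: "('k, 'p, 'n, 'z) monoidal_category_scheme"
    and F :: "('o, 'm, 'p, 'n, 'w) monoidal_functor_scheme" +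
  assumes map_obj: "X \<in> Obj D \<Longrightarrow> FObj F X \<in> Obj V"
    and map_hom: "f \<in> hom D X Y \<Longrightarrow> FArr F f \<in> hom V (FObj F X) (FObj F Y)"
    and map_id: "X \<in> Obj D \<Longrightarrow> FArr F (\<i>\<d>\<^bsub>D\<^esub> X) = \<i>\<d>\<^bsub>V\<^esub> (FObj F X)"
    and map_comp: "\<lbrakk>f \<in> hom D X Y; g \<in> hom D Y Z\<rbrakk>
      \<Longrightarrow> FArr F (g \<cdot>\<^bsub>D\<^esub> f) = FArr F g \<cdot>\<^bsub>V\<^esub> FArr F f"
    and map_add: "\<lbrakk>f \<in> hom D X Y; g \<in> hom D X Y\<rbrakk>
      \<Longrightarrow> FArr F (f \<oplus>\<^bsub>D\<^esub> g) = FArr F f \<oplus>\<^bsub>V\<^esub> FArr F g"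
    and map_scale: "f \<in> hom D X Y \<Longrightarrow> FArr F (a *\<^sub>k\<^bsub>D\<^esub> f) = a *\<^sub>k\<^bsub>V\<^esub> FArr F f"
    and mult_hom: "\<lbrakk>X \<in> Obj D; Y \<in> Obj D\<rbrakk>
      \<Longrightarrow> FMult F X Y \<in> hom V (FObj F X \<otimes>\<^bsub>V\<^esub> FObj F Y) (FObj F (X \<otimes>\<^bsub>D\<^esub> Y))"
    and mult_iso: "\<lbrakk>X \<in> Obj D; Y \<in> Obj D\<rbrakk> \<Longrightarrow> iso_arr V (FMult F X Y)"
    and mult_natural: "\<lbrakk>f \<in> hom D X X'; g \<in> hom D Y Y'\<rbrakk>
      \<Longrightarrow> FMult F X' Y' \<cdot>\<^bsub>V\<^esub> (FArr F f \<boxtimes>\<^bsub>V\<^esub> FArr F g) = FArr F (f \<boxtimes>\<^bsub>D\<^esub> g) \<cdot>\<^bsub>V\<^esub> FMult F X Y"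
    and unit_hom: "FUnit F \<in> hom V \<one>\<^bsub>V\<^esub> (FObj F \<one>\<^bsub>D\<^esub>)"
    and unit_iso: "iso_arr V (FUnit F)"
    and mult_assoc: "\<lbrakk>X \<in> Obj D; Y \<in> Obj D; Z \<in> Obj D\<rbrakk>
      \<Longrightarrow> FArr F (\<a>\<^bsub>D\<^esub> X Y Z) \<cdot>\<^bsub>V\<^esub> FMult F (X \<otimes>\<^bsub>D\<^esub> Y) Z \<cdot>\<^bsub>V\<^esub> (FMult F X Y \<boxtimes>\<^bsub>V\<^esub> \<i>\<d>\<^bsub>V\<^esub> (FObj F Z)) =
          FMult F X (Y \<otimes>\<^bsub>D\<^esub> Z) \<cdot>\<^bsub>V\<^esub> (\<i>\<d>\<^bsub>V\<^esub> (FObj F X) \<boxtimes>\<^bsub>V\<^esub> FMult F Y Z) \<cdot>\<^bsub>V\<^esub>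
            \<a>\<^bsub>V\<^esub> (FObj F X) (FObj F Y) (FObj F Z)"
    and mult_lunit: "X \<in> Obj D
      \<Longrightarrow> FArr F (\<l>\<^bsub>D\<^esub> X) \<cdot>\<^bsub>V\<^esub> FMult F \<one>\<^bsub>D\<^esub> X \<cdot>\<^bsub>V\<^esub> (FUnit F \<boxtimes>\<^bsub>V\<^esub> \<i>\<d>\<^bsub>V\<^esub> (FObj F X)) =
          \<l>\<^bsub>V\<^esub> (FObj F X)"
    and mult_runit: "X \<in> Obj D
      \<Longrightarrow> FArr F (\<r>\<^bsub>D\<^esub> X) \<cdot>\<^bsub>V\<^esub> FMult F X \<one>\<^bsub>D\<^esub> \<cdot>\<^bsub>V\<^esub> (\<i>\<d>\<^bsub>V\<^esub> (FObj F X) \<boxtimes>\<^bsub>V\<^esub> FUnit F) =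
          \<r>\<^bsub>V\<^esub> (FObj F X)"
    and mult_braid: "\<lbrakk>X \<in> Obj D; Y \<in> Obj D\<rbrakk>
      \<Longrightarrow> FArr F (\<c>\<^bsub>D\<^esub> X Y) \<cdot>\<^bsub>V\<^esub> FMult F X Y = FMult F Y X \<cdot>\<^bsub>V\<^esub> \<c>\<^bsub>V\<^esub> (FObj F X) (FObj F Y)"

definition fully_faithful ::
  "('o, 'm, 'y) category_scheme \<Rightarrow> ('p, 'n, 'z) category_scheme
    \<Rightarrow> ('o, 'm, 'p, 'n, 'w) monoidal_functor_scheme \<Rightarrow> bool" where
  "fully_faithful D V F \<longleftrightarrow> (\<forall>X \<in> Obj D. \<forall>Y \<in> Obj D.
     bij_betw (FArr F) (hom D X Y) (hom V (FObj F X) (FObj F Y)))"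

definition ess_image ::
  "('o, 'm, 'y) category_scheme \<Rightarrow> ('p, 'n, 'z) category_scheme
    \<Rightarrow> ('o, 'm, 'p, 'n, 'w) monoidal_functor_scheme \<Rightarrow> 'p set" where
  "ess_image D V F = {X \<in> Obj V. \<exists>A \<in> Obj D. isomorphic V X (FObj F A)}"

end

theory Submission
  imports Defs
begin

text \<open>
  Let \<open>E\<close> be the essential image of \<open>I\<close>; as \<open>I\<close> is fully faithful and \<open>D\<close> is Karoubian, \<open>E\<close> is closed
  under tensor products and retracts, and by the vanishing of \<open>Ext\<^sup>1\<close> under extensions, which all split.

  Given (2) and (3), every \<open>X\<close> is a quotient of some \<open>I P\<close>; after tensoring with a nonzero \<open>I T\<close> the
  quotient map splits, so \<open>X \<otimes> I T\<close> is a retract of \<open>I (P \<otimes> T)\<close>.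

  Conversely, induction on the length shows that every \<open>X\<close> (not only the simple ones) has
  \<open>X \<otimes> I A \<in> E\<close> for a nonzero \<open>A\<close>, since tensoring is exact and tensor products of nonzero objects of
  \<open>V\<close> are nonzero. For (3), apply this to the kernel and the target of the epimorphism: the tensored
  sequence is an extension of objects of \<open>E\<close> and splits. For (2), the unit and counit of \<open>A\<close> present
  \<open>X\<close> as a subobject of \<open>X \<otimes> I (A \<otimes> A\<^sup>*)\<close> and as a quotient of \<open>X \<otimes> I (A\<^sup>* \<otimes> A)\<close>, both in \<open>E\<close>.
\<close>

section \<open>Linear and abelian categories\<close>

text \<open>Two ingredients are not axioms and carry most of the work. Exactness of the tensor
  product comes from rigidity: a dual turns tensoring into a left or right adjoint. The absence of
  zero divisors is where the bijection between \<open>k\<close> and the endomorphisms of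
  \<open>\<one>\<close> enters: the image of a coevaluation yields an idempotent of
  \<open>\<one>\<close>, which must be 0 or 1.

  The second ingredient is used twice more. Witnesses for two objects are merged by tensoring them,
  and the merged witness has to stay nonzero. Moreover \<open>D\<close> need not be abelian, so
  \<open>I\<close> cannot be expected to preserve monic or epic arrows. It does preserve split ones,
  and by the triangle identities unit and counit split after tensoring with the object or its dual.
  Tensoring with a nonzero object of \<open>V\<close> reflects monic and epic arrows, since the
  kernel or cokernel becomes zero only if it was zero; so the image of the unit is monic and that of
  the counit is epic, although neither need split.\<close>

context category
begin

text \<open>Typing is restated through \<open>Arr\<close>, \<open>Dom\<close> and
  \<open>Cod\<close>, which the simplifier can compute from a composite; membership in
  \<open>hom\<close> would leave the middle object to be guessed.\<close>

lemma comp_arr [simp]: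
  assumes "f \<in> Arr C" "g \<in> Arr C" "Cod C f = Dom C g"
  shows "g \<cdot> f \<in> Arr C" "Dom C (g \<cdot> f) = Dom C f" "Cod C (g \<cdot> f) = Cod C g"
  using comp_hom[of f "Dom C f" "Cod C f" g "Cod C g"] assms by (auto simp: hom_def)

lemma id_arr [simp]:
  assumes "X \<in> Obj C"
  shows "\<i>\<d> X \<in> Arr C" "Dom C (\<i>\<d> X) = X" "Cod C (\<i>\<d> X) = X"
  using id_hom[OF assms] by (auto simp: hom_def)

lemma id_left [simp]: "f \<in> Arr C \<Longrightarrow> Cod C f = Y \<Longrightarrow> \<i>\<d> Y \<cdot> f = f"
  using comp_id_left[of f "Dom C f" Y] by (auto simp: hom_def)

lemma id_right [simp]: "f \<in> Arr C \<Longrightarrow> Dom C f = X \<Longrightarrow> f \<cdot> \<i>\<d> X = f"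
  using comp_id_right[of f X "Cod C f"] by (auto simp: hom_def)

lemma assoc [simp]:
  "\<lbrakk>f \<in> Arr C; g \<in> Arr C; h \<in> Arr C; Cod C f = Dom C g; Cod C g = Dom C h\<rbrakk>
    \<Longrightarrow> (h \<cdot> g) \<cdot> f = h \<cdot> g \<cdot> f"
  using comp_assoc[of f "Dom C f" "Cod C f" g "Cod C g" h "Cod C h"] by (auto simp: hom_def)

declare dom_obj [simp] cod_obj [simp]

lemma hom_obj: "f \<in> hom C X Y \<Longrightarrow> X \<in> Obj C" "f \<in> hom C X Y \<Longrightarrow> Y \<in> Obj C"
  by (auto simp: hom_def)

lemma comp_cong_right:
  "\<lbrakk>g \<cdot> f = k; f \<in> Arr C; g \<in> Arr C; x \<in> Arr C; Cod C f = Dom C g; Cod C x = Dom C f\<rbrakk>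
    \<Longrightarrow> g \<cdot> f \<cdot> x = k \<cdot> x"
  by (metis assoc)

lemma iso_arrE:
  assumes "iso_arr C f" "f \<in> hom C X Y"
  obtains g where "g \<in> hom C Y X" "g \<cdot> f = \<i>\<d> X" "f \<cdot> g = \<i>\<d> Y"
  using assms by (auto simp: iso_arr_def inverse_arrows_def hom_def)

lemma iso_arrI:
  "\<lbrakk>f \<in> hom C X Y; g \<in> hom C Y X; g \<cdot> f = \<i>\<d> X; f \<cdot> g = \<i>\<d> Y\<rbrakk> \<Longrightarrow> iso_arr C f"
  by (auto simp: iso_arr_def inverse_arrows_def)

text \<open>Uniqueness makes the definite description in \<open>inv_arr\<close> denote an
  inverse.\<close>

lemma inverse_arrows_unique:
  assumes "inverse_arrows C f g" "inverse_arrows C f h" shows "g = h"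
proof -
  have "h = (g \<cdot> f) \<cdot> h" using assms by (auto simp: inverse_arrows_def hom_def)
  also have "\<dots> = g \<cdot> f \<cdot> h" using assms by (subst assoc) (auto simp: inverse_arrows_def hom_def)
  also have "\<dots> = g" using assms by (auto simp: inverse_arrows_def hom_def)
  finally show ?thesis ..
qed

lemma inverse_arrows_inv: "iso_arr C f \<Longrightarrow> inverse_arrows C f (inv_arr C f)"
  unfolding iso_arr_def inv_arr_def using inverse_arrows_unique by (metis theI)

lemma inv_arr:
  assumes "iso_arr C f" "f \<in> hom C X Y"
  shows "inv_arr C f \<in> hom C Y X" "inv_arr C f \<cdot> f = \<i>\<d> X" "f \<cdot> inv_arr C f = \<i>\<d> Y"
  using inverse_arrows_inv[OF assms(1)] assms(2) by (auto simp: inverse_arrows_def hom_def)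

lemma isomorphicI:
  "\<lbrakk>f \<in> hom C X Y; g \<in> hom C Y X; g \<cdot> f = \<i>\<d> X; f \<cdot> g = \<i>\<d> Y\<rbrakk> \<Longrightarrow> isomorphic C X Y"
  unfolding isomorphic_def using iso_arrI by blast

lemma isomorphicE:
  assumes "isomorphic C X Y"
  obtains f g where "f \<in> hom C X Y" "g \<in> hom C Y X" "g \<cdot> f = \<i>\<d> X" "f \<cdot> g = \<i>\<d> Y"
  using assms unfolding isomorphic_def by (meson iso_arrE)

lemma isomorphic_refl: "X \<in> Obj C \<Longrightarrow> isomorphic C X X"
  by (rule isomorphicI[of "\<i>\<d> X" _ _ "\<i>\<d> X"]) (auto simp: id_hom)

lemma isomorphic_sym: "isomorphic C X Y \<Longrightarrow> isomorphic C Y X"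
  by (meson isomorphicE isomorphicI)

lemma comp_retract:
  assumes "f \<in> hom C X Y" "g \<in> hom C Y X" "g \<cdot> f = \<i>\<d> X"
    and "h \<in> hom C Y Z" "k \<in> hom C Z Y" "k \<cdot> h = \<i>\<d> Y"
  shows "(g \<cdot> k) \<cdot> (h \<cdot> f) = \<i>\<d> X"
proof -
  have "(g \<cdot> k) \<cdot> (h \<cdot> f) = g \<cdot> (k \<cdot> h) \<cdot> f"
    using assms(1,2,4,5) by (auto simp: hom_def)
  then show ?thesis using assms by (auto simp: hom_def)
qed

lemma isomorphic_trans:
  assumes "isomorphic C X Y" "isomorphic C Y Z" shows "isomorphic C X Z"
proof -
  obtain f g where fg: "f \<in> hom C X Y" "g \<in> hom C Y X" "g \<cdot> f = \<i>\<d> X" "f \<cdot> g = \<i>\<d> Y"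
    using assms(1) by (rule isomorphicE)
  obtain h k where hk: "h \<in> hom C Y Z" "k \<in> hom C Z Y" "k \<cdot> h = \<i>\<d> Y" "h \<cdot> k = \<i>\<d> Z"
    using assms(2) by (rule isomorphicE)
  show ?thesis
    by (rule isomorphicI[of "h \<cdot> f" _ _ "g \<cdot> k"])
      (use fg hk in \<open>auto intro: comp_hom comp_retract\<close>)
qed

lemma isomorphic_obj: "isomorphic C X Y \<Longrightarrow> X \<in> Obj C" "isomorphic C X Y \<Longrightarrow> Y \<in> Obj C"
  by (auto simp: isomorphic_def hom_def)

lemma iso_isomorphic: "f \<in> hom C X Y \<Longrightarrow> iso_arr C f \<Longrightarrow> isomorphic C X Y"
  by (auto simp: isomorphic_def)

lemma monicD:
  "\<lbrakk>monic C f; f \<in> hom C X Y; g \<in> hom C W X; h \<in> hom C W X; f \<cdot> g = f \<cdot> h\<rbrakk> \<Longrightarrow> g = h"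
  using hom_obj(1)[of g W X] by (auto simp: monic_def hom_def)

lemma epicD:
  "\<lbrakk>epic C f; f \<in> hom C X Y; g \<in> hom C Y W; h \<in> hom C Y W; g \<cdot> f = h \<cdot> f\<rbrakk> \<Longrightarrow> g = h"
  using hom_obj(2)[of g Y W] by (auto simp: epic_def hom_def)

lemma split_monic:
  assumes "f \<in> hom C X Y" "g \<in> hom C Y X" "g \<cdot> f = \<i>\<d> X"
  shows "monic C f"
  unfolding monic_def
proof (intro conjI ballI impI)
  show "f \<in> Arr C" using assms by (auto simp: hom_def)
  fix W u v assume W: "W \<in> Obj C" and u: "u \<in> hom C W (Dom C f)" and v: "v \<in> hom C W (Dom C f)"
    and eq: "f \<cdot> u = f \<cdot> v"
  have "u = (g \<cdot> f) \<cdot> u" using u assms by (auto simp: hom_def)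
  also have "\<dots> = g \<cdot> f \<cdot> u" using u assms(1,2) by (auto simp: hom_def)
  also have "\<dots> = (g \<cdot> f) \<cdot> v" using v assms(1,2) eq by (auto simp: hom_def)
  also have "\<dots> = v" using v assms by (auto simp: hom_def)
  finally show "u = v" .
qed

lemma split_epic:
  assumes "f \<in> hom C X Y" "g \<in> hom C Y X" "f \<cdot> g = \<i>\<d> Y"
  shows "epic C f"
  unfolding epic_def
proof (intro conjI ballI impI)
  show "f \<in> Arr C" using assms by (auto simp: hom_def)
  fix W u v assume W: "W \<in> Obj C" and u: "u \<in> hom C (Cod C f) W" and v: "v \<in> hom C (Cod C f) W"
    and eq: "u \<cdot> f = v \<cdot> f"
  have "u = u \<cdot> f \<cdot> g" using u assms by (auto simp: hom_def)
  also have "\<dots> = (u \<cdot> f) \<cdot> g" using u assms(1,2) by (auto simp: hom_def)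
  also have "\<dots> = v \<cdot> f \<cdot> g" using v assms(1,2) eq by (auto simp: hom_def)
  also have "\<dots> = v" using v assms by (auto simp: hom_def)
  finally show "u = v" .
qed

lemma iso_monic: "iso_arr C f \<Longrightarrow> f \<in> hom C X Y \<Longrightarrow> monic C f"
  by (meson iso_arrE split_monic)

lemma iso_epic: "iso_arr C f \<Longrightarrow> f \<in> hom C X Y \<Longrightarrow> epic C f"
  by (meson iso_arrE split_epic)

lemma monic_comp:
  assumes "monic C f" "f \<in> hom C X Y" "monic C g" "g \<in> hom C Y Z"
  shows "monic C (g \<cdot> f)"
  unfolding monic_def
proof (intro conjI ballI impI)
  show "g \<cdot> f \<in> Arr C" using assms by (auto simp: hom_def)
  fix W u v assume "W \<in> Obj C" "u \<in> hom C W (Dom C (g \<cdot> f))" "v \<in> hom C W (Dom C (g \<cdot> f))"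
    and eq: "(g \<cdot> f) \<cdot> u = (g \<cdot> f) \<cdot> v"
  then have uv: "u \<in> hom C W X" "v \<in> hom C W X" using assms by (auto simp: hom_def)
  have "g \<cdot> f \<cdot> u = g \<cdot> f \<cdot> v" using eq uv assms(2,4) by (auto simp: hom_def)
  then have "f \<cdot> u = f \<cdot> v" using uv assms(2) by (blast intro: monicD[OF assms(3,4)] comp_hom)
  then show "u = v" using uv by (blast intro: monicD[OF assms(1,2)])
qed

lemma epic_comp:
  assumes "epic C f" "f \<in> hom C X Y" "epic C g" "g \<in> hom C Y Z"
  shows "epic C (g \<cdot> f)"
  unfolding epic_def
proof (intro conjI ballI impI)
  show "g \<cdot> f \<in> Arr C" using assms by (auto simp: hom_def)
  fix W u v assume "W \<in> Obj C" "u \<in> hom C (Cod C (g \<cdot> f)) W" "v \<in> hom C (Cod C (g \<cdot> f)) W"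
    and eq: "u \<cdot> g \<cdot> f = v \<cdot> g \<cdot> f"
  then have uv: "u \<in> hom C Z W" "v \<in> hom C Z W" using assms by (auto simp: hom_def)
  have "(u \<cdot> g) \<cdot> f = (v \<cdot> g) \<cdot> f" using eq uv assms(2,4) by (auto simp: hom_def)
  then have "u \<cdot> g = v \<cdot> g" using uv assms(4) by (blast intro: epicD[OF assms(1,2)] comp_hom)
  then show "u = v" using uv by (blast intro: epicD[OF assms(3,4)])
qed

end


section \<open>Zero arrows, zero objects, kernels and cokernels\<close>

context linear_category
begin

text \<open>The common source of the later facts on zero arrows: an additive operation sends a zero
  arrow \<open>z\<close> to an arrow equal to its own double, because
  \<open>z \<oplus> z = z\<close>.\<close>

lemma add_idem_zero:
  assumes "f \<in> hom C X Y" "f \<oplus> f = f"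
  shows "f = \<zero> X Y"
  by (metis add_assoc add_inverse add_zero assms)

lemma zero_comp: "f \<in> hom C X Y \<Longrightarrow> Z \<in> Obj C \<Longrightarrow> \<zero> Y Z \<cdot> f = \<zero> X Z"
  by (rule add_idem_zero) (metis comp_hom hom_obj(2) zero_hom, metis add_zero comp_add_left hom_obj(2) zero_hom)

lemma comp_zero: "f \<in> hom C Y Z \<Longrightarrow> X \<in> Obj C \<Longrightarrow> f \<cdot> \<zero> X Y = \<zero> X Z"
  by (rule add_idem_zero) (metis comp_hom hom_obj(1) zero_hom, metis add_zero comp_add_right hom_obj(1) zero_hom)

lemma zero_scale: "f \<in> hom C X Y \<Longrightarrow> 0 *\<^sub>k f = \<zero> X Y"
  by (rule add_idem_zero) (metis scale_hom, metis add_0 scale_add_left)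

lemma zero_add: "f \<in> hom C X Y \<Longrightarrow> \<zero> X Y \<oplus> f = f"
  by (metis add_commute add_zero hom_obj zero_hom)

lemma monicI:
  assumes f: "f \<in> hom C X Y"
    and 0: "\<And>W g. g \<in> hom C W X \<Longrightarrow> f \<cdot> g = \<zero> W Y \<Longrightarrow> g = \<zero> W X"
  shows "monic C f"
  unfolding monic_def
proof (intro conjI ballI impI)
  show "f \<in> Arr C" using f by (auto simp: hom_def)
  fix W u v assume "W \<in> Obj C" "u \<in> hom C W (Dom C f)" "v \<in> hom C W (Dom C f)"
    and eq: "f \<cdot> u = f \<cdot> v"
  then have W: "W \<in> Obj C" and u: "u \<in> hom C W X" and v: "v \<in> hom C W X"
    using f by (auto simp: hom_def)
  \<comment> \<open>The difference of \<open>u\<close> and \<open>v\<close> is formed as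
    \<open>u \<oplus> n\<close> with an additive inverse \<open>n\<close> of \<open>v\<close>, as
    the structure has no subtraction.\<close>
  obtain n where n: "n \<in> hom C W X" "v \<oplus> n = \<zero> W X" using add_inverse[OF v] by blast
  have "f \<cdot> (u \<oplus> n) = f \<cdot> (v \<oplus> n)" using eq u v n(1) f by (simp add: comp_add_right)
  also have "\<dots> = \<zero> W Y" using n comp_zero f W by simp
  finally have "u \<oplus> n = \<zero> W X" using 0 add_hom u n by blast
  then show "u = v" by (metis add_assoc add_commute add_zero n u v)
qed

lemma epicI:
  assumes f: "f \<in> hom C X Y"
    and 0: "\<And>W g. g \<in> hom C Y W \<Longrightarrow> g \<cdot> f = \<zero> X W \<Longrightarrow> g = \<zero> Y W"
  shows "epic C f"
  unfolding epic_def
proof (intro conjI ballI impI)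
  show "f \<in> Arr C" using f by (auto simp: hom_def)
  fix W u v assume "W \<in> Obj C" "u \<in> hom C (Cod C f) W" "v \<in> hom C (Cod C f) W"
    and eq: "u \<cdot> f = v \<cdot> f"
  then have W: "W \<in> Obj C" and u: "u \<in> hom C Y W" and v: "v \<in> hom C Y W"
    using f by (auto simp: hom_def)
  obtain n where n: "n \<in> hom C Y W" "v \<oplus> n = \<zero> Y W" using add_inverse[OF v] by blast
  have "(u \<oplus> n) \<cdot> f = (v \<oplus> n) \<cdot> f" using eq u v n(1) f by (simp add: comp_add_left)
  also have "\<dots> = \<zero> X W" using n zero_comp f W by simp
  finally have "u \<oplus> n = \<zero> Y W" using 0 add_hom u n by blast
  then show "u = v" by (metis add_assoc add_commute add_zero n u v)
qed

lemma monic_zeroD: "\<lbrakk>monic C f; f \<in> hom C X Y; g \<in> hom C W X; f \<cdot> g = \<zero> W Y\<rbrakk> \<Longrightarrow> g = \<zero> W X"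
  by (metis comp_zero hom_obj monicD zero_hom)

lemma epic_zeroD: "\<lbrakk>epic C f; f \<in> hom C X Y; g \<in> hom C Y W; g \<cdot> f = \<zero> X W\<rbrakk> \<Longrightarrow> g = \<zero> Y W"
  by (metis zero_comp hom_obj epicD zero_hom)

lemma zero_obj_iff: "zero_obj C X \<longleftrightarrow> X \<in> Obj C \<and> \<i>\<d> X = \<zero> X X"
proof
  assume "zero_obj C X"
  then show "X \<in> Obj C \<and> \<i>\<d> X = \<zero> X X" unfolding zero_obj_def by (metis id_hom zero_hom)
next
  assume X: "X \<in> Obj C \<and> \<i>\<d> X = \<zero> X X"
  have "f = \<zero> X Y" if "f \<in> hom C X Y" for f Y
    by (metis X comp_id_right comp_zero that)
  moreover have "f = \<zero> Y X" if "f \<in> hom C Y X" for f Y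
    by (metis X comp_id_left zero_comp that)
  ultimately show "zero_obj C X" unfolding zero_obj_def using X zero_hom by metis
qed

lemma zero_obj_hom:
  assumes "zero_obj C X"
  shows "f \<in> hom C X Y \<Longrightarrow> f = \<zero> X Y" "f \<in> hom C Y X \<Longrightarrow> f = \<zero> Y X"
  by (metis assms comp_id_right comp_zero zero_obj_iff)
     (metis assms comp_id_left zero_comp zero_obj_iff)

lemma zero_obj_monic:
  "\<lbrakk>monic C f; f \<in> hom C X Y; f = \<zero> X Y\<rbrakk> \<Longrightarrow> zero_obj C X"
  by (metis zero_obj_iff comp_id_right hom_obj(1) id_hom monic_zeroD)

lemma zero_obj_epic:
  "\<lbrakk>epic C f; f \<in> hom C X Y; f = \<zero> X Y\<rbrakk> \<Longrightarrow> zero_obj C Y"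
  by (metis zero_obj_iff comp_id_left hom_obj(2) id_hom epic_zeroD)

lemma zero_obj_retract:
  assumes "zero_obj C Y" "f \<in> hom C X Y" "g \<in> hom C Y X" "g \<cdot> f = \<i>\<d> X"
  shows "zero_obj C X"
  by (metis assms split_monic zero_obj_hom(2) zero_obj_monic)

lemma zero_obj_isomorphic: "isomorphic C X Y \<Longrightarrow> zero_obj C X \<Longrightarrow> zero_obj C Y"
  by (meson isomorphicE zero_obj_retract)

text \<open>Fixes the objects that the definition quantifies existentially and trades uniqueness of
  factorisations for monicity. In this split form each part can be transported separately through
  the tensor product.\<close>

lemma is_kernelD:
  assumes "is_kernel C f m" "f \<in> hom C X Y" "m \<in> hom C K X"
  shows "f \<cdot> m = \<zero> K Y"
    and "h \<in> hom C W X \<Longrightarrow> f \<cdot> h = \<zero> W Y \<Longrightarrow> \<exists>u\<in>hom C W K. m \<cdot> u = h"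
    and "monic C m"
proof -
  show 0: "f \<cdot> m = \<zero> K Y" using assms by (auto simp: is_kernel_def hom_def)
  have *: "\<exists>!u. u \<in> hom C W K \<and> m \<cdot> u = h" if "h \<in> hom C W X" "f \<cdot> h = \<zero> W Y" for h W
    using assms that hom_obj(1)[OF that(1)] by (auto simp: is_kernel_def hom_def)
  show "h \<in> hom C W X \<Longrightarrow> f \<cdot> h = \<zero> W Y \<Longrightarrow> \<exists>u\<in>hom C W K. m \<cdot> u = h" using * by blast
  show "monic C m"
  proof (rule monicI[OF assms(3)])
    fix W g assume g: "g \<in> hom C W K" "m \<cdot> g = \<zero> W X"
    have "\<zero> W X \<in> hom C W X" using g(1) assms(2) by (auto intro!: zero_hom dest: hom_obj)
    moreover have "f \<cdot> \<zero> W X = \<zero> W Y" using g(1) assms(2) by (auto intro!: comp_zero dest: hom_obj)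
    ultimately have "\<exists>!u. u \<in> hom C W K \<and> m \<cdot> u = \<zero> W X" by (rule *)
    moreover have "m \<cdot> \<zero> W K = \<zero> W X" "\<zero> W K \<in> hom C W K"
      using g(1) assms(3) by (auto intro!: comp_zero zero_hom dest: hom_obj)
    ultimately show "g = \<zero> W K" using g by blast
  qed
qed

lemma is_kernelI:
  assumes "f \<in> hom C X Y" "m \<in> hom C K X" "f \<cdot> m = \<zero> K Y" "monic C m"
    and "\<And>W h. h \<in> hom C W X \<Longrightarrow> f \<cdot> h = \<zero> W Y \<Longrightarrow> \<exists>u\<in>hom C W K. m \<cdot> u = h"
  shows "is_kernel C f m"
  unfolding is_kernel_def
proof (intro exI conjI ballI impI)
  fix W h assume "W \<in> Obj C" "h \<in> hom C W X" "f \<cdot> h = \<zero> W Y"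
  then obtain u where u: "u \<in> hom C W K" "m \<cdot> u = h" using assms(5) by blast
  then show "\<exists>!u. u \<in> hom C W K \<and> m \<cdot> u = h"
    by (intro ex1I[of _ u]) (use monicD[OF assms(4,2)] in auto)
qed (use assms in auto)

lemma is_cokernelD:
  assumes "is_cokernel C f c" "f \<in> hom C X Y" "c \<in> hom C Y Q"
  shows "c \<cdot> f = \<zero> X Q"
    and "h \<in> hom C Y W \<Longrightarrow> h \<cdot> f = \<zero> X W \<Longrightarrow> \<exists>u\<in>hom C Q W. u \<cdot> c = h"
    and "epic C c"
proof -
  show 0: "c \<cdot> f = \<zero> X Q" using assms by (auto simp: is_cokernel_def hom_def)
  have *: "\<exists>!u. u \<in> hom C Q W \<and> u \<cdot> c = h" if "h \<in> hom C Y W" "h \<cdot> f = \<zero> X W" for h W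
    using assms that hom_obj(2)[OF that(1)] by (auto simp: is_cokernel_def hom_def)
  show "h \<in> hom C Y W \<Longrightarrow> h \<cdot> f = \<zero> X W \<Longrightarrow> \<exists>u\<in>hom C Q W. u \<cdot> c = h" using * by blast
  show "epic C c"
  proof (rule epicI[OF assms(3)])
    fix W g assume g: "g \<in> hom C Q W" "g \<cdot> c = \<zero> Y W"
    have "\<zero> Y W \<in> hom C Y W" using g(1) assms(2) by (auto intro!: zero_hom dest: hom_obj)
    moreover have "\<zero> Y W \<cdot> f = \<zero> X W" using g(1) assms(2) by (auto intro!: zero_comp dest: hom_obj)
    ultimately have "\<exists>!u. u \<in> hom C Q W \<and> u \<cdot> c = \<zero> Y W" by (rule *)
    moreover have "\<zero> Q W \<cdot> c = \<zero> Y W" "\<zero> Q W \<in> hom C Q W"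
      using g(1) assms(3) by (auto intro!: zero_comp zero_hom dest: hom_obj)
    ultimately show "g = \<zero> Q W" using g by blast
  qed
qed

lemma is_cokernelI:
  assumes "f \<in> hom C X Y" "c \<in> hom C Y Q" "c \<cdot> f = \<zero> X Q" "epic C c"
    and "\<And>W h. h \<in> hom C Y W \<Longrightarrow> h \<cdot> f = \<zero> X W \<Longrightarrow> \<exists>u\<in>hom C Q W. u \<cdot> c = h"
  shows "is_cokernel C f c"
  unfolding is_cokernel_def
proof (intro exI conjI ballI impI)
  fix W h assume "W \<in> Obj C" "h \<in> hom C Y W" "h \<cdot> f = \<zero> X W"
  then obtain u where u: "u \<in> hom C Q W" "u \<cdot> c = h" using assms(5) by blast
  then show "\<exists>!u. u \<in> hom C Q W \<and> u \<cdot> c = h"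
    by (intro ex1I[of _ u]) (use epicD[OF assms(4,2)] in auto)
qed (use assms in auto)

lemma is_kernel_hom: "is_kernel C f m \<Longrightarrow> f \<in> hom C X Y \<Longrightarrow> m \<in> hom C (Dom C m) X"
  by (auto simp: is_kernel_def hom_def)

lemma is_cokernel_hom: "is_cokernel C f c \<Longrightarrow> f \<in> hom C X Y \<Longrightarrow> c \<in> hom C Y (Cod C c)"
  by (auto simp: is_cokernel_def hom_def)

end


section \<open>Normality and image factorisation\<close>

context abelian_category
begin

lemma kernelE:
  assumes "f \<in> hom C X Y"
  obtains K m where "m \<in> hom C K X" "is_kernel C f m"
  using assms ex_kernel is_kernel_hom by (metis (mono_tags, lifting) hom_def mem_Collect_eq)

lemma cokernelE:
  assumes "f \<in> hom C X Y"
  obtains Q c where "c \<in> hom C Y Q" "is_cokernel C f c"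
  using assms ex_cokernel is_cokernel_hom by (metis (mono_tags, lifting) hom_def mem_Collect_eq)

text \<open>By normality \<open>m\<close> is a kernel of some \<open>f\<close>. As \<open>f\<close>
  kills \<open>m\<close>, it factors through the cokernel \<open>c\<close>, so every arrow killed by
  \<open>c\<close> is killed by \<open>f\<close> and factors through \<open>m\<close>.\<close>

lemma monic_kernel_of_cokernel:
  assumes m: "monic C m" "m \<in> hom C K X" and c: "c \<in> hom C X Q" "is_cokernel C m c"
  shows "is_kernel C c m"
proof -
  obtain f where f: "is_kernel C f m" using monic_normal m(1) by blast
  then obtain Y where fh: "f \<in> hom C X Y" using m by (auto simp: is_kernel_def hom_def)
  note K = is_kernelD[OF f fh m(2)] and Q = is_cokernelD[OF c(2) m(2) c(1)]
  show ?thesis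
  proof (rule is_kernelI[OF c(1) m(2) Q(1) m(1)])
    fix W h assume h: "h \<in> hom C W X" "c \<cdot> h = \<zero> W Q"
    obtain u where u: "u \<in> hom C Q Y" "u \<cdot> c = f" using Q(2)[OF fh K(1)] by blast
    have "f \<cdot> h = u \<cdot> c \<cdot> h" using u(1) u(2)[symmetric] c h(1) by (auto simp: hom_def)
    also have "\<dots> = \<zero> W Y" using h u(1) comp_zero hom_obj(1) by metis
    finally show "\<exists>u\<in>hom C W K. m \<cdot> u = h" using K(2) h(1) by blast
  qed
qed

text \<open>Dually, \<open>c\<close> is a cokernel of some \<open>f\<close> that factors through
  \<open>m\<close>. This turns an epimorphism and its kernel into a short exact sequence.\<close>

lemma epic_cokernel_of_kernel:
  assumes c: "epic C c" "c \<in> hom C X Q" and m: "m \<in> hom C K X" "is_kernel C c m"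
  shows "is_cokernel C m c"
proof -
  obtain f where f: "is_cokernel C f c" using epic_normal c(1) by blast
  then obtain Y where fh: "f \<in> hom C Y X" using c by (auto simp: is_cokernel_def hom_def)
  note Q = is_cokernelD[OF f fh c(2)] and K = is_kernelD[OF m(2) c(2) m(1)]
  show ?thesis
  proof (rule is_cokernelI[OF m(1) c(2) K(1) c(1)])
    fix W h assume h: "h \<in> hom C X W" "h \<cdot> m = \<zero> K W"
    obtain u where u: "u \<in> hom C Y K" "m \<cdot> u = f" using K(2)[OF fh Q(1)] by blast
    have "h \<cdot> f = (h \<cdot> m) \<cdot> u" using u(1) u(2)[symmetric] m h(1) by (auto simp: hom_def)
    also have "\<dots> = \<zero> Y W" using h u(1) zero_comp hom_obj(2) by metis
    finally show "\<exists>u\<in>hom C Q W. u \<cdot> c = h" using Q(2) h(1) by blast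
  qed
qed

text \<open>Since \<open>f\<close> is epic, its cokernel is zero; since \<open>f\<close> is monic,
  it is the kernel of that cokernel. Hence the identity of \<open>Y\<close> factors through
  \<open>f\<close>, and cancelling \<open>f\<close> makes the section two-sided.\<close>

lemma monic_epic_iso:
  assumes f: "f \<in> hom C X Y" "monic C f" "epic C f"
  shows "iso_arr C f"
proof -
  obtain Q c where c: "c \<in> hom C Y Q" "is_cokernel C f c" using f(1) by (rule cokernelE)
  have "is_kernel C c f" using monic_kernel_of_cokernel f c by blast
  note K = is_kernelD[OF this c(1) f(1)]
  have "c = \<zero> Y Q" using epic_zeroD f c(1) K(1) by blast
  then have "c \<cdot> \<i>\<d> Y = \<zero> Y Q" using c(1) by (simp add: comp_id_right)
  then obtain g where g: "g \<in> hom C Y X" "f \<cdot> g = \<i>\<d> Y"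
    using K(2) id_hom f(1) hom_obj(2) by metis
  have "f \<cdot> g \<cdot> f = f \<cdot> \<i>\<d> X"
    using comp_assoc[OF f(1) g(1) f(1)] g f(1) by (simp add: comp_id_left comp_id_right)
  then have "g \<cdot> f = \<i>\<d> X"
    using monicD[OF f(2,1)] f(1) g(1) by (metis comp_hom hom_obj(1) id_hom)
  then show ?thesis using iso_arrI f(1) g by blast
qed

text \<open>For epicness, let \<open>g\<close> kill \<open>e\<close>. Then \<open>e\<close> factors
  through the kernel \<open>n\<close> of \<open>g\<close>, so \<open>f\<close> factors through the
  monic \<open>m \<cdot> n\<close>, which is a kernel of some \<open>h\<close>. Now \<open>h\<close>
  kills \<open>f\<close>, hence factors through the cokernel of \<open>f\<close>, hence kills
  \<open>m\<close>. So \<open>m\<close> factors through \<open>m \<cdot> n\<close>, which gives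
  \<open>n\<close> a section and forces \<open>g\<close> to be zero.\<close>

lemma image_factor:
  assumes f: "f \<in> hom C X Y" and m: "m \<in> hom C M Y" "is_image C f m"
  shows "monic C m" "\<exists>e\<in>hom C X M. m \<cdot> e = f \<and> epic C e"
proof -
  obtain c where c: "is_cokernel C f c" "is_kernel C c m" using m by (auto simp: is_image_def)
  define Q where "Q = Cod C c"
  have ch: "c \<in> hom C Y Q" unfolding Q_def using is_cokernel_hom c(1) f by blast
  note QQ = is_cokernelD[OF c(1) f ch] and K = is_kernelD[OF c(2) ch m(1)]
  show mm: "monic C m" by (rule K(3))
  obtain e where e: "e \<in> hom C X M" "m \<cdot> e = f" using K(2)[OF f QQ(1)] by blast
  have "epic C e"
  proof (rule epicI[OF e(1)])
    fix W g assume g: "g \<in> hom C M W" "g \<cdot> e = \<zero> X W"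
    obtain N n where n: "n \<in> hom C N M" "is_kernel C g n" using g(1) by (rule kernelE)
    note N = is_kernelD[OF n(2) g(1) n(1)]
    obtain e' where e': "e' \<in> hom C X N" "n \<cdot> e' = e" using N(2)[OF e(1) g(2)] by blast
    have mn: "m \<cdot> n \<in> hom C N Y" "monic C (m \<cdot> n)"
      using monic_comp[OF N(3) n(1) mm m(1)] comp_hom n(1) m(1) by auto
    obtain h where h: "is_kernel C h (m \<cdot> n)" using monic_normal mn(2) by blast
    then obtain Z where hh: "h \<in> hom C Y Z" using mn by (auto simp: is_kernel_def hom_def)
    note H = is_kernelD[OF h hh mn(1)]
    have "h \<cdot> f = (h \<cdot> (m \<cdot> n)) \<cdot> e'"
      using e(2)[symmetric] e'(2)[symmetric] e(1) e'(1) m(1) n(1) hh by (auto simp: hom_def)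
    also have "\<dots> = \<zero> X Z" using H(1) zero_comp e'(1) hom_obj(2)[OF hh] by simp
    finally obtain h' where h': "h' \<in> hom C Q Z" "h' \<cdot> c = h" using QQ(2)[OF hh] by blast
    have "h \<cdot> m = h' \<cdot> c \<cdot> m" using h'(2)[symmetric] h'(1) ch m(1) by (auto simp: hom_def)
    also have "\<dots> = \<zero> M Z" using K(1) comp_zero h'(1) hom_obj(1)[OF m(1)] by simp
    finally obtain t where t: "t \<in> hom C M N" "(m \<cdot> n) \<cdot> t = m" using H(2)[OF m(1)] by blast
    have "m \<cdot> n \<cdot> t = m \<cdot> \<i>\<d> M" using t m(1) n(1) by (auto simp: hom_def)
    then have nt: "n \<cdot> t = \<i>\<d> M"
      using monicD[OF mm m(1)] t(1) n(1) comp_hom hom_obj(1)[OF m(1)] id_hom by metis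
    have "g = g \<cdot> n \<cdot> t" using nt g(1) by (simp add: comp_id_right)
    also have "\<dots> = (g \<cdot> n) \<cdot> t" using g(1) n(1) t(1) by (auto simp: hom_def)
    also have "\<dots> = \<zero> M W" using N(1) t(1) zero_comp hom_obj(2)[OF g(1)] by simp
    finally show "g = \<zero> M W" .
  qed
  then show "\<exists>e\<in>hom C X M. m \<cdot> e = f \<and> epic C e" using e by blast
qed

lemma imageE:
  assumes "f \<in> hom C X Y"
  obtains M m e where "m \<in> hom C M Y" "e \<in> hom C X M" "m \<cdot> e = f" "monic C m" "epic C e"
proof -
  obtain Q c where c: "c \<in> hom C Y Q" "is_cokernel C f c" using assms by (rule cokernelE)
  obtain M m where m: "m \<in> hom C M Y" "is_kernel C c m" using c(1) by (rule kernelE)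
  have "is_image C f m" using c m by (auto simp: is_image_def)
  from image_factor[OF assms m(1) this] that m(1) show ?thesis by blast
qed

text \<open>Precomposing with an epimorphism does not change the cokernel, and \<open>m\<close> is
  the kernel of its own cokernel.\<close>

lemma is_imageI:
  assumes "m \<in> hom C M Y" "e \<in> hom C X M" "monic C m" "epic C e"
  shows "is_image C (m \<cdot> e) m"
proof -
  obtain Q c where c: "c \<in> hom C Y Q" "is_cokernel C m c" using assms(1) by (rule cokernelE)
  note QQ = is_cokernelD[OF c(2) assms(1) c(1)]
  have me: "m \<cdot> e \<in> hom C X Y" using assms comp_hom by blast
  have "is_cokernel C (m \<cdot> e) c"
  proof (rule is_cokernelI[OF me c(1)])
    have "c \<cdot> m \<cdot> e = (c \<cdot> m) \<cdot> e" using c(1) assms by (auto simp: hom_def)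
    then show "c \<cdot> m \<cdot> e = \<zero> X Q" using QQ(1) assms(2) zero_comp hom_obj(2)[OF c(1)] by simp
    show "epic C c" by (rule QQ(3))
    fix W h assume h: "h \<in> hom C Y W" "h \<cdot> m \<cdot> e = \<zero> X W"
    have "(h \<cdot> m) \<cdot> e = \<zero> X W" using h assms by (auto simp: hom_def)
    then have "h \<cdot> m = \<zero> M W" using epic_zeroD[OF assms(4,2)] h(1) assms(1) comp_hom by blast
    then show "\<exists>u\<in>hom C Q W. u \<cdot> c = h" using QQ(2)[OF h(1)] by blast
  qed
  moreover have "is_kernel C c m" using monic_kernel_of_cokernel assms c by blast
  ultimately show ?thesis by (auto simp: is_image_def)
qed

end


section \<open>Unit coherence and duality\<close>

context linear_symmetric_monoidal_category
begin

lemma tensor_arr [simp]: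
  assumes "f \<in> Arr C" "g \<in> Arr C"
  shows "f \<boxtimes> g \<in> Arr C" "Dom C (f \<boxtimes> g) = Dom C f \<otimes> Dom C g" "Cod C (f \<boxtimes> g) = Cod C f \<otimes> Cod C g"
  using tensor_hom[of f "Dom C f" "Cod C f" g "Dom C g" "Cod C g"] assms by (auto simp: hom_def)

declare unit_obj [simp] tensor_obj [simp] tensor_id [simp]

lemma interchange [simp]:
  "\<lbrakk>f \<in> Arr C; f' \<in> Arr C; g \<in> Arr C; g' \<in> Arr C; Cod C f = Dom C f'; Cod C g = Dom C g'\<rbrakk>
    \<Longrightarrow> (f' \<boxtimes> g') \<cdot> (f \<boxtimes> g) = (f' \<cdot> f) \<boxtimes> (g' \<cdot> g)"
  using tensor_comp[of f "Dom C f" "Cod C f" f' "Cod C f'" g "Dom C g" "Cod C g" g' "Cod C g'"]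
  by (auto simp: hom_def)

text \<open>The interchange law at the head of a longer composite, where the right-nested normal
  form given by \<open>assoc\<close> hides the left side of \<open>interchange\<close>.\<close>

lemma interchange_comp [simp]:
  "\<lbrakk>f \<in> Arr C; f' \<in> Arr C; g \<in> Arr C; g' \<in> Arr C; x \<in> Arr C; Cod C f = Dom C f'; Cod C g = Dom C g';
    Cod C x = Dom C f \<otimes> Dom C g\<rbrakk>
    \<Longrightarrow> (f' \<boxtimes> g') \<cdot> (f \<boxtimes> g) \<cdot> x = ((f' \<cdot> f) \<boxtimes> (g' \<cdot> g)) \<cdot> x"
  by (subst interchange[symmetric]) (simp_all del: interchange)

abbreviation assoc_inv ("\<a>\<^sup>i") where "\<a>\<^sup>i X Y Z \<equiv> inv_arr C (\<a> X Y Z)"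
abbreviation lunit_inv ("\<l>\<^sup>i") where "\<l>\<^sup>i X \<equiv> inv_arr C (\<l> X)"
abbreviation runit_inv ("\<r>\<^sup>i") where "\<r>\<^sup>i X \<equiv> inv_arr C (\<r> X)"

lemma structure_arr [simp]:
  assumes "X \<in> Obj C"
  shows "\<l> X \<in> Arr C" "Dom C (\<l> X) = \<one> \<otimes> X" "Cod C (\<l> X) = X"
    and "\<r> X \<in> Arr C" "Dom C (\<r> X) = X \<otimes> \<one>" "Cod C (\<r> X) = X"
    and "\<l>\<^sup>i X \<in> Arr C" "Dom C (\<l>\<^sup>i X) = X" "Cod C (\<l>\<^sup>i X) = \<one> \<otimes> X"
    and "\<r>\<^sup>i X \<in> Arr C" "Dom C (\<r>\<^sup>i X) = X" "Cod C (\<r>\<^sup>i X) = X \<otimes> \<one>"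
    and "\<l>\<^sup>i X \<cdot> \<l> X = \<i>\<d> (\<one> \<otimes> X)" "\<l> X \<cdot> \<l>\<^sup>i X = \<i>\<d> X"
    and "\<r>\<^sup>i X \<cdot> \<r> X = \<i>\<d> (X \<otimes> \<one>)" "\<r> X \<cdot> \<r>\<^sup>i X = \<i>\<d> X"
  using lunit_hom[OF assms] runit_hom[OF assms]
    inv_arr[OF lunit_iso lunit_hom, OF assms assms] inv_arr[OF runit_iso runit_hom, OF assms assms]
  by (auto simp: hom_def)

lemma assoc_arr [simp]:
  assumes "X \<in> Obj C" "Y \<in> Obj C" "Z \<in> Obj C"
  shows "\<a> X Y Z \<in> Arr C" "Dom C (\<a> X Y Z) = (X \<otimes> Y) \<otimes> Z" "Cod C (\<a> X Y Z) = X \<otimes> (Y \<otimes> Z)"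
    and "\<a>\<^sup>i X Y Z \<in> Arr C" "Dom C (\<a>\<^sup>i X Y Z) = X \<otimes> (Y \<otimes> Z)" "Cod C (\<a>\<^sup>i X Y Z) = (X \<otimes> Y) \<otimes> Z"
    and "\<a>\<^sup>i X Y Z \<cdot> \<a> X Y Z = \<i>\<d> ((X \<otimes> Y) \<otimes> Z)" "\<a> X Y Z \<cdot> \<a>\<^sup>i X Y Z = \<i>\<d> (X \<otimes> (Y \<otimes> Z))"
  using assoc_hom[OF assms] inv_arr[OF assoc_iso assoc_hom, OF assms assms]
  by (auto simp: hom_def)

lemma braid_arr [simp]:
  assumes "X \<in> Obj C" "Y \<in> Obj C"
  shows "\<c> X Y \<in> Arr C" "Dom C (\<c> X Y) = X \<otimes> Y" "Cod C (\<c> X Y) = Y \<otimes> X"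
    and "\<c> Y X \<cdot> \<c> X Y = \<i>\<d> (X \<otimes> Y)"
  using braid_hom[OF assms] braid_symmetric[OF assms] by (auto simp: hom_def)

text \<open>The sources occur only through \<open>Dom\<close>, so matching the left side determines
  every variable and the equation can be used by \<open>subst\<close>.\<close>

lemma assoc_nat:
  "\<lbrakk>f \<in> Arr C; g \<in> Arr C; h \<in> Arr C; Cod C f = X'; Cod C g = Y'; Cod C h = Z'\<rbrakk>
    \<Longrightarrow> \<a> X' Y' Z' \<cdot> ((f \<boxtimes> g) \<boxtimes> h) = (f \<boxtimes> (g \<boxtimes> h)) \<cdot> \<a> (Dom C f) (Dom C g) (Dom C h)"
  using assoc_natural[of f "Dom C f" X' g "Dom C g" Y' h "Dom C h" Z'] by (auto simp: hom_def)

lemma inv_left_cancel: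
  assumes "i \<in> Arr C" "j \<in> Arr C" "Cod C i = Dom C j" "j \<cdot> i = \<i>\<d> (Dom C i)" "x \<in> Arr C" "Cod C x = Dom C i"
  shows "j \<cdot> i \<cdot> x = x"
  by (metis assms assoc id_left)

lemma inv_cancel [simp]:
  "\<lbrakk>X \<in> Obj C; Y \<in> Obj C; Z \<in> Obj C; x \<in> Arr C; Cod C x = (X \<otimes> Y) \<otimes> Z\<rbrakk> \<Longrightarrow> \<a>\<^sup>i X Y Z \<cdot> \<a> X Y Z \<cdot> x = x"
  "\<lbrakk>X \<in> Obj C; Y \<in> Obj C; Z \<in> Obj C; x \<in> Arr C; Cod C x = X \<otimes> (Y \<otimes> Z)\<rbrakk> \<Longrightarrow> \<a> X Y Z \<cdot> \<a>\<^sup>i X Y Z \<cdot> x = x"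
  "\<lbrakk>X \<in> Obj C; x \<in> Arr C; Cod C x = X\<rbrakk> \<Longrightarrow> \<l> X \<cdot> \<l>\<^sup>i X \<cdot> x = x"
  "\<lbrakk>X \<in> Obj C; x \<in> Arr C; Cod C x = \<one> \<otimes> X\<rbrakk> \<Longrightarrow> \<l>\<^sup>i X \<cdot> \<l> X \<cdot> x = x"
  "\<lbrakk>X \<in> Obj C; x \<in> Arr C; Cod C x = X\<rbrakk> \<Longrightarrow> \<r> X \<cdot> \<r>\<^sup>i X \<cdot> x = x"
  "\<lbrakk>X \<in> Obj C; x \<in> Arr C; Cod C x = X \<otimes> \<one>\<rbrakk> \<Longrightarrow> \<r>\<^sup>i X \<cdot> \<r> X \<cdot> x = x"
  by (rule inv_left_cancel; simp)+

lemma iso_cancel_left: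
  assumes "i \<in> Arr C" "j \<in> Arr C" "Cod C i = Dom C j" "j \<cdot> i = \<i>\<d> (Dom C i)"
    and "f \<in> Arr C" "g \<in> Arr C" "Cod C f = Dom C i" "Cod C g = Dom C i" "i \<cdot> f = i \<cdot> g"
  shows "f = g"
  by (metis assms assoc id_left)

lemma iso_cancel_right:
  assumes "i \<in> Arr C" "j \<in> Arr C" "Cod C j = Dom C i" "i \<cdot> j = \<i>\<d> (Cod C i)"
    and "f \<in> Arr C" "g \<in> Arr C" "Dom C f = Cod C i" "Dom C g = Cod C i" "f \<cdot> i = g \<cdot> i"
  shows "f = g"
  by (metis assms assoc id_right)

text \<open>\<open>\<r>\<close> is a natural isomorphism from tensoring with \<open>\<one>\<close>
  to the identity functor. Equations may therefore be checked after tensoring with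
  \<open>\<one>\<close>, where pentagon and triangle apply.\<close>

lemma tensor_unit_faithful_right:
  assumes "f \<in> hom C X Y" "g \<in> hom C X Y" "f \<boxtimes> \<i>\<d> \<one> = g \<boxtimes> \<i>\<d> \<one>"
  shows "f = g"
proof (rule iso_cancel_right[of "\<r> X" "\<r>\<^sup>i X"])
  show "f \<cdot> \<r> X = g \<cdot> \<r> X"
    using runit_natural[OF assms(1)] runit_natural[OF assms(2)] assms(3) by simp
qed (use assms hom_obj[OF assms(1)] in \<open>auto simp: hom_def\<close>)

lemma tensor_unit_faithful_left:
  assumes "f \<in> hom C X Y" "g \<in> hom C X Y" "\<i>\<d> \<one> \<boxtimes> f = \<i>\<d> \<one> \<boxtimes> g"
  shows "f = g"
proof (rule iso_cancel_right[of "\<l> X" "\<l>\<^sup>i X"])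
  show "f \<cdot> \<l> X = g \<cdot> \<l> X"
    using lunit_natural[OF assms(1)] lunit_natural[OF assms(2)] assms(3) by simp
qed (use assms hom_obj[OF assms(1)] in \<open>auto simp: hom_def\<close>)

text \<open>Kelly's derivation of a unit coherence absent from the axioms: after tensoring with
  \<open>\<one>\<close>, the triangle for \<open>X, \<one>\<close>, the pentagon for
  \<open>W, X, \<one>, \<one>\<close> and the triangle for \<open>W \<otimes> X, \<one>\<close>
  identify the two sides up to an associator.\<close>

lemma runit_tensor:
  assumes [simp]: "W \<in> Obj C" "X \<in> Obj C"
  shows "(\<i>\<d> W \<boxtimes> \<r> X) \<cdot> \<a> W X \<one> = \<r> (W \<otimes> X)"
proof (rule tensor_unit_faithful_right)
  show "(\<i>\<d> W \<boxtimes> \<r> X) \<cdot> \<a> W X \<one> \<in> hom C ((W \<otimes> X) \<otimes> \<one>) (W \<otimes> X)" "\<r> (W \<otimes> X) \<in> hom C ((W \<otimes> X) \<otimes> \<one>) (W \<otimes> X)"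
    by (simp_all add: hom_def)
  let ?L = "((\<i>\<d> W \<boxtimes> \<r> X) \<cdot> \<a> W X \<one>) \<boxtimes> \<i>\<d> \<one>" and ?R = "\<r> (W \<otimes> X) \<boxtimes> \<i>\<d> \<one>"
  have "\<a> W X \<one> \<cdot> ?L = \<a> W X \<one> \<cdot> ((\<i>\<d> W \<boxtimes> \<r> X) \<boxtimes> \<i>\<d> \<one>) \<cdot> (\<a> W X \<one> \<boxtimes> \<i>\<d> \<one>)"
    by simp
  also have "\<dots> = (\<i>\<d> W \<boxtimes> (\<r> X \<boxtimes> \<i>\<d> \<one>)) \<cdot> \<a> W (X \<otimes> \<one>) \<one> \<cdot> (\<a> W X \<one> \<boxtimes> \<i>\<d> \<one>)"
    by (subst comp_cong_right[OF assoc_nat]) simp_all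
  also have "\<dots> = (\<i>\<d> W \<boxtimes> (\<i>\<d> X \<boxtimes> \<l> \<one>)) \<cdot> (\<i>\<d> W \<boxtimes> \<a> X \<one> \<one>) \<cdot> \<a> W (X \<otimes> \<one>) \<one> \<cdot> (\<a> W X \<one> \<boxtimes> \<i>\<d> \<one>)"
    by (simp flip: triangle)
  also have "\<dots> = (\<i>\<d> W \<boxtimes> (\<i>\<d> X \<boxtimes> \<l> \<one>)) \<cdot> \<a> W X (\<one> \<otimes> \<one>) \<cdot> \<a> (W \<otimes> X) \<one> \<one>"
    by (simp only: pentagon assms unit_obj)
  also have "\<dots> = \<a> W X \<one> \<cdot> ((\<i>\<d> W \<boxtimes> \<i>\<d> X) \<boxtimes> \<l> \<one>) \<cdot> \<a> (W \<otimes> X) \<one> \<one>"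
    by (subst comp_cong_right[OF assoc_nat]) simp_all
  also have "\<dots> = \<a> W X \<one> \<cdot> ?R"
    using triangle[of "W \<otimes> X" \<one>] by simp
  finally have "\<a> W X \<one> \<cdot> ?L = \<a> W X \<one> \<cdot> ?R" .
  then show "?L = ?R"
    by (rule iso_cancel_left[of "\<a> W X \<one>" "\<a>\<^sup>i W X \<one>", rotated 8]) simp_all
qed

lemma lunit_tensor:
  assumes [simp]: "X \<in> Obj C" "Z \<in> Obj C"
  shows "\<l> (X \<otimes> Z) \<cdot> \<a> \<one> X Z = \<l> X \<boxtimes> \<i>\<d> Z"
proof (rule tensor_unit_faithful_left)
  show "\<l> (X \<otimes> Z) \<cdot> \<a> \<one> X Z \<in> hom C ((\<one> \<otimes> X) \<otimes> Z) (X \<otimes> Z)" "\<l> X \<boxtimes> \<i>\<d> Z \<in> hom C ((\<one> \<otimes> X) \<otimes> Z) (X \<otimes> Z)"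
    by (simp_all add: hom_def)
  let ?L = "\<i>\<d> \<one> \<boxtimes> (\<l> (X \<otimes> Z) \<cdot> \<a> \<one> X Z)" and ?R = "\<i>\<d> \<one> \<boxtimes> (\<l> X \<boxtimes> \<i>\<d> Z)"
  \<comment> \<open>An invertible arrow that completes \<open>?L\<close> to one side of the pentagon
    for \<open>\<one>, \<one>, X, Z\<close>; it is cancelled at the end.\<close>
  let ?i = "\<a> \<one> (\<one> \<otimes> X) Z \<cdot> (\<a> \<one> \<one> X \<boxtimes> \<i>\<d> Z)"
  have "?L \<cdot> ?i = (\<i>\<d> \<one> \<boxtimes> \<l> (X \<otimes> Z)) \<cdot> (\<i>\<d> \<one> \<boxtimes> \<a> \<one> X Z) \<cdot> \<a> \<one> (\<one> \<otimes> X) Z \<cdot> (\<a> \<one> \<one> X \<boxtimes> \<i>\<d> Z)"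
    by simp
  also have "\<dots> = (\<i>\<d> \<one> \<boxtimes> \<l> (X \<otimes> Z)) \<cdot> \<a> \<one> \<one> (X \<otimes> Z) \<cdot> \<a> (\<one> \<otimes> \<one>) X Z"
    by (simp only: pentagon assms unit_obj)
  also have "\<dots> = (\<r> \<one> \<boxtimes> \<i>\<d> (X \<otimes> Z)) \<cdot> \<a> (\<one> \<otimes> \<one>) X Z"
    by (rule comp_cong_right[OF triangle]) simp_all
  also have "\<dots> = \<a> \<one> X Z \<cdot> ((\<r> \<one> \<boxtimes> \<i>\<d> X) \<boxtimes> \<i>\<d> Z)"
    by (subst assoc_nat) simp_all
  also have "\<dots> = \<a> \<one> X Z \<cdot> ((\<i>\<d> \<one> \<boxtimes> \<l> X) \<boxtimes> \<i>\<d> Z) \<cdot> (\<a> \<one> \<one> X \<boxtimes> \<i>\<d> Z)"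
    by (simp flip: triangle)
  also have "\<dots> = ?R \<cdot> ?i"
    by (subst comp_cong_right[OF assoc_nat]) simp_all
  finally have eq: "?L \<cdot> ?i = ?R \<cdot> ?i" .
  show "?L = ?R"
    by (rule iso_cancel_right[OF _ _ _ _ _ _ _ _ eq, of "(\<a>\<^sup>i \<one> \<one> X \<boxtimes> \<i>\<d> Z) \<cdot> \<a>\<^sup>i \<one> (\<one> \<otimes> X) Z"]) simp_all
qed

end


context linear_symmetric_monoidal_category
begin

text \<open>For \<open>Y\<close> dual to \<open>X\<close>, the functor \<open>- \<otimes> X\<close> is left adjoint to \<open>- \<otimes> Y\<close> and \<open>X \<otimes> -\<close> is right
  adjoint to \<open>Y \<otimes> -\<close>. In each case one of the two round trips is enough for exactness, and
  both of these follow from the first triangle identity.\<close>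

definition transpose :: "'o \<Rightarrow> 'o \<Rightarrow> 'o \<Rightarrow> 'm \<Rightarrow> 'm \<Rightarrow> 'm" where
  "transpose W X Y coev h = (h \<boxtimes> \<i>\<d> Y) \<cdot> \<a>\<^sup>i W X Y \<cdot> (\<i>\<d> W \<boxtimes> coev) \<cdot> \<r>\<^sup>i W"

definition untranspose :: "'o \<Rightarrow> 'o \<Rightarrow> 'o \<Rightarrow> 'm \<Rightarrow> 'm \<Rightarrow> 'm" where
  "untranspose Z X Y ev g = \<r> Z \<cdot> (\<i>\<d> Z \<boxtimes> ev) \<cdot> \<a> Z Y X \<cdot> (g \<boxtimes> \<i>\<d> X)"

definition transpose' :: "'o \<Rightarrow> 'o \<Rightarrow> 'o \<Rightarrow> 'm \<Rightarrow> 'm \<Rightarrow> 'm" where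
  "transpose' W X Y coev g = (\<i>\<d> X \<boxtimes> g) \<cdot> \<a> X Y W \<cdot> (coev \<boxtimes> \<i>\<d> W) \<cdot> \<l>\<^sup>i W"

definition untranspose' :: "'o \<Rightarrow> 'o \<Rightarrow> 'o \<Rightarrow> 'm \<Rightarrow> 'm \<Rightarrow> 'm" where
  "untranspose' Z X Y ev h = \<l> Z \<cdot> (ev \<boxtimes> \<i>\<d> Z) \<cdot> \<a>\<^sup>i Y X Z \<cdot> (\<i>\<d> Y \<boxtimes> h)"

lemma is_dual_arr:
  assumes "is_dual C X Y ev coev"
  shows "X \<in> Obj C" "Y \<in> Obj C" "ev \<in> Arr C" "Dom C ev = Y \<otimes> X" "Cod C ev = \<one>"
    "coev \<in> Arr C" "Dom C coev = \<one>" "Cod C coev = X \<otimes> Y"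
    "\<r> X \<cdot> (\<i>\<d> X \<boxtimes> ev) \<cdot> \<a> X Y X \<cdot> (coev \<boxtimes> \<i>\<d> X) = \<l> X"
    "\<l> Y \<cdot> (ev \<boxtimes> \<i>\<d> Y) \<cdot> \<a>\<^sup>i Y X Y \<cdot> (\<i>\<d> Y \<boxtimes> coev) = \<r> Y"
  using assms by (auto simp: is_dual_def hom_def)

lemma transpose_hom:
  "is_dual C X Y ev coev \<Longrightarrow> h \<in> hom C (W \<otimes> X) Z \<Longrightarrow> W \<in> Obj C \<Longrightarrow> transpose W X Y coev h \<in> hom C W (Z \<otimes> Y)"
  using is_dual_arr[of X Y ev coev] by (auto simp: transpose_def hom_def)

lemma untranspose_hom:
  "is_dual C X Y ev coev \<Longrightarrow> g \<in> hom C W (Z \<otimes> Y) \<Longrightarrow> Z \<in> Obj C \<Longrightarrow> untranspose Z X Y ev g \<in> hom C (W \<otimes> X) Z"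
  using is_dual_arr[of X Y ev coev] by (auto simp: untranspose_def hom_def)

lemma transpose'_hom:
  "is_dual C X Y ev coev \<Longrightarrow> g \<in> hom C (Y \<otimes> W) Z \<Longrightarrow> W \<in> Obj C \<Longrightarrow> transpose' W X Y coev g \<in> hom C W (X \<otimes> Z)"
  using is_dual_arr[of X Y ev coev] by (auto simp: transpose'_def hom_def)

lemma untranspose'_hom:
  "is_dual C X Y ev coev \<Longrightarrow> h \<in> hom C W (X \<otimes> Z) \<Longrightarrow> Z \<in> Obj C \<Longrightarrow> untranspose' Z X Y ev h \<in> hom C (Y \<otimes> W) Z"
  using is_dual_arr[of X Y ev coev] by (auto simp: untranspose'_def hom_def)

text \<open>The left side is \<open>untranspose\<close> applied to the \<open>transpose\<close> of
  the identity of \<open>W \<otimes> X\<close>. Up to associators and unitors it is the first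
  triangle identity tensored with \<open>W\<close> on the left.\<close>

lemma whiskered_triangle:
  assumes d: "is_dual C X Y ev coev" and [simp]: "W \<in> Obj C"
  shows "\<r> (W \<otimes> X) \<cdot> (\<i>\<d> (W \<otimes> X) \<boxtimes> ev) \<cdot> \<a> (W \<otimes> X) Y X \<cdot>
    ((\<a>\<^sup>i W X Y \<cdot> (\<i>\<d> W \<boxtimes> coev) \<cdot> \<r>\<^sup>i W) \<boxtimes> \<i>\<d> X) = \<i>\<d> (W \<otimes> X)" (is "?l = _")
proof -
  note [simp] = is_dual_arr(1-8)[OF d]
  have "\<a> W X (Y \<otimes> X) \<cdot> \<a> (W \<otimes> X) Y X \<cdot> ((\<a>\<^sup>i W X Y \<cdot> (\<i>\<d> W \<boxtimes> coev) \<cdot> \<r>\<^sup>i W) \<boxtimes> \<i>\<d> X) =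
    (\<a> W X (Y \<otimes> X) \<cdot> \<a> (W \<otimes> X) Y X) \<cdot> ((\<a>\<^sup>i W X Y \<cdot> (\<i>\<d> W \<boxtimes> coev) \<cdot> \<r>\<^sup>i W) \<boxtimes> \<i>\<d> X)"
    by simp
  also have "\<dots> = (\<i>\<d> W \<boxtimes> \<a> X Y X) \<cdot> \<a> W (X \<otimes> Y) X \<cdot> (((\<i>\<d> W \<boxtimes> coev) \<cdot> \<r>\<^sup>i W) \<boxtimes> \<i>\<d> X)"
    by (subst pentagon) simp_all
  also have "\<dots> = (\<i>\<d> W \<boxtimes> \<a> X Y X) \<cdot> \<a> W (X \<otimes> Y) X \<cdot> ((\<i>\<d> W \<boxtimes> coev) \<boxtimes> \<i>\<d> X) \<cdot> (\<r>\<^sup>i W \<boxtimes> \<i>\<d> X)"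
    by simp
  also have "\<dots> = (\<i>\<d> W \<boxtimes> (\<a> X Y X \<cdot> (coev \<boxtimes> \<i>\<d> X))) \<cdot> \<a> W \<one> X \<cdot> (\<r>\<^sup>i W \<boxtimes> \<i>\<d> X)"
    by (subst comp_cong_right[OF assoc_nat]) simp_all
  finally have 1: "\<a> W X (Y \<otimes> X) \<cdot> \<a> (W \<otimes> X) Y X \<cdot> ((\<a>\<^sup>i W X Y \<cdot> (\<i>\<d> W \<boxtimes> coev) \<cdot> \<r>\<^sup>i W) \<boxtimes> \<i>\<d> X) =
    (\<i>\<d> W \<boxtimes> (\<a> X Y X \<cdot> (coev \<boxtimes> \<i>\<d> X))) \<cdot> \<a> W \<one> X \<cdot> (\<r>\<^sup>i W \<boxtimes> \<i>\<d> X)" (is "_ \<cdot> ?t = ?s") .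
  have "?l = (\<i>\<d> W \<boxtimes> \<r> X) \<cdot> \<a> W X \<one> \<cdot> ((\<i>\<d> W \<boxtimes> \<i>\<d> X) \<boxtimes> ev) \<cdot> ?t"
    by (simp flip: runit_tensor)
  also have "\<dots> = (\<i>\<d> W \<boxtimes> (\<r> X \<cdot> (\<i>\<d> X \<boxtimes> ev))) \<cdot> \<a> W X (Y \<otimes> X) \<cdot> ?t"
    by (subst comp_cong_right[OF assoc_nat]) simp_all
  also have "\<dots> = (\<i>\<d> W \<boxtimes> (\<r> X \<cdot> (\<i>\<d> X \<boxtimes> ev))) \<cdot> ?s"
    by (subst 1) simp
  also have "\<dots> = (\<i>\<d> W \<boxtimes> (\<r> X \<cdot> (\<i>\<d> X \<boxtimes> ev) \<cdot> \<a> X Y X \<cdot> (coev \<boxtimes> \<i>\<d> X))) \<cdot> \<a> W \<one> X \<cdot> (\<r>\<^sup>i W \<boxtimes> \<i>\<d> X)"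
    by simp
  also have "\<dots> = (\<i>\<d> W \<boxtimes> \<l> X) \<cdot> \<a> W \<one> X \<cdot> (\<r>\<^sup>i W \<boxtimes> \<i>\<d> X)"
    by (simp only: is_dual_arr(9)[OF d])
  also have "\<dots> = (\<r> W \<boxtimes> \<i>\<d> X) \<cdot> (\<r>\<^sup>i W \<boxtimes> \<i>\<d> X)"
    by (rule comp_cong_right[OF triangle]) simp_all
  also have "\<dots> = \<i>\<d> (W \<otimes> X)" by simp
  finally show ?thesis .
qed

lemma runit_nat: "f \<in> Arr C \<Longrightarrow> Cod C f = Z \<Longrightarrow> \<r> Z \<cdot> (f \<boxtimes> \<i>\<d> \<one>) = f \<cdot> \<r> (Dom C f)"
  using runit_natural[of f "Dom C f" Z] by (simp add: hom_def)

lemma lunit_nat: "f \<in> Arr C \<Longrightarrow> Cod C f = Z \<Longrightarrow> \<l> Z \<cdot> (\<i>\<d> \<one> \<boxtimes> f) = f \<cdot> \<l> (Dom C f)"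
  using lunit_natural[of f "Dom C f" Z] by (simp add: hom_def)

text \<open>Naturality of the associator and of \<open>\<r>\<close> moves \<open>h\<close> to the
  far left; what remains is the round trip at an identity.\<close>

lemma untranspose_transpose:
  assumes d: "is_dual C X Y ev coev" and h: "h \<in> hom C (W \<otimes> X) Z" and [simp]: "W \<in> Obj C"
  shows "untranspose Z X Y ev (transpose W X Y coev h) = h"
proof -
  note [simp] = is_dual_arr(1-8)[OF d]
  have [simp]: "h \<in> Arr C" "Dom C h = W \<otimes> X" "Cod C h = Z" "Z \<in> Obj C"
    using h hom_obj[OF h] by (auto simp: hom_def)
  let ?t = "\<a>\<^sup>i W X Y \<cdot> (\<i>\<d> W \<boxtimes> coev) \<cdot> \<r>\<^sup>i W"
  have "untranspose Z X Y ev (transpose W X Y coev h) =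
      \<r> Z \<cdot> (\<i>\<d> Z \<boxtimes> ev) \<cdot> \<a> Z Y X \<cdot> ((h \<boxtimes> \<i>\<d> Y) \<boxtimes> \<i>\<d> X) \<cdot> (?t \<boxtimes> \<i>\<d> X)"
    by (simp add: transpose_def untranspose_def)
  also have "\<dots> = \<r> Z \<cdot> (\<i>\<d> Z \<boxtimes> ev) \<cdot> (h \<boxtimes> \<i>\<d> (Y \<otimes> X)) \<cdot> \<a> (W \<otimes> X) Y X \<cdot> (?t \<boxtimes> \<i>\<d> X)"
    by (subst comp_cong_right[OF assoc_nat]) simp_all
  also have "\<dots> = \<r> Z \<cdot> (h \<boxtimes> \<i>\<d> \<one>) \<cdot> (\<i>\<d> (W \<otimes> X) \<boxtimes> ev) \<cdot> \<a> (W \<otimes> X) Y X \<cdot> (?t \<boxtimes> \<i>\<d> X)"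
    by simp
  also have "\<dots> = h \<cdot> \<r> (W \<otimes> X) \<cdot> (\<i>\<d> (W \<otimes> X) \<boxtimes> ev) \<cdot> \<a> (W \<otimes> X) Y X \<cdot> (?t \<boxtimes> \<i>\<d> X)"
    by (subst comp_cong_right[OF runit_nat]) simp_all
  also have "\<dots> = h"
    by (simp only: whiskered_triangle[OF d \<open>W \<in> Obj C\<close>]) simp
  finally show ?thesis .
qed

lemma lunit_inv_nat:
  assumes "f \<in> Arr C" "Dom C f = W"
  shows "(\<i>\<d> \<one> \<boxtimes> f) \<cdot> \<l>\<^sup>i W = \<l>\<^sup>i (Cod C f) \<cdot> f"
proof (rule iso_cancel_left[of "\<l> (Cod C f)" "\<l>\<^sup>i (Cod C f)"])
  have "(\<l> (Cod C f) \<cdot> (\<i>\<d> \<one> \<boxtimes> f)) \<cdot> \<l>\<^sup>i W = f"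
    using assms by (subst lunit_nat) auto
  then show "\<l> (Cod C f) \<cdot> (\<i>\<d> \<one> \<boxtimes> f) \<cdot> \<l>\<^sup>i W = \<l> (Cod C f) \<cdot> \<l>\<^sup>i (Cod C f) \<cdot> f"
    using assms by auto
qed (use assms in auto)

text \<open>The mirror round trip, \<open>transpose'\<close> after \<open>untranspose'\<close> at
  the identity of \<open>X \<otimes> Z\<close>. It is again the first triangle identity, now
  tensored with \<open>Z\<close> on the right.\<close>

lemma whiskered_triangle':
  assumes d: "is_dual C X Y ev coev" and [simp]: "Z \<in> Obj C"
  shows "(\<i>\<d> X \<boxtimes> (\<l> Z \<cdot> (ev \<boxtimes> \<i>\<d> Z) \<cdot> \<a>\<^sup>i Y X Z)) \<cdot> \<a> X Y (X \<otimes> Z) \<cdot> (coev \<boxtimes> \<i>\<d> (X \<otimes> Z)) \<cdot> \<l>\<^sup>i (X \<otimes> Z)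
    = \<i>\<d> (X \<otimes> Z)"
proof -
  note [simp] = is_dual_arr(1-8)[OF d]
  let ?s = "\<i>\<d> X \<boxtimes> (\<l> Z \<cdot> (ev \<boxtimes> \<i>\<d> Z) \<cdot> \<a>\<^sup>i Y X Z)"
  \<comment> \<open>Rewrites the inverse unitor of \<open>X \<otimes> Z\<close> as that of
    \<open>X\<close> tensored with \<open>Z\<close>, so that all of the triangle identity takes
    place inside a tensor product with \<open>Z\<close>.\<close>
  have l: "\<l>\<^sup>i (X \<otimes> Z) = \<a> \<one> X Z \<cdot> (\<l>\<^sup>i X \<boxtimes> \<i>\<d> Z)"
  proof (rule iso_cancel_left[of "\<l> (X \<otimes> Z)" "\<l>\<^sup>i (X \<otimes> Z)"])
    have "\<l> (X \<otimes> Z) \<cdot> \<a> \<one> X Z \<cdot> (\<l>\<^sup>i X \<boxtimes> \<i>\<d> Z) = (\<l> X \<boxtimes> \<i>\<d> Z) \<cdot> (\<l>\<^sup>i X \<boxtimes> \<i>\<d> Z)"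
      by (rule comp_cong_right[OF lunit_tensor]) simp_all
    then show "\<l> (X \<otimes> Z) \<cdot> \<l>\<^sup>i (X \<otimes> Z) = \<l> (X \<otimes> Z) \<cdot> \<a> \<one> X Z \<cdot> (\<l>\<^sup>i X \<boxtimes> \<i>\<d> Z)" by simp
  qed simp_all
  have "\<a> (X \<otimes> Y) X Z \<cdot> ((coev \<boxtimes> \<i>\<d> X) \<boxtimes> \<i>\<d> Z) = (coev \<boxtimes> (\<i>\<d> X \<boxtimes> \<i>\<d> Z)) \<cdot> \<a> \<one> X Z"
    by (subst assoc_nat) simp_all
  then have "(coev \<boxtimes> \<i>\<d> (X \<otimes> Z)) \<cdot> \<a> \<one> X Z \<cdot> (\<l>\<^sup>i X \<boxtimes> \<i>\<d> Z) =
      (\<a> (X \<otimes> Y) X Z \<cdot> ((coev \<boxtimes> \<i>\<d> X) \<boxtimes> \<i>\<d> Z)) \<cdot> (\<l>\<^sup>i X \<boxtimes> \<i>\<d> Z)"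
    by simp
  then have "?s \<cdot> \<a> X Y (X \<otimes> Z) \<cdot> (coev \<boxtimes> \<i>\<d> (X \<otimes> Z)) \<cdot> \<l>\<^sup>i (X \<otimes> Z) =
      ?s \<cdot> (\<a> X Y (X \<otimes> Z) \<cdot> \<a> (X \<otimes> Y) X Z) \<cdot> (((coev \<boxtimes> \<i>\<d> X) \<cdot> \<l>\<^sup>i X) \<boxtimes> \<i>\<d> Z)"
    by (simp add: l)
  also have "\<dots> = (\<i>\<d> X \<boxtimes> \<l> Z) \<cdot> (\<i>\<d> X \<boxtimes> (ev \<boxtimes> \<i>\<d> Z)) \<cdot> \<a> X (Y \<otimes> X) Z \<cdot>
      ((\<a> X Y X \<cdot> (coev \<boxtimes> \<i>\<d> X) \<cdot> \<l>\<^sup>i X) \<boxtimes> \<i>\<d> Z)"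
    by (subst pentagon) simp_all
  also have "\<dots> = (\<i>\<d> X \<boxtimes> \<l> Z) \<cdot> (\<a> X \<one> Z \<cdot> ((\<i>\<d> X \<boxtimes> ev) \<boxtimes> \<i>\<d> Z)) \<cdot>
      ((\<a> X Y X \<cdot> (coev \<boxtimes> \<i>\<d> X) \<cdot> \<l>\<^sup>i X) \<boxtimes> \<i>\<d> Z)"
    by (subst assoc_nat) simp_all
  also have "\<dots> = (\<i>\<d> X \<boxtimes> \<l> Z) \<cdot> \<a> X \<one> Z \<cdot>
      (((\<i>\<d> X \<boxtimes> ev) \<cdot> \<a> X Y X \<cdot> (coev \<boxtimes> \<i>\<d> X) \<cdot> \<l>\<^sup>i X) \<boxtimes> \<i>\<d> Z)"
    by simp
  also have "\<dots> = (\<r> X \<boxtimes> \<i>\<d> Z) \<cdot> (((\<i>\<d> X \<boxtimes> ev) \<cdot> \<a> X Y X \<cdot> (coev \<boxtimes> \<i>\<d> X) \<cdot> \<l>\<^sup>i X) \<boxtimes> \<i>\<d> Z)"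
    by (rule comp_cong_right[OF triangle]) simp_all
  also have "\<dots> = ((\<r> X \<cdot> (\<i>\<d> X \<boxtimes> ev) \<cdot> \<a> X Y X \<cdot> (coev \<boxtimes> \<i>\<d> X)) \<cdot> \<l>\<^sup>i X) \<boxtimes> \<i>\<d> Z"
    by simp
  also have "\<dots> = \<i>\<d> (X \<otimes> Z)"
    by (simp only: is_dual_arr(9)[OF d]) simp
  finally show ?thesis .
qed

lemma transpose'_untranspose':
  assumes d: "is_dual C X Y ev coev" and h: "h \<in> hom C W (X \<otimes> Z)" and [simp]: "Z \<in> Obj C"
  shows "transpose' W X Y coev (untranspose' Z X Y ev h) = h"
proof -
  note [simp] = is_dual_arr(1-8)[OF d]
  have [simp]: "h \<in> Arr C" "Cod C h = X \<otimes> Z" "Dom C h = W" "W \<in> Obj C"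
    using h hom_obj[OF h] by (auto simp: hom_def)
  let ?s = "\<i>\<d> X \<boxtimes> (\<l> Z \<cdot> (ev \<boxtimes> \<i>\<d> Z) \<cdot> \<a>\<^sup>i Y X Z)"
  have "transpose' W X Y coev (untranspose' Z X Y ev h) =
      ?s \<cdot> ((\<i>\<d> X \<boxtimes> (\<i>\<d> Y \<boxtimes> h)) \<cdot> \<a> X Y W) \<cdot> (coev \<boxtimes> \<i>\<d> W) \<cdot> \<l>\<^sup>i W"
    by (simp add: transpose'_def untranspose'_def)
  also have "(\<i>\<d> X \<boxtimes> (\<i>\<d> Y \<boxtimes> h)) \<cdot> \<a> X Y W = \<a> X Y (X \<otimes> Z) \<cdot> ((\<i>\<d> X \<boxtimes> \<i>\<d> Y) \<boxtimes> h)"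
    by (subst assoc_nat) simp_all
  also have "?s \<cdot> (\<a> X Y (X \<otimes> Z) \<cdot> ((\<i>\<d> X \<boxtimes> \<i>\<d> Y) \<boxtimes> h)) \<cdot> (coev \<boxtimes> \<i>\<d> W) \<cdot> \<l>\<^sup>i W =
      ?s \<cdot> \<a> X Y (X \<otimes> Z) \<cdot> (coev \<boxtimes> \<i>\<d> (X \<otimes> Z)) \<cdot> ((\<i>\<d> \<one> \<boxtimes> h) \<cdot> \<l>\<^sup>i W)"
    by simp
  also have "\<dots> = (?s \<cdot> \<a> X Y (X \<otimes> Z) \<cdot> (coev \<boxtimes> \<i>\<d> (X \<otimes> Z)) \<cdot> \<l>\<^sup>i (X \<otimes> Z)) \<cdot> h"
    by (subst lunit_inv_nat) simp_all
  also have "\<dots> = h"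
    by (simp only: whiskered_triangle'[OF d \<open>Z \<in> Obj C\<close>]) simp
  finally show ?thesis .
qed

lemma transpose_natural:
  assumes "is_dual C X Y ev coev" "f \<in> hom C W' W" "h \<in> hom C (W \<otimes> X) Z"
  shows "transpose W' X Y coev (h \<cdot> (f \<boxtimes> \<i>\<d> X)) = transpose W X Y coev h \<cdot> f"
proof -
  note [simp] = is_dual_arr(1-8)[OF assms(1)]
  have [simp]: "f \<in> Arr C" "Cod C f = W" "Dom C f = W'" "W \<in> Obj C" "W' \<in> Obj C"
    "h \<in> Arr C" "Dom C h = W \<otimes> X" "Cod C h = Z"
    using assms(2-) hom_obj[OF assms(2)] by (auto simp: hom_def)
  have r: "\<r>\<^sup>i W \<cdot> f = (f \<boxtimes> \<i>\<d> \<one>) \<cdot> \<r>\<^sup>i W'"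
  proof (rule iso_cancel_left[of "\<r> W" "\<r>\<^sup>i W"])
    have "(\<r> W \<cdot> (f \<boxtimes> \<i>\<d> \<one>)) \<cdot> \<r>\<^sup>i W' = f" by (subst runit_nat) simp_all
    then show "\<r> W \<cdot> \<r>\<^sup>i W \<cdot> f = \<r> W \<cdot> (f \<boxtimes> \<i>\<d> \<one>) \<cdot> \<r>\<^sup>i W'" by simp
  qed simp_all
  have a: "((f \<boxtimes> \<i>\<d> X) \<boxtimes> \<i>\<d> Y) \<cdot> \<a>\<^sup>i W' X Y = \<a>\<^sup>i W X Y \<cdot> (f \<boxtimes> \<i>\<d> (X \<otimes> Y))"
  proof (rule iso_cancel_left[of "\<a> W X Y" "\<a>\<^sup>i W X Y"])
    have "(\<a> W X Y \<cdot> ((f \<boxtimes> \<i>\<d> X) \<boxtimes> \<i>\<d> Y)) \<cdot> \<a>\<^sup>i W' X Y = f \<boxtimes> \<i>\<d> (X \<otimes> Y)"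
      by (subst assoc_nat) simp_all
    then show "\<a> W X Y \<cdot> ((f \<boxtimes> \<i>\<d> X) \<boxtimes> \<i>\<d> Y) \<cdot> \<a>\<^sup>i W' X Y = \<a> W X Y \<cdot> \<a>\<^sup>i W X Y \<cdot> (f \<boxtimes> \<i>\<d> (X \<otimes> Y))"
      by simp
  qed simp_all
  have "transpose W' X Y coev (h \<cdot> (f \<boxtimes> \<i>\<d> X)) =
      (h \<boxtimes> \<i>\<d> Y) \<cdot> (((f \<boxtimes> \<i>\<d> X) \<boxtimes> \<i>\<d> Y) \<cdot> \<a>\<^sup>i W' X Y) \<cdot> (\<i>\<d> W' \<boxtimes> coev) \<cdot> \<r>\<^sup>i W'"
    by (simp add: transpose_def)
  also have "\<dots> = (h \<boxtimes> \<i>\<d> Y) \<cdot> \<a>\<^sup>i W X Y \<cdot> (\<i>\<d> W \<boxtimes> coev) \<cdot> ((f \<boxtimes> \<i>\<d> \<one>) \<cdot> \<r>\<^sup>i W')"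
    by (subst a) simp_all
  also have "\<dots> = transpose W X Y coev h \<cdot> f"
    by (simp add: transpose_def flip: r)
  finally show ?thesis .
qed

lemma untranspose_natural:
  assumes "is_dual C X Y ev coev" "f \<in> hom C W' W" "g \<in> hom C W (Z \<otimes> Y)" "Z \<in> Obj C"
  shows "untranspose Z X Y ev (g \<cdot> f) = untranspose Z X Y ev g \<cdot> (f \<boxtimes> \<i>\<d> X)"
  using assms is_dual_arr(1-8)[OF assms(1)] by (auto simp: untranspose_def hom_def)

text \<open>Naturality in the target: a lift of a transposed arrow through
  \<open>p \<boxtimes> \<i>\<d> Y\<close> becomes a lift of the arrow itself through
  \<open>p\<close>. This produces the section in the proof of
  \<open>tensor_no_zero_divisors\<close>.\<close>

lemma untranspose_natural_right:
  assumes "is_dual C X Y ev coev" "p \<in> hom C Z Z'" "g \<in> hom C W (Z \<otimes> Y)"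
  shows "untranspose Z' X Y ev ((p \<boxtimes> \<i>\<d> Y) \<cdot> g) = p \<cdot> untranspose Z X Y ev g"
proof -
  note [simp] = is_dual_arr(1-8)[OF assms(1)]
  have [simp]: "p \<in> Arr C" "Dom C p = Z" "Cod C p = Z'" "Z \<in> Obj C" "Z' \<in> Obj C"
    "g \<in> Arr C" "Dom C g = W" "Cod C g = Z \<otimes> Y" "W \<in> Obj C"
    using assms(2-) hom_obj[OF assms(2)] hom_obj[OF assms(3)] by (auto simp: hom_def)
  have "untranspose Z' X Y ev ((p \<boxtimes> \<i>\<d> Y) \<cdot> g) =
      \<r> Z' \<cdot> (\<i>\<d> Z' \<boxtimes> ev) \<cdot> \<a> Z' Y X \<cdot> ((p \<boxtimes> \<i>\<d> Y) \<boxtimes> \<i>\<d> X) \<cdot> (g \<boxtimes> \<i>\<d> X)"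
    by (simp add: untranspose_def)
  also have "\<dots> = \<r> Z' \<cdot> (p \<boxtimes> \<i>\<d> \<one>) \<cdot> (\<i>\<d> Z \<boxtimes> ev) \<cdot> \<a> Z Y X \<cdot> (g \<boxtimes> \<i>\<d> X)"
    by (subst comp_cong_right[OF assoc_nat]) simp_all
  also have "\<dots> = p \<cdot> untranspose Z X Y ev g"
    by (subst comp_cong_right[OF runit_nat]) (simp_all add: untranspose_def)
  finally show ?thesis .
qed

lemma transpose'_natural:
  assumes "is_dual C X Y ev coev" "f \<in> hom C Z Z'" "g \<in> hom C (Y \<otimes> W) Z" "W \<in> Obj C"
  shows "transpose' W X Y coev (f \<cdot> g) = (\<i>\<d> X \<boxtimes> f) \<cdot> transpose' W X Y coev g"
  using assms is_dual_arr(1-8)[OF assms(1)] by (auto simp: transpose'_def hom_def)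

lemma untranspose'_natural:
  assumes "is_dual C X Y ev coev" "f \<in> hom C Z Z'" "h \<in> hom C W (X \<otimes> Z)"
  shows "untranspose' Z' X Y ev ((\<i>\<d> X \<boxtimes> f) \<cdot> h) = f \<cdot> untranspose' Z X Y ev h"
proof -
  note [simp] = is_dual_arr(1-8)[OF assms(1)]
  have [simp]: "f \<in> Arr C" "Dom C f = Z" "Cod C f = Z'" "Z \<in> Obj C" "Z' \<in> Obj C"
    "h \<in> Arr C" "Dom C h = W" "Cod C h = X \<otimes> Z" "W \<in> Obj C"
    using assms(2-) hom_obj[OF assms(2)] hom_obj[OF assms(3)] by (auto simp: hom_def)
  have a: "\<a>\<^sup>i Y X Z' \<cdot> (\<i>\<d> Y \<boxtimes> (\<i>\<d> X \<boxtimes> f)) = (\<i>\<d> (Y \<otimes> X) \<boxtimes> f) \<cdot> \<a>\<^sup>i Y X Z"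
  proof (rule iso_cancel_left[of "\<a> Y X Z'" "\<a>\<^sup>i Y X Z'"])
    have "(\<a> Y X Z' \<cdot> ((\<i>\<d> Y \<boxtimes> \<i>\<d> X) \<boxtimes> f)) \<cdot> \<a>\<^sup>i Y X Z = \<i>\<d> Y \<boxtimes> (\<i>\<d> X \<boxtimes> f)"
      by (subst assoc_nat) simp_all
    then show "\<a> Y X Z' \<cdot> \<a>\<^sup>i Y X Z' \<cdot> (\<i>\<d> Y \<boxtimes> (\<i>\<d> X \<boxtimes> f)) = \<a> Y X Z' \<cdot> (\<i>\<d> (Y \<otimes> X) \<boxtimes> f) \<cdot> \<a>\<^sup>i Y X Z"
      by simp
  qed simp_all
  have "untranspose' Z' X Y ev ((\<i>\<d> X \<boxtimes> f) \<cdot> h) =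
      \<l> Z' \<cdot> (ev \<boxtimes> \<i>\<d> Z') \<cdot> (\<a>\<^sup>i Y X Z' \<cdot> (\<i>\<d> Y \<boxtimes> (\<i>\<d> X \<boxtimes> f))) \<cdot> (\<i>\<d> Y \<boxtimes> h)"
    by (simp add: untranspose'_def)
  also have "\<dots> = \<l> Z' \<cdot> (\<i>\<d> \<one> \<boxtimes> f) \<cdot> (ev \<boxtimes> \<i>\<d> Z) \<cdot> \<a>\<^sup>i Y X Z \<cdot> (\<i>\<d> Y \<boxtimes> h)"
    by (subst a) simp_all
  also have "\<dots> = f \<cdot> untranspose' Z X Y ev h"
    by (subst comp_cong_right[OF lunit_nat]) (simp_all add: untranspose'_def)
  finally show ?thesis .
qed

end


section \<open>Exactness and zero divisors of the tensor product\<close>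

context linear_symmetric_monoidal_category
begin

lemma tensor_zero_left:
  assumes "X \<in> Obj C" "X' \<in> Obj C" "g \<in> hom C Y Y'"
  shows "\<zero> X X' \<boxtimes> g = \<zero> (X \<otimes> Y) (X' \<otimes> Y')"
proof (rule add_idem_zero)
  show "\<zero> X X' \<boxtimes> g \<in> hom C (X \<otimes> Y) (X' \<otimes> Y')" using assms by (intro tensor_hom zero_hom)
  show "\<zero> X X' \<boxtimes> g \<oplus> \<zero> X X' \<boxtimes> g = \<zero> X X' \<boxtimes> g"
    using tensor_add_left[OF zero_hom zero_hom assms(3), of X X'] assms by (simp add: add_zero zero_hom)
qed

lemma tensor_zero_right:
  assumes "X \<in> Obj C" "X' \<in> Obj C" "g \<in> hom C Y Y'"
  shows "g \<boxtimes> \<zero> X X' = \<zero> (Y \<otimes> X) (Y' \<otimes> X')"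
proof (rule add_idem_zero)
  show "g \<boxtimes> \<zero> X X' \<in> hom C (Y \<otimes> X) (Y' \<otimes> X')" using assms by (intro tensor_hom zero_hom)
  show "g \<boxtimes> \<zero> X X' \<oplus> g \<boxtimes> \<zero> X X' = g \<boxtimes> \<zero> X X'"
    using tensor_add_right[OF assms(3) zero_hom zero_hom, of X X'] assms by (simp add: add_zero zero_hom)
qed

lemma tensor_retract:
  assumes "f \<in> hom C X X'" "g \<in> hom C X' X" "g \<cdot> f = \<i>\<d> X"
    and "h \<in> hom C Y Y'" "k \<in> hom C Y' Y" "k \<cdot> h = \<i>\<d> Y"
  shows "(g \<boxtimes> k) \<cdot> (f \<boxtimes> h) = \<i>\<d> (X \<otimes> Y)"
  using tensor_comp[OF assms(1,2,4,5)] hom_obj(1)[OF assms(1)] hom_obj(1)[OF assms(4)] assms(3,6)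
  by simp

lemma isomorphic_tensor:
  assumes "isomorphic C X X'" "isomorphic C Y Y'"
  shows "isomorphic C (X \<otimes> Y) (X' \<otimes> Y')"
proof -
  obtain f g where fg: "f \<in> hom C X X'" "g \<in> hom C X' X" "g \<cdot> f = \<i>\<d> X" "f \<cdot> g = \<i>\<d> X'"
    using assms(1) by (rule isomorphicE)
  obtain h k where hk: "h \<in> hom C Y Y'" "k \<in> hom C Y' Y" "k \<cdot> h = \<i>\<d> Y" "h \<cdot> k = \<i>\<d> Y'"
    using assms(2) by (rule isomorphicE)
  show ?thesis
    by (rule isomorphicI[of "f \<boxtimes> h" _ _ "g \<boxtimes> k"])
      (use fg hk in \<open>auto intro: tensor_hom tensor_retract\<close>)
qed

lemma isomorphic_assoc:
  "\<lbrakk>X \<in> Obj C; Y \<in> Obj C; Z \<in> Obj C\<rbrakk> \<Longrightarrow> isomorphic C ((X \<otimes> Y) \<otimes> Z) (X \<otimes> (Y \<otimes> Z))"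
  using assoc_hom assoc_iso iso_isomorphic by blast

lemma isomorphic_commute: "\<lbrakk>X \<in> Obj C; Y \<in> Obj C\<rbrakk> \<Longrightarrow> isomorphic C (X \<otimes> Y) (Y \<otimes> X)"
  by (rule isomorphicI[of "\<c> X Y" _ _ "\<c> Y X"]) (auto simp: hom_def)

lemma isomorphic_unit_left: "X \<in> Obj C \<Longrightarrow> isomorphic C (\<one> \<otimes> X) X"
  using lunit_hom lunit_iso iso_isomorphic by blast

lemma isomorphic_unit_right: "X \<in> Obj C \<Longrightarrow> isomorphic C (X \<otimes> \<one>) X"
  using runit_hom runit_iso iso_isomorphic by blast

lemma isomorphic_swap_right:
  assumes "X \<in> Obj C" "Y \<in> Obj C" "Z \<in> Obj C"
  shows "isomorphic C (X \<otimes> (Y \<otimes> Z)) ((X \<otimes> Z) \<otimes> Y)"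
proof -
  have "isomorphic C (X \<otimes> (Y \<otimes> Z)) (X \<otimes> (Z \<otimes> Y))"
    using assms by (intro isomorphic_tensor isomorphic_commute isomorphic_refl)
  then show ?thesis using assms by (meson isomorphic_assoc isomorphic_sym isomorphic_trans)
qed

lemma zero_obj_tensor_left: "zero_obj C X \<Longrightarrow> Y \<in> Obj C \<Longrightarrow> zero_obj C (X \<otimes> Y)"
  using tensor_zero_left[of X X "\<i>\<d> Y" Y Y] tensor_id[of X Y] id_hom[of Y]
  by (auto simp: zero_obj_iff simp del: tensor_id)

lemma zero_obj_tensor_right: "zero_obj C X \<Longrightarrow> Y \<in> Obj C \<Longrightarrow> zero_obj C (Y \<otimes> X)"
  using tensor_zero_right[of X X "\<i>\<d> Y" Y Y] tensor_id[of Y X] id_hom[of Y]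
  by (auto simp: zero_obj_iff simp del: tensor_id)

text \<open>Transports monicity from \<open>X \<otimes> -\<close> to \<open>- \<otimes> X\<close>;
  the companion below transports epicness the other way.\<close>

lemma braid_conj_right:
  assumes "f \<in> hom C X Y" "Z \<in> Obj C"
  shows "\<c> Z Y \<cdot> (\<i>\<d> Z \<boxtimes> f) \<cdot> \<c> X Z = f \<boxtimes> \<i>\<d> Z"
proof -
  have [simp]: "f \<in> Arr C" "Dom C f = X" "Cod C f = Y" "X \<in> Obj C" "Y \<in> Obj C" "Z \<in> Obj C"
    using assms hom_obj[OF assms(1)] by (auto simp: hom_def)
  have "\<c> Z Y \<cdot> (\<i>\<d> Z \<boxtimes> f) \<cdot> \<c> X Z = \<c> Z Y \<cdot> \<c> Y Z \<cdot> (f \<boxtimes> \<i>\<d> Z)"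
    using braid_natural[OF assms(1) id_hom[OF assms(2)]] by simp
  then show ?thesis by (simp add: inv_left_cancel)
qed

lemma braid_conj_left:
  assumes "f \<in> hom C X Y" "Z \<in> Obj C"
  shows "\<c> Y Z \<cdot> (f \<boxtimes> \<i>\<d> Z) \<cdot> \<c> Z X = \<i>\<d> Z \<boxtimes> f"
proof -
  have [simp]: "f \<in> Arr C" "Dom C f = X" "Cod C f = Y" "X \<in> Obj C" "Y \<in> Obj C" "Z \<in> Obj C"
    using assms hom_obj[OF assms(1)] by (auto simp: hom_def)
  have "\<c> Y Z \<cdot> (f \<boxtimes> \<i>\<d> Z) \<cdot> \<c> Z X = \<c> Y Z \<cdot> \<c> Z Y \<cdot> (\<i>\<d> Z \<boxtimes> f)"
    using braid_natural[OF id_hom[OF assms(2)] assms(1)] by simp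
  then show ?thesis by (simp add: inv_left_cancel)
qed

lemma braid_monic_epic:
  assumes "X \<in> Obj C" "Y \<in> Obj C" shows "monic C (\<c> X Y)" "epic C (\<c> X Y)"
  using assms split_monic[OF braid_hom braid_hom] split_epic[OF braid_hom braid_hom] by auto

lemma transpose_zero:
  assumes "is_dual C X Y ev coev" "W \<in> Obj C" "Z \<in> Obj C"
  shows "transpose W X Y coev (\<zero> (W \<otimes> X) Z) = \<zero> W (Z \<otimes> Y)"
proof -
  note [simp] = is_dual_arr(1-8)[OF assms(1)]
  have "\<a>\<^sup>i W X Y \<cdot> (\<i>\<d> W \<boxtimes> coev) \<cdot> \<r>\<^sup>i W \<in> hom C W ((W \<otimes> X) \<otimes> Y)"
    using assms by (auto simp: hom_def)
  then show ?thesis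
    using assms by (auto simp: transpose_def tensor_zero_left[OF _ _ id_hom] zero_comp)
qed

lemma untranspose'_zero:
  assumes "is_dual C X Y ev coev" "W \<in> Obj C" "Z \<in> Obj C"
  shows "untranspose' Z X Y ev (\<zero> W (X \<otimes> Z)) = \<zero> (Y \<otimes> W) Z"
proof -
  note [simp] = is_dual_arr(1-8)[OF assms(1)]
  have "\<l> Z \<cdot> (ev \<boxtimes> \<i>\<d> Z) \<cdot> \<a>\<^sup>i Y X Z \<in> hom C (Y \<otimes> (X \<otimes> Z)) Z"
    using assms by (auto simp: hom_def)
  then have "(\<l> Z \<cdot> (ev \<boxtimes> \<i>\<d> Z) \<cdot> \<a>\<^sup>i Y X Z) \<cdot> (\<i>\<d> Y \<boxtimes> \<zero> W (X \<otimes> Z)) = \<zero> (Y \<otimes> W) Z"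
    using assms by (simp add: tensor_zero_right[OF _ _ id_hom] comp_zero del: assoc)
  moreover have "\<zero> W (X \<otimes> Z) \<in> hom C W (X \<otimes> Z)" using assms by (simp add: zero_hom)
  ultimately show ?thesis
    using assms by (auto simp: untranspose'_def hom_def)
qed

end


section \<open>Exactness of tensoring through duals\<close>

context rigid_symmetric_monoidal_category
begin

text \<open>If \<open>u\<close> kills \<open>c \<boxtimes> \<i>\<d> X\<close>, its transpose kills
  \<open>c\<close> and so vanishes; the round trip recovers \<open>u\<close> from its
  transpose.\<close>

lemma epic_tensor_right:
  assumes c: "epic C c" "c \<in> hom C B Q" and X: "X \<in> Obj C"
  shows "epic C (c \<boxtimes> \<i>\<d> X)"
proof -
  obtain Y ev coev where d: "is_dual C X Y ev coev" using ex_dual X by blast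
  have cX: "c \<boxtimes> \<i>\<d> X \<in> hom C (B \<otimes> X) (Q \<otimes> X)" using c X by (intro tensor_hom id_hom)
  have Q: "Q \<in> Obj C" using c hom_obj by blast
  show ?thesis
  proof (rule epicI[OF cX])
    fix Z u assume u: "u \<in> hom C (Q \<otimes> X) Z" "u \<cdot> (c \<boxtimes> \<i>\<d> X) = \<zero> (B \<otimes> X) Z"
    have Z: "Z \<in> Obj C" and B: "B \<in> Obj C" using u c hom_obj by auto
    have "transpose Q X Y coev u \<cdot> c = \<zero> B (Z \<otimes> Y)"
      using transpose_natural[OF d c(2) u(1)] u(2) transpose_zero[OF d B Z] by simp
    then have "transpose Q X Y coev u = \<zero> Q (Z \<otimes> Y)"
      using epic_zeroD[OF c] transpose_hom[OF d u(1) Q] by blast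
    then have "transpose Q X Y coev u = transpose Q X Y coev (\<zero> (Q \<otimes> X) Z)"
      using transpose_zero[OF d Q Z] by simp
    then show "u = \<zero> (Q \<otimes> X) Z"
      using untranspose_transpose[OF d _ Q] u(1) Z Q X by (metis tensor_obj zero_hom)
  qed
qed

text \<open>Left adjoints preserve cokernels: transpose the test arrow, factor it through
  \<open>c\<close>, and untranspose the factor.\<close>

lemma is_cokernel_tensor_right:
  assumes f: "f \<in> hom C A B" and c: "c \<in> hom C B Q" "is_cokernel C f c" and X: "X \<in> Obj C"
  shows "is_cokernel C (f \<boxtimes> \<i>\<d> X) (c \<boxtimes> \<i>\<d> X)"
proof -
  obtain Y ev coev where d: "is_dual C X Y ev coev" using ex_dual X by blast
  note D = is_cokernelD[OF c(2) f c(1)]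
  have obj: "A \<in> Obj C" "B \<in> Obj C" "Q \<in> Obj C" "Y \<in> Obj C"
    using hom_obj f c(1) is_dual_arr(2)[OF d] by auto
  show ?thesis
  proof (rule is_cokernelI[where X = "A \<otimes> X" and Y = "B \<otimes> X" and Q = "Q \<otimes> X"])
    show "f \<boxtimes> \<i>\<d> X \<in> hom C (A \<otimes> X) (B \<otimes> X)" "c \<boxtimes> \<i>\<d> X \<in> hom C (B \<otimes> X) (Q \<otimes> X)"
      using f c X by (auto intro: tensor_hom id_hom)
    show "(c \<boxtimes> \<i>\<d> X) \<cdot> (f \<boxtimes> \<i>\<d> X) = \<zero> (A \<otimes> X) (Q \<otimes> X)"
      using tensor_comp[OF f c(1) id_hom id_hom, OF X X] D(1) X obj
      by (simp add: tensor_zero_left[OF _ _ id_hom])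
    show "epic C (c \<boxtimes> \<i>\<d> X)" using epic_tensor_right D(3) c(1) X by blast
    fix W h assume h: "h \<in> hom C (B \<otimes> X) W" "h \<cdot> (f \<boxtimes> \<i>\<d> X) = \<zero> (A \<otimes> X) W"
    have W: "W \<in> Obj C" using h hom_obj by blast
    have "transpose B X Y coev h \<cdot> f = \<zero> A (W \<otimes> Y)"
      using transpose_natural[OF d f h(1)] h(2) transpose_zero[OF d _ W] obj by simp
    then obtain u where u: "u \<in> hom C Q (W \<otimes> Y)" "u \<cdot> c = transpose B X Y coev h"
      using D(2) transpose_hom[OF d h(1)] obj by blast
    have "untranspose W X Y ev u \<cdot> (c \<boxtimes> \<i>\<d> X) = h"
      using untranspose_natural[OF d c(1) u(1) W] u(2) untranspose_transpose[OF d h(1)] obj by simp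
    then show "\<exists>u\<in>hom C (Q \<otimes> X) W. u \<cdot> (c \<boxtimes> \<i>\<d> X) = h"
      using untranspose_hom[OF d u(1) W] by blast
  qed
qed

lemma monic_tensor_left:
  assumes m: "monic C m" "m \<in> hom C K B" and X: "X \<in> Obj C"
  shows "monic C (\<i>\<d> X \<boxtimes> m)"
proof -
  obtain Y ev coev where d: "is_dual C X Y ev coev" using ex_dual X by blast
  have Xm: "\<i>\<d> X \<boxtimes> m \<in> hom C (X \<otimes> K) (X \<otimes> B)" using m X by (intro tensor_hom id_hom)
  have K: "K \<in> Obj C" and B: "B \<in> Obj C" using m hom_obj by auto
  show ?thesis
  proof (rule monicI[OF Xm])
    fix W u assume u: "u \<in> hom C W (X \<otimes> K)" "(\<i>\<d> X \<boxtimes> m) \<cdot> u = \<zero> W (X \<otimes> B)"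
    have W: "W \<in> Obj C" using u hom_obj by auto
    have "m \<cdot> untranspose' K X Y ev u = \<zero> (Y \<otimes> W) B"
      using untranspose'_natural[OF d m(2) u(1)] u(2) untranspose'_zero[OF d W B] by simp
    then have "untranspose' K X Y ev u = \<zero> (Y \<otimes> W) K"
      using monic_zeroD[OF m] untranspose'_hom[OF d u(1) K] by blast
    then have "untranspose' K X Y ev u = untranspose' K X Y ev (\<zero> W (X \<otimes> K))"
      using untranspose'_zero[OF d W K] by simp
    then show "u = \<zero> W (X \<otimes> K)"
      using transpose'_untranspose'[OF d _ K] u(1) W K X by (metis tensor_obj zero_hom)
  qed
qed

text \<open>Right adjoints preserve kernels: untranspose the test arrow, factor it through
  \<open>m\<close>, and transpose the factor back.\<close>

lemma is_kernel_tensor_left: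
  assumes f: "f \<in> hom C A B" and m: "m \<in> hom C K A" "is_kernel C f m" and X: "X \<in> Obj C"
  shows "is_kernel C (\<i>\<d> X \<boxtimes> f) (\<i>\<d> X \<boxtimes> m)"
proof -
  obtain Y ev coev where d: "is_dual C X Y ev coev" using ex_dual X by blast
  note D = is_kernelD[OF m(2) f m(1)]
  have obj: "A \<in> Obj C" "B \<in> Obj C" "K \<in> Obj C" "Y \<in> Obj C"
    using hom_obj f m(1) is_dual_arr(2)[OF d] by auto
  show ?thesis
  proof (rule is_kernelI[where X = "X \<otimes> A" and Y = "X \<otimes> B" and K = "X \<otimes> K"])
    show "\<i>\<d> X \<boxtimes> f \<in> hom C (X \<otimes> A) (X \<otimes> B)" "\<i>\<d> X \<boxtimes> m \<in> hom C (X \<otimes> K) (X \<otimes> A)"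
      using f m X by (auto intro: tensor_hom id_hom)
    show "(\<i>\<d> X \<boxtimes> f) \<cdot> (\<i>\<d> X \<boxtimes> m) = \<zero> (X \<otimes> K) (X \<otimes> B)"
      using tensor_comp[OF id_hom id_hom m(1) f, OF X X] D(1) X obj
      by (simp add: tensor_zero_right[OF _ _ id_hom])
    show "monic C (\<i>\<d> X \<boxtimes> m)" using monic_tensor_left D(3) m(1) X by blast
    fix W h assume h: "h \<in> hom C W (X \<otimes> A)" "(\<i>\<d> X \<boxtimes> f) \<cdot> h = \<zero> W (X \<otimes> B)"
    have W: "W \<in> Obj C" using h hom_obj by blast
    have "f \<cdot> untranspose' A X Y ev h = \<zero> (Y \<otimes> W) B"
      using untranspose'_natural[OF d f h(1)] h(2) untranspose'_zero[OF d W] obj by simp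
    then obtain u where u: "u \<in> hom C (Y \<otimes> W) K" "m \<cdot> u = untranspose' A X Y ev h"
      using D(2) untranspose'_hom[OF d h(1)] obj by blast
    have "(\<i>\<d> X \<boxtimes> m) \<cdot> transpose' W X Y coev u = h"
      using transpose'_natural[OF d m(1) u(1) W] u(2) transpose'_untranspose'[OF d h(1)] obj by simp
    then show "\<exists>u\<in>hom C W (X \<otimes> K). (\<i>\<d> X \<boxtimes> m) \<cdot> u = h"
      using transpose'_hom[OF d u(1) W] by blast
  qed
qed

lemma monic_tensor_right:
  assumes m: "monic C m" "m \<in> hom C K B" and X: "X \<in> Obj C"
  shows "monic C (m \<boxtimes> \<i>\<d> X)"
proof -
  have obj: "K \<in> Obj C" "B \<in> Obj C" using m hom_obj by auto
  have Xm: "\<i>\<d> X \<boxtimes> m \<in> hom C (X \<otimes> K) (X \<otimes> B)" using m X by (intro tensor_hom id_hom)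
  have "monic C (\<c> X B \<cdot> (\<i>\<d> X \<boxtimes> m) \<cdot> \<c> K X)"
    using obj X Xm monic_tensor_left[OF m X] braid_monic_epic
    by (intro monic_comp[where Y = "X \<otimes> B"] monic_comp[where Y = "X \<otimes> K"] comp_hom[where Y = "X \<otimes> K"])
      (auto intro: braid_hom)
  then show ?thesis using braid_conj_right[OF m(2) X] by simp
qed

lemma epic_tensor_left:
  assumes c: "epic C c" "c \<in> hom C B Q" and X: "X \<in> Obj C"
  shows "epic C (\<i>\<d> X \<boxtimes> c)"
proof -
  have obj: "B \<in> Obj C" "Q \<in> Obj C" using c hom_obj by auto
  have cX: "c \<boxtimes> \<i>\<d> X \<in> hom C (B \<otimes> X) (Q \<otimes> X)" using c X by (intro tensor_hom id_hom)
  have "epic C (\<c> Q X \<cdot> (c \<boxtimes> \<i>\<d> X) \<cdot> \<c> X B)"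
    using obj X cX epic_tensor_right[OF c X] braid_monic_epic
    by (intro epic_comp[where Y = "Q \<otimes> X"] epic_comp[where Y = "B \<otimes> X"] comp_hom[where Y = "B \<otimes> X"])
      (auto intro: braid_hom)
  then show ?thesis using braid_conj_left[OF c(2) X] by simp
qed

text \<open>The adjunction yields kernels for \<open>X \<otimes> -\<close> and cokernels for
  \<open>- \<otimes> X\<close>, while short exactness needs both on one side. The braiding carries
  the factorisation across.\<close>

lemma is_kernel_tensor_right:
  assumes f: "f \<in> hom C A B" and m: "m \<in> hom C K A" "is_kernel C f m" and X: "X \<in> Obj C"
  shows "is_kernel C (f \<boxtimes> \<i>\<d> X) (m \<boxtimes> \<i>\<d> X)"
proof (rule is_kernelI[where X = "A \<otimes> X" and Y = "B \<otimes> X" and K = "K \<otimes> X"])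
  note D = is_kernelD[OF m(2) f m(1)]
  have obj: "A \<in> Obj C" "B \<in> Obj C" "K \<in> Obj C"
    using hom_obj f m(1) by auto
  show fX: "f \<boxtimes> \<i>\<d> X \<in> hom C (A \<otimes> X) (B \<otimes> X)" and mX: "m \<boxtimes> \<i>\<d> X \<in> hom C (K \<otimes> X) (A \<otimes> X)"
    using f m X by (auto intro: tensor_hom id_hom)
  have Xf: "\<i>\<d> X \<boxtimes> f \<in> hom C (X \<otimes> A) (X \<otimes> B)" and Xm: "\<i>\<d> X \<boxtimes> m \<in> hom C (X \<otimes> K) (X \<otimes> A)"
    using f m X by (auto intro: tensor_hom id_hom)
  note E = is_kernelD[OF is_kernel_tensor_left[OF f m X] Xf Xm]
  show "(f \<boxtimes> \<i>\<d> X) \<cdot> (m \<boxtimes> \<i>\<d> X) = \<zero> (K \<otimes> X) (B \<otimes> X)"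
    using tensor_comp[OF m(1) f id_hom id_hom, OF X X] D(1) X obj
    by (simp add: tensor_zero_left[OF _ _ id_hom])
  show "monic C (m \<boxtimes> \<i>\<d> X)" using monic_tensor_right D(3) m(1) X by blast
  fix W h assume h: "h \<in> hom C W (A \<otimes> X)" "(f \<boxtimes> \<i>\<d> X) \<cdot> h = \<zero> W (B \<otimes> X)"
  have c: "\<c> A X \<in> hom C (A \<otimes> X) (X \<otimes> A)" "\<c> X A \<in> hom C (X \<otimes> A) (A \<otimes> X)"
    "\<c> B X \<in> hom C (B \<otimes> X) (X \<otimes> B)" "\<c> X K \<in> hom C (X \<otimes> K) (K \<otimes> X)"
    using obj X by (auto intro: braid_hom)
  have ch: "\<c> A X \<cdot> h \<in> hom C W (X \<otimes> A)" using c h by (blast intro: comp_hom)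
  have "(\<i>\<d> X \<boxtimes> f) \<cdot> \<c> A X \<cdot> h = ((\<i>\<d> X \<boxtimes> f) \<cdot> \<c> A X) \<cdot> h"
    using comp_assoc[OF h(1) c(1) Xf] by simp
  also have "\<dots> = \<c> B X \<cdot> (f \<boxtimes> \<i>\<d> X) \<cdot> h"
    using comp_assoc[OF h(1) fX c(3)] braid_natural[OF f id_hom[OF X]] by simp
  also have "\<dots> = \<zero> W (X \<otimes> B)" using h comp_zero c(3) hom_obj(1) by metis
  finally obtain u where u: "u \<in> hom C W (X \<otimes> K)" "(\<i>\<d> X \<boxtimes> m) \<cdot> u = \<c> A X \<cdot> h"
    using E(2)[OF ch] by blast
  have "(m \<boxtimes> \<i>\<d> X) \<cdot> \<c> X K \<cdot> u = ((m \<boxtimes> \<i>\<d> X) \<cdot> \<c> X K) \<cdot> u"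
    using comp_assoc[OF u(1) c(4) mX] by simp
  also have "\<dots> = \<c> X A \<cdot> (\<i>\<d> X \<boxtimes> m) \<cdot> u"
    using comp_assoc[OF u(1) Xm c(2)] braid_natural[OF id_hom[OF X] m(1)] by simp
  also have "\<dots> = (\<c> X A \<cdot> \<c> A X) \<cdot> h"
    using comp_assoc[OF h(1) c(1,2)] u(2) by simp
  also have "\<dots> = h" using braid_symmetric obj X h(1) comp_id_left by simp
  finally show "\<exists>u\<in>hom C W (K \<otimes> X). (m \<boxtimes> \<i>\<d> X) \<cdot> u = h" using u(1) c(4) comp_hom by blast
qed

lemma short_exact_tensor_right:
  assumes "i \<in> hom C A B" "q \<in> hom C B Q" "short_exact C i q" "X \<in> Obj C"
  shows "short_exact C (i \<boxtimes> \<i>\<d> X) (q \<boxtimes> \<i>\<d> X)"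
  using assms is_kernel_tensor_right is_cokernel_tensor_right by (auto simp: short_exact_def)

lemma dual_retract:
  assumes d: "is_dual C X Y ev coev"
  shows "\<exists>f\<in>hom C Y (Y \<otimes> (X \<otimes> Y)). \<exists>g\<in>hom C (Y \<otimes> (X \<otimes> Y)) Y. g \<cdot> f = \<i>\<d> Y"
proof (intro bexI)
  note [simp] = is_dual_arr(1-8)[OF d]
  have "(\<l> Y \<cdot> (ev \<boxtimes> \<i>\<d> Y) \<cdot> \<a>\<^sup>i Y X Y \<cdot> (\<i>\<d> Y \<boxtimes> coev)) \<cdot> \<r>\<^sup>i Y = \<i>\<d> Y"
    by (simp only: is_dual_arr(10)[OF d]) simp
  then show "(\<l> Y \<cdot> (ev \<boxtimes> \<i>\<d> Y) \<cdot> \<a>\<^sup>i Y X Y) \<cdot> ((\<i>\<d> Y \<boxtimes> coev) \<cdot> \<r>\<^sup>i Y) = \<i>\<d> Y" by simp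
qed (auto simp: hom_def is_dual_arr[OF d])

text \<open>By the second triangle identity \<open>Y\<close> is a retract of
  \<open>Y \<otimes> (X \<otimes> Y)\<close>. Hence \<open>W \<otimes> Y\<close> is a retract of an
  object which, after reordering, has the zero factor \<open>W \<otimes> X\<close>.\<close>

lemma zero_tensor_dual:
  assumes d: "is_dual C X Y ev coev" and W: "W \<in> Obj C" and z: "zero_obj C (W \<otimes> X)"
  shows "zero_obj C (W \<otimes> Y)"
proof -
  have XY: "X \<in> Obj C" "Y \<in> Obj C" using is_dual_arr[OF d] by auto
  obtain f g where fg: "f \<in> hom C Y (Y \<otimes> (X \<otimes> Y))" "g \<in> hom C (Y \<otimes> (X \<otimes> Y)) Y" "g \<cdot> f = \<i>\<d> Y"
    using dual_retract[OF d] by blast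
  have "isomorphic C (Y \<otimes> (X \<otimes> Y)) ((X \<otimes> Y) \<otimes> Y)" "isomorphic C ((X \<otimes> Y) \<otimes> Y) (X \<otimes> (Y \<otimes> Y))"
    using XY by (auto intro: isomorphic_commute isomorphic_assoc)
  then have "isomorphic C (W \<otimes> (Y \<otimes> (X \<otimes> Y))) (W \<otimes> (X \<otimes> (Y \<otimes> Y)))"
    using W by (blast intro: isomorphic_tensor isomorphic_refl isomorphic_trans)
  moreover have "isomorphic C ((W \<otimes> X) \<otimes> (Y \<otimes> Y)) (W \<otimes> (X \<otimes> (Y \<otimes> Y)))"
    using W XY by (intro isomorphic_assoc tensor_obj)
  ultimately have "isomorphic C ((W \<otimes> X) \<otimes> (Y \<otimes> Y)) (W \<otimes> (Y \<otimes> (X \<otimes> Y)))"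
    using isomorphic_sym isomorphic_trans by blast
  then have "zero_obj C (W \<otimes> (Y \<otimes> (X \<otimes> Y)))"
    using zero_obj_isomorphic zero_obj_tensor_left[OF z, of "Y \<otimes> Y"] XY by simp
  then show ?thesis
    using zero_obj_retract tensor_retract[OF id_hom id_hom comp_id_left fg, OF W W id_hom] W fg
      tensor_hom[OF id_hom[OF W] fg(1)] tensor_hom[OF id_hom[OF W] fg(2)] by blast
qed

text \<open>A triangle identity provides a left inverse of the coevaluation once it is tensored with
  \<open>X\<close>. A functor preserves such a splitting, whatever it does to monic arrows in
  general.\<close>

lemma dual_unit_split:
  assumes d: "is_dual C X Y ev coev"
  shows "\<exists>g\<in>hom C ((X \<otimes> Y) \<otimes> X) (\<one> \<otimes> X). g \<cdot> (coev \<boxtimes> \<i>\<d> X) = \<i>\<d> (\<one> \<otimes> X)"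
proof (intro bexI)
  note [simp] = is_dual_arr(1-8)[OF d]
  have "\<l>\<^sup>i X \<cdot> (\<r> X \<cdot> (\<i>\<d> X \<boxtimes> ev) \<cdot> \<a> X Y X \<cdot> (coev \<boxtimes> \<i>\<d> X)) = \<i>\<d> (\<one> \<otimes> X)"
    by (simp only: is_dual_arr(9)[OF d]) simp
  then show "(\<l>\<^sup>i X \<cdot> \<r> X \<cdot> (\<i>\<d> X \<boxtimes> ev) \<cdot> \<a> X Y X) \<cdot> (coev \<boxtimes> \<i>\<d> X) = \<i>\<d> (\<one> \<otimes> X)" by simp
qed (auto simp: hom_def is_dual_arr[OF d])

lemma dual_counit_split:
  assumes d: "is_dual C X Y ev coev"
  shows "\<exists>g\<in>hom C (\<one> \<otimes> Y) ((Y \<otimes> X) \<otimes> Y). (ev \<boxtimes> \<i>\<d> Y) \<cdot> g = \<i>\<d> (\<one> \<otimes> Y)"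
proof (intro bexI)
  note [simp] = is_dual_arr(1-8)[OF d]
  \<comment> \<open>Read off from the second triangle identity, which gives the equation only after
    composition with the invertible \<open>\<l> Y\<close>.\<close>
  let ?g = "\<a>\<^sup>i Y X Y \<cdot> (\<i>\<d> Y \<boxtimes> coev) \<cdot> \<r>\<^sup>i Y \<cdot> \<l> Y"
  have "(\<l> Y \<cdot> (ev \<boxtimes> \<i>\<d> Y) \<cdot> \<a>\<^sup>i Y X Y \<cdot> (\<i>\<d> Y \<boxtimes> coev)) \<cdot> \<r>\<^sup>i Y \<cdot> \<l> Y = \<l> Y"
    by (simp only: is_dual_arr(10)[OF d]) simp
  then have "\<l> Y \<cdot> ((ev \<boxtimes> \<i>\<d> Y) \<cdot> ?g) = \<l> Y \<cdot> \<i>\<d> (\<one> \<otimes> Y)" by simp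
  then show "(ev \<boxtimes> \<i>\<d> Y) \<cdot> ?g = \<i>\<d> (\<one> \<otimes> Y)"
    by (rule iso_cancel_left[of "\<l> Y" "\<l>\<^sup>i Y", rotated 8]) simp_all
qed (auto simp: hom_def is_dual_arr[OF d])

lemma dual_unit_monic:
  assumes d: "is_dual C X Y ev coev"
  shows "monic C (coev \<boxtimes> \<i>\<d> X)"
proof -
  have "coev \<boxtimes> \<i>\<d> X \<in> hom C (\<one> \<otimes> X) ((X \<otimes> Y) \<otimes> X)" using is_dual_arr[OF d] by (auto simp: hom_def)
  then show ?thesis using dual_unit_split[OF d] split_monic by blast
qed

end


section \<open>Absence of zero divisors, and reflection of monic and epic arrows\<close>

context tensor_category
begin

text \<open>Every endomorphism of \<open>\<one>\<close> is a scalar, and a field has only the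
  idempotents 0 and 1.\<close>

lemma unit_idempotent:
  assumes "e \<in> hom C \<one> \<one>" "e \<cdot> e = e"
  shows "e = \<i>\<d> \<one> \<or> e = \<zero> \<one> \<one>"
proof -
  obtain a where a: "e = a *\<^sub>k \<i>\<d> \<one>" using end_unit assms(1) by (auto simp: bij_betw_def)
  have i: "\<i>\<d> \<one> \<in> hom C \<one> \<one>" by (simp add: id_hom)
  have "e \<cdot> e = a *\<^sub>k (\<i>\<d> \<one> \<cdot> e)" using comp_scale_left[OF assms(1) i] a by simp
  also have "\<dots> = (a * a) *\<^sub>k \<i>\<d> \<one>"
    using assms(1) scale_scale[OF i] a by (simp add: comp_id_left)
  finally have "(a * a) *\<^sub>k \<i>\<d> \<one> = a *\<^sub>k \<i>\<d> \<one>" using assms(2) a by simp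
  then have "a * a = a" using end_unit by (auto simp: bij_betw_def dest: injD)
  then have "a = 0 \<or> a = 1" by simp
  then show ?thesis using a i zero_scale scale_one by auto
qed

text \<open>If \<open>X \<otimes> Y = 0\<close>, factor the unit \<open>\<one> \<rightarrow> X \<otimes> X\<^sup>*\<close> through its image \<open>J\<close> with kernel \<open>K\<close>. Then
  \<open>K \<otimes> J = 0\<close>, which makes \<open>J\<close> a direct summand of \<open>\<one>\<close>; as \<open>End(\<one>)\<close> is a field, \<open>J\<close> is
  \<open>0\<close> or \<open>\<one>\<close>.\<close>

lemma tensor_no_zero_divisors:
  assumes X: "X \<in> Obj C" and Y: "Y \<in> Obj C" and z: "zero_obj C (X \<otimes> Y)"
  shows "zero_obj C X \<or> zero_obj C Y"
proof -
  obtain X' ev coev where d: "is_dual C X X' ev coev" using ex_dual X by blast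
  have X': "X' \<in> Obj C" and coev: "coev \<in> hom C \<one> (X \<otimes> X')" using d by (auto simp: is_dual_def)
  obtain J m p where m: "m \<in> hom C J (X \<otimes> X')" "monic C m" and p: "p \<in> hom C \<one> J" "epic C p"
    and mp: "m \<cdot> p = coev" using imageE[OF coev] by metis
  obtain K k where k: "k \<in> hom C K \<one>" "is_kernel C p k" using p(1) by (rule kernelE)
  have J: "J \<in> Obj C" and K: "K \<in> Obj C" using p(1) k(1) hom_obj by auto
  note KD = is_kernelD[OF k(2) p(1) k(1)]
  have "coev \<cdot> k = m \<cdot> p \<cdot> k" using comp_assoc[OF k(1) p(1) m(1)] mp by simp
  then have ck: "coev \<cdot> k = \<zero> K (X \<otimes> X')" using KD(1) comp_zero[OF m(1) K] by simp
  have kX: "k \<boxtimes> \<i>\<d> X \<in> hom C (K \<otimes> X) (\<one> \<otimes> X)" "monic C (k \<boxtimes> \<i>\<d> X)"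
    using k(1) X monic_tensor_right[OF KD(3) k(1) X] by (auto intro: tensor_hom id_hom)
  have cX: "coev \<boxtimes> \<i>\<d> X \<in> hom C (\<one> \<otimes> X) ((X \<otimes> X') \<otimes> X)" using coev X by (intro tensor_hom id_hom)
  \<comment> \<open>\<open>coev\<close> kills \<open>k\<close>, but
    \<open>coev \<boxtimes> \<i>\<d> X\<close> and \<open>k \<boxtimes> \<i>\<d> X\<close> are both
    monic. Their composite is a monic zero arrow, so its domain \<open>K \<otimes> X\<close> is
    zero.\<close>
  have "(coev \<boxtimes> \<i>\<d> X) \<cdot> (k \<boxtimes> \<i>\<d> X) = \<zero> (K \<otimes> X) ((X \<otimes> X') \<otimes> X)"
    using tensor_comp[OF k(1) coev id_hom id_hom, OF X X] ck X X' K
    by (simp add: tensor_zero_left[OF _ _ id_hom])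
  then have zKX: "zero_obj C (K \<otimes> X)"
    using zero_obj_monic[OF monic_comp[OF kX(2,1) dual_unit_monic[OF d] cX]] comp_hom[OF kX(1) cX]
    by blast
  \<comment> \<open>\<open>J\<close> is a subobject of \<open>X \<otimes> X'\<close>. So
    \<open>K \<otimes> J\<close> embeds into a zero object, and below \<open>J \<otimes> Y\<close>
    embeds into a reordering of \<open>(X \<otimes> Y) \<otimes> X'\<close>, which is zero as
    well.\<close>
  have "zero_obj C (K \<otimes> (X \<otimes> X'))"
    using zero_obj_isomorphic[OF isomorphic_assoc zero_obj_tensor_left[OF zKX X']] K X X' by blast
  then have zKJ: "zero_obj C (K \<otimes> J)"
    using zero_obj_monic[OF monic_tensor_left[OF m(2,1) K]] tensor_hom[OF id_hom[OF K] m(1)]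
      zero_obj_hom(2) by blast
  have "isomorphic C ((X \<otimes> X') \<otimes> Y) ((X \<otimes> Y) \<otimes> X')"
    using X X' Y isomorphic_swap_right[OF X X' Y] isomorphic_assoc isomorphic_trans by blast
  then have "zero_obj C ((X \<otimes> X') \<otimes> Y)"
    using zero_obj_isomorphic zero_obj_tensor_left[OF z X'] isomorphic_sym by blast
  then have zJY: "zero_obj C (J \<otimes> Y)"
    using zero_obj_monic[OF monic_tensor_right[OF m(2,1) Y]] tensor_hom[OF m(1) id_hom[OF Y]]
      zero_obj_hom(2) by blast
  obtain J' ev' coev' where d': "is_dual C J J' ev' coev'" using ex_dual J by blast
  have J': "J' \<in> Obj C" using is_dual_arr[OF d'] by auto
  \<comment> \<open>The kernel of \<open>p \<boxtimes> \<i>\<d> J'\<close> is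
    \<open>K \<otimes> J'\<close>. Its vanishing makes this epimorphism invertible, and the dual of
    \<open>J\<close> is the factor over which transposes are formed.\<close>
  have zKJ': "zero_obj C (K \<otimes> J')" using zero_tensor_dual[OF d' K zKJ] .
  have pJ: "p \<boxtimes> \<i>\<d> J' \<in> hom C (\<one> \<otimes> J') (J \<otimes> J')" and kJ: "k \<boxtimes> \<i>\<d> J' \<in> hom C (K \<otimes> J') (\<one> \<otimes> J')"
    using p(1) k(1) J' by (auto intro: tensor_hom id_hom)
  have "monic C (p \<boxtimes> \<i>\<d> J')"
  proof (rule monicI[OF pJ])
    fix W g assume g: "g \<in> hom C W (\<one> \<otimes> J')" "(p \<boxtimes> \<i>\<d> J') \<cdot> g = \<zero> W (J \<otimes> J')"
    obtain u where u: "u \<in> hom C W (K \<otimes> J')" "(k \<boxtimes> \<i>\<d> J') \<cdot> u = g"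
      using is_kernelD(2)[OF is_kernel_tensor_right[OF p(1) k J'] pJ kJ g] by blast
    then show "g = \<zero> W (\<one> \<otimes> J')"
      using zero_obj_hom(2)[OF zKJ' u(1)] comp_zero[OF kJ] hom_obj(1)[OF g(1)] by simp
  qed
  then have "iso_arr C (p \<boxtimes> \<i>\<d> J')"
    using monic_epic_iso[OF pJ] epic_tensor_right[OF p(2,1) J'] by blast
  then obtain n where n: "n \<in> hom C (J \<otimes> J') (\<one> \<otimes> J')" "(p \<boxtimes> \<i>\<d> J') \<cdot> n = \<i>\<d> (J \<otimes> J')"
    using pJ by (rule iso_arrE)
  \<comment> \<open>\<open>t\<close> is the transpose of the left unitor of \<open>J\<close>.
    Lifting it through the invertible \<open>p \<boxtimes> \<i>\<d> J'\<close> and untransposing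
    lifts the unitor through \<open>p\<close>, which gives \<open>p\<close> the section
    \<open>s\<close>.\<close>
  define t where "t = transpose \<one> J J' coev' (\<l> J)"
  have t: "t \<in> hom C \<one> (J \<otimes> J')" unfolding t_def
    by (rule transpose_hom[OF d' lunit_hom[OF J] unit_obj])
  define v where "v = n \<cdot> t"
  have v: "v \<in> hom C \<one> (\<one> \<otimes> J')" unfolding v_def using n t comp_hom by blast
  have "(p \<boxtimes> \<i>\<d> J') \<cdot> v = t"
    unfolding v_def using comp_assoc[OF t n(1) pJ] n(2) comp_id_left[OF t] by simp
  then have l: "p \<cdot> untranspose \<one> J J' ev' v = \<l> J"
    using untranspose_natural_right[OF d' p(1) v] untranspose_transpose[OF d' lunit_hom[OF J] unit_obj]
    by (simp add: t_def)
  define s where "s = untranspose \<one> J J' ev' v \<cdot> \<l>\<^sup>i J"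
  have u: "untranspose \<one> J J' ev' v \<in> hom C (\<one> \<otimes> J) \<one>" by (rule untranspose_hom[OF d' v unit_obj])
  have li: "\<l>\<^sup>i J \<in> hom C J (\<one> \<otimes> J)" using J by (simp add: hom_def)
  have s: "s \<in> hom C J \<one>" unfolding s_def using u li comp_hom by blast
  have ps: "p \<cdot> s = \<i>\<d> J" unfolding s_def using comp_assoc[OF li u p(1)] l J by simp
  have sp: "s \<cdot> p \<in> hom C \<one> \<one>" using s p comp_hom by blast
  have psp: "p \<cdot> s \<cdot> p = p" using comp_assoc[OF p(1) s p(1)] ps comp_id_left[OF p(1)] by simp
  then have "(s \<cdot> p) \<cdot> (s \<cdot> p) = s \<cdot> p" using comp_assoc[OF sp p(1) s] by simp
  then consider "s \<cdot> p = \<i>\<d> \<one>" | "s \<cdot> p = \<zero> \<one> \<one>" using unit_idempotent sp by blast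
  then show ?thesis
  proof cases
    case 1
    \<comment> \<open>Here \<open>\<one>\<close> is a retract of \<open>J\<close>, so
      \<open>\<one> \<otimes> Y\<close> is a retract of the zero object
      \<open>J \<otimes> Y\<close>.\<close>
    have "zero_obj C (\<one> \<otimes> Y)"
      by (rule zero_obj_retract[OF zJY _ _ tensor_retract[OF p(1) s 1 id_hom id_hom comp_id_left]])
        (use Y p s in \<open>auto intro: tensor_hom id_hom\<close>)
    then show ?thesis using zero_obj_isomorphic[OF isomorphic_unit_left[OF Y]] by blast
  next
    case 2
    \<comment> \<open>Since \<open>p \<cdot> s \<cdot> p = p\<close>, the arrow \<open>p\<close> and
      with it \<open>coev\<close> vanish; but \<open>coev \<boxtimes> \<i>\<d> X\<close> is monic,
      so its domain is zero.\<close>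
    then have "p = \<zero> \<one> J" using psp comp_zero[OF p(1) unit_obj] by simp
    then have "coev = \<zero> \<one> (X \<otimes> X')" using mp comp_zero[OF m(1) unit_obj] by simp
    then have "coev \<boxtimes> \<i>\<d> X = \<zero> (\<one> \<otimes> X) ((X \<otimes> X') \<otimes> X)"
      using X X' by (simp add: tensor_zero_left[OF _ _ id_hom])
    then have "zero_obj C (\<one> \<otimes> X)" using zero_obj_monic[OF dual_unit_monic[OF d] cX] by blast
    then show ?thesis using zero_obj_isomorphic[OF isomorphic_unit_left[OF X]] by blast
  qed
qed

lemma unit_not_zero: "\<not> zero_obj C \<one>"
proof
  assume "zero_obj C \<one>"
  then have "1 *\<^sub>k \<i>\<d> \<one> = 0 *\<^sub>k \<i>\<d> \<one>"
    using scale_one zero_scale id_hom unit_obj by (metis zero_obj_iff)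
  then have "(1 :: 'k) = 0" using end_unit by (auto simp: bij_betw_def dest: injD)
  then show False by simp
qed

text \<open>If \<open>k\<close> is a kernel of \<open>c\<close>, then
  \<open>k \<boxtimes> \<i>\<d> T\<close> is monic and killed by the monic
  \<open>c \<boxtimes> \<i>\<d> T\<close>. So \<open>K \<otimes> T\<close> is zero, and a nonzero
  \<open>T\<close> forces \<open>K\<close> to be zero.\<close>

lemma monic_tensor_cancel:
  assumes c: "c \<in> hom C X Y" and T: "T \<in> Obj C" "\<not> zero_obj C T" and m: "monic C (c \<boxtimes> \<i>\<d> T)"
  shows "monic C c"
proof -
  obtain K k where k: "k \<in> hom C K X" "is_kernel C c k" using c by (rule kernelE)
  note D = is_kernelD[OF k(2) c k(1)]
  have obj: "X \<in> Obj C" "Y \<in> Obj C" "K \<in> Obj C" using c k(1) hom_obj by auto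
  have kT: "k \<boxtimes> \<i>\<d> T \<in> hom C (K \<otimes> T) (X \<otimes> T)" and cT: "c \<boxtimes> \<i>\<d> T \<in> hom C (X \<otimes> T) (Y \<otimes> T)"
    using c k T by (auto intro: tensor_hom id_hom)
  have "(c \<boxtimes> \<i>\<d> T) \<cdot> (k \<boxtimes> \<i>\<d> T) = \<zero> (K \<otimes> T) (Y \<otimes> T)"
    using is_kernelD(1)[OF is_kernel_tensor_right[OF c k T(1)] cT kT] .
  then have "k \<boxtimes> \<i>\<d> T = \<zero> (K \<otimes> T) (X \<otimes> T)" using monic_zeroD[OF m cT kT] by blast
  then have "zero_obj C (K \<otimes> T)" using zero_obj_monic monic_tensor_right[OF D(3) k(1) T(1)] kT by blast
  then have K: "zero_obj C K" using tensor_no_zero_divisors obj T by blast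
  show ?thesis
  proof (rule monicI[OF c])
    fix W g assume g: "g \<in> hom C W X" "c \<cdot> g = \<zero> W Y"
    obtain u where u: "u \<in> hom C W K" "k \<cdot> u = g" using D(2)[OF g] by blast
    then show "g = \<zero> W X" using zero_obj_hom(2)[OF K u(1)] comp_zero[OF k(1)] hom_obj(1)[OF g(1)] by simp
  qed
qed

lemma epic_tensor_cancel:
  assumes c: "c \<in> hom C X Y" and T: "T \<in> Obj C" "\<not> zero_obj C T" and m: "epic C (c \<boxtimes> \<i>\<d> T)"
  shows "epic C c"
proof -
  obtain Q q where q: "q \<in> hom C Y Q" "is_cokernel C c q" using c by (rule cokernelE)
  note D = is_cokernelD[OF q(2) c q(1)]
  have obj: "X \<in> Obj C" "Y \<in> Obj C" "Q \<in> Obj C" using c q(1) hom_obj by auto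
  have qT: "q \<boxtimes> \<i>\<d> T \<in> hom C (Y \<otimes> T) (Q \<otimes> T)" and cT: "c \<boxtimes> \<i>\<d> T \<in> hom C (X \<otimes> T) (Y \<otimes> T)"
    using c q T by (auto intro: tensor_hom id_hom)
  have "(q \<boxtimes> \<i>\<d> T) \<cdot> (c \<boxtimes> \<i>\<d> T) = \<zero> (X \<otimes> T) (Q \<otimes> T)"
    using is_cokernelD(1)[OF is_cokernel_tensor_right[OF c q T(1)] cT qT] .
  then have "q \<boxtimes> \<i>\<d> T = \<zero> (Y \<otimes> T) (Q \<otimes> T)" using epic_zeroD[OF m cT qT] by blast
  then have "zero_obj C (Q \<otimes> T)" using zero_obj_epic epic_tensor_right[OF D(3) q(1) T(1)] qT by blast
  then have Q: "zero_obj C Q" using tensor_no_zero_divisors obj T by blast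
  show ?thesis
  proof (rule epicI[OF c])
    fix W g assume g: "g \<in> hom C Y W" "g \<cdot> c = \<zero> X W"
    obtain u where u: "u \<in> hom C Q W" "u \<cdot> q = g" using D(2)[OF g] by blast
    then show "g = \<zero> Y W" using zero_obj_hom(1)[OF Q u(1)] zero_comp[OF q(1)] hom_obj(2)[OF g(1)] by simp
  qed
qed

end


section \<open>The essential image\<close>

context linear_category
begin

text \<open>Only a retract is produced, even though it will be applied to isomorphisms: the
  essential image is closed under retracts, so the second composite need not be computed.\<close>

lemma biproduct_retract:
  assumes B: "biproduct C X Y B i j p q" and B': "biproduct C X' Y' B' i' j' p' q'"
    and f: "f \<in> hom C X X'" "g \<in> hom C X' X" "g \<cdot> f = \<i>\<d> X"
    and h: "h \<in> hom C Y Y'" "k \<in> hom C Y' Y" "k \<cdot> h = \<i>\<d> Y"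
  shows "\<exists>s\<in>hom C B B'. \<exists>r\<in>hom C B' B. r \<cdot> s = \<i>\<d> B"
proof (intro bexI)
  have b: "i \<in> hom C X B" "j \<in> hom C Y B" "p \<in> hom C B X" "q \<in> hom C B Y"
    and sum: "(i \<cdot> p) \<oplus> (j \<cdot> q) = \<i>\<d> B"
    using B by (auto simp: biproduct_def)
  have b': "i' \<in> hom C X' B'" "j' \<in> hom C Y' B'" "p' \<in> hom C B' X'" "q' \<in> hom C B' Y'"
    and e': "p' \<cdot> i' = \<i>\<d> X'" "q' \<cdot> j' = \<i>\<d> Y'" "q' \<cdot> i' = \<zero> X' Y'" "p' \<cdot> j' = \<zero> Y' X'"
    using B' by (auto simp: biproduct_def)
  \<comment> \<open>The direct sums of \<open>f\<close> and \<open>h\<close> and of \<open>g\<close>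
    and \<open>k\<close>, written through injections and projections.\<close>
  let ?s = "(i' \<cdot> f \<cdot> p) \<oplus> (j' \<cdot> h \<cdot> q)" and ?r = "(i \<cdot> g \<cdot> p') \<oplus> (j \<cdot> k \<cdot> q')"
  have fp: "f \<cdot> p \<in> hom C B X'" and hq: "h \<cdot> q \<in> hom C B Y'" and gp: "g \<cdot> p' \<in> hom C B' X"
    and kq: "k \<cdot> q' \<in> hom C B' Y"
    using f h b b' comp_hom by auto
  have t: "i' \<cdot> f \<cdot> p \<in> hom C B B'" "j' \<cdot> h \<cdot> q \<in> hom C B B'"
    and u: "i \<cdot> g \<cdot> p' \<in> hom C B' B" "j \<cdot> k \<cdot> q' \<in> hom C B' B"
    using fp hq gp kq b b' comp_hom by auto
  show s: "?s \<in> hom C B B'" and r: "?r \<in> hom C B' B" using t u add_hom by auto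
  have obj: "X' \<in> Obj C" "Y' \<in> Obj C" using b' hom_obj by auto
  have "p' \<cdot> ?s = (p' \<cdot> i') \<cdot> (f \<cdot> p) \<oplus> (p' \<cdot> j') \<cdot> (h \<cdot> q)"
    using comp_assoc[OF fp b'(1,3)] comp_assoc[OF hq b'(2,3)] comp_add_right[OF t b'(3)] by simp
  also have "\<dots> = f \<cdot> p" using e' zero_comp[OF hq] fp obj by (simp add: comp_id_left add_zero)
  finally have ps: "p' \<cdot> ?s = f \<cdot> p" .
  have "q' \<cdot> ?s = (q' \<cdot> i') \<cdot> (f \<cdot> p) \<oplus> (q' \<cdot> j') \<cdot> (h \<cdot> q)"
    using comp_assoc[OF fp b'(1,4)] comp_assoc[OF hq b'(2,4)] comp_add_right[OF t b'(4)] by simp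
  also have "\<dots> = h \<cdot> q" using e' zero_comp[OF fp] hq obj by (simp add: comp_id_left zero_add)
  finally have qs: "q' \<cdot> ?s = h \<cdot> q" .
  have "?r \<cdot> ?s = (i \<cdot> g \<cdot> p') \<cdot> ?s \<oplus> (j \<cdot> k \<cdot> q') \<cdot> ?s"
    by (rule comp_add_left[OF s u])
  also have "(i \<cdot> g \<cdot> p') \<cdot> ?s = i \<cdot> g \<cdot> p' \<cdot> ?s"
    using comp_assoc[OF s gp b(1)] comp_assoc[OF s b'(3) f(2)] by simp
  also have "\<dots> = i \<cdot> (g \<cdot> f) \<cdot> p" using ps comp_assoc[OF b(3) f(1,2)] by simp
  also have "\<dots> = i \<cdot> p" using f(3) comp_id_left[OF b(3)] by simp
  also have "(j \<cdot> k \<cdot> q') \<cdot> ?s = j \<cdot> k \<cdot> q' \<cdot> ?s"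
    using comp_assoc[OF s kq b(2)] comp_assoc[OF s b'(4) h(2)] by simp
  also have "\<dots> = j \<cdot> (k \<cdot> h) \<cdot> q" using qs comp_assoc[OF b(4) h(1,2)] by simp
  also have "\<dots> = j \<cdot> q" using h(3) comp_id_left[OF b(4)] by simp
  finally show "?r \<cdot> ?s = \<i>\<d> B" using sum by simp
qed

end


section \<open>Closure properties of the essential image and transfer of unit and counit\<close>

locale tensor_embedding =
  linear_symmetric_monoidal_functor D V F + D: additive_category D + D: karoubian_category D +
  D: rigid_symmetric_monoidal_category D + V: tensor_category V
  for D :: "('k::field, 'o, 'm, 'y) monoidal_category_scheme"
    and V :: "('k, 'p, 'n, 'z) monoidal_category_scheme"
    and F :: "('o, 'm, 'p, 'n, 'w) monoidal_functor_scheme" +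
  assumes ff: "fully_faithful D V F"
    and Ext1_ess_image: "\<lbrakk>T \<in> ess_image D V F; T' \<in> ess_image D V F\<rbrakk>
      \<Longrightarrow> Ext1 V T T' = {Ext1_zero V T T'}"
begin

abbreviation "E \<equiv> ess_image D V F"

lemma full: "\<lbrakk>X \<in> Obj D; Y \<in> Obj D; g \<in> hom V (FObj F X) (FObj F Y)\<rbrakk> \<Longrightarrow> \<exists>f\<in>hom D X Y. FArr F f = g"
proof -
  assume "X \<in> Obj D" "Y \<in> Obj D" and g: "g \<in> hom V (FObj F X) (FObj F Y)"
  then have "FArr F ` hom D X Y = hom V (FObj F X) (FObj F Y)"
    using ff unfolding fully_faithful_def bij_betw_def by blast
  then have "g \<in> FArr F ` hom D X Y" using g by simp
  then show ?thesis by blast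
qed

lemma faithful: "\<lbrakk>f \<in> hom D X Y; g \<in> hom D X Y; FArr F f = FArr F g\<rbrakk> \<Longrightarrow> f = g"
proof -
  assume f: "f \<in> hom D X Y" and g: "g \<in> hom D X Y" and eq: "FArr F f = FArr F g"
  have "inj_on (FArr F) (hom D X Y)"
    using ff D.hom_obj[OF f] unfolding fully_faithful_def bij_betw_def by blast
  then show ?thesis using eq f g by (rule inj_onD)
qed

lemma map_zero:
  assumes "X \<in> Obj D" "Y \<in> Obj D"
  shows "FArr F (\<zero>\<^bsub>D\<^esub> X Y) = \<zero>\<^bsub>V\<^esub> (FObj F X) (FObj F Y)"
proof (rule V.add_idem_zero)
  have z: "\<zero>\<^bsub>D\<^esub> X Y \<in> hom D X Y" using assms by (rule D.zero_hom)
  then show "FArr F (\<zero>\<^bsub>D\<^esub> X Y) \<in> hom V (FObj F X) (FObj F Y)" by (rule map_hom)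
  show "FArr F (\<zero>\<^bsub>D\<^esub> X Y) \<oplus>\<^bsub>V\<^esub> FArr F (\<zero>\<^bsub>D\<^esub> X Y) = FArr F (\<zero>\<^bsub>D\<^esub> X Y)"
    using map_add[OF z z] D.add_zero[OF z] by simp
qed

lemma zero_obj_map_iff:
  assumes "X \<in> Obj D" shows "zero_obj V (FObj F X) \<longleftrightarrow> zero_obj D X"
proof -
  have "FArr F (\<i>\<d>\<^bsub>D\<^esub> X) = FArr F (\<zero>\<^bsub>D\<^esub> X X) \<longleftrightarrow> \<i>\<d>\<^bsub>D\<^esub> X = \<zero>\<^bsub>D\<^esub> X X"
    using faithful[OF D.id_hom[OF assms] D.zero_hom[OF assms assms]] by metis
  then show ?thesis
    using assms map_obj[OF assms] map_id[OF assms] map_zero[OF assms assms]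
    by (simp add: V.zero_obj_iff D.zero_obj_iff)
qed

lemma map_ess_image: "A \<in> Obj D \<Longrightarrow> FObj F A \<in> E"
  using map_obj V.isomorphic_refl by (auto simp: ess_image_def)

lemma ess_image_isomorphic: "X \<in> E \<Longrightarrow> isomorphic V X Y \<Longrightarrow> Y \<in> E"
proof -
  assume "X \<in> E" and XY: "isomorphic V X Y"
  then obtain A where A: "A \<in> Obj D" "isomorphic V X (FObj F A)" by (auto simp: ess_image_def)
  have "isomorphic V Y (FObj F A)" by (rule V.isomorphic_trans[OF V.isomorphic_sym[OF XY] A(2)])
  then show ?thesis using A(1) V.isomorphic_obj(2)[OF XY] by (auto simp: ess_image_def)
qed

text \<open>The idempotent \<open>s \<cdot> r\<close> lifts to \<open>D\<close> by fullness, and the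
  lift is idempotent by faithfulness. A splitting of it in \<open>D\<close> maps to a second
  splitting of \<open>s \<cdot> r\<close>, and any two splittings of an idempotent are
  isomorphic.\<close>

lemma ess_image_retract:
  assumes A: "A \<in> Obj D" and s: "s \<in> hom V X (FObj F A)" and r: "r \<in> hom V (FObj F A) X"
    and rs: "r \<cdot>\<^bsub>V\<^esub> s = \<i>\<d>\<^bsub>V\<^esub> X"
  shows "X \<in> E"
proof -
  have sr: "s \<cdot>\<^bsub>V\<^esub> r \<in> hom V (FObj F A) (FObj F A)" using s r V.comp_hom by blast
  then obtain e where e: "e \<in> hom D A A" "FArr F e = s \<cdot>\<^bsub>V\<^esub> r" using full A by blast
  have "r \<cdot>\<^bsub>V\<^esub> s \<cdot>\<^bsub>V\<^esub> r = r"
    using V.comp_assoc[OF r s r] rs V.comp_id_left[OF r] by simp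
  then have "FArr F (e \<cdot>\<^bsub>D\<^esub> e) = FArr F e"
    using map_comp[OF e(1,1)] e(2) V.comp_assoc[OF sr r s] by simp
  then have "e \<cdot>\<^bsub>D\<^esub> e = e" using faithful e(1) D.comp_hom by blast
  then obtain B r' s' where B: "B \<in> Obj D" "r' \<in> hom D A B" "s' \<in> hom D B A"
    "s' \<cdot>\<^bsub>D\<^esub> r' = e" "r' \<cdot>\<^bsub>D\<^esub> s' = \<i>\<d>\<^bsub>D\<^esub> B"
    using D.idempotents_split e(1) by metis
  have R: "FArr F r' \<in> hom V (FObj F A) (FObj F B)" and S: "FArr F s' \<in> hom V (FObj F B) (FObj F A)"
    and SR: "FArr F s' \<cdot>\<^bsub>V\<^esub> FArr F r' = s \<cdot>\<^bsub>V\<^esub> r"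
    and RS: "FArr F r' \<cdot>\<^bsub>V\<^esub> FArr F s' = \<i>\<d>\<^bsub>V\<^esub> (FObj F B)"
    using B map_hom map_comp[OF B(2,3)] map_comp[OF B(3,2)] e(2) map_id by auto
  \<comment> \<open>The comparison arrows between the splittings: the section of one followed by the
    retraction of the other.\<close>
  have Rs: "FArr F r' \<cdot>\<^bsub>V\<^esub> s \<in> hom V X (FObj F B)" and rS: "r \<cdot>\<^bsub>V\<^esub> FArr F s' \<in> hom V (FObj F B) X"
    using R S r s V.comp_hom by auto
  have "(r \<cdot>\<^bsub>V\<^esub> FArr F s') \<cdot>\<^bsub>V\<^esub> (FArr F r' \<cdot>\<^bsub>V\<^esub> s) = r \<cdot>\<^bsub>V\<^esub> (FArr F s' \<cdot>\<^bsub>V\<^esub> FArr F r') \<cdot>\<^bsub>V\<^esub> s"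
    using V.comp_assoc[OF Rs S r] V.comp_assoc[OF s R S] by simp
  also have "\<dots> = (r \<cdot>\<^bsub>V\<^esub> s) \<cdot>\<^bsub>V\<^esub> (r \<cdot>\<^bsub>V\<^esub> s)"
    using SR V.comp_assoc[OF s r s] V.comp_assoc[OF V.comp_hom[OF s r] s r] by simp
  also have "\<dots> = \<i>\<d>\<^bsub>V\<^esub> X" using rs V.comp_id_left[OF V.id_hom] V.hom_obj(1)[OF s] by simp
  finally have 1: "(r \<cdot>\<^bsub>V\<^esub> FArr F s') \<cdot>\<^bsub>V\<^esub> (FArr F r' \<cdot>\<^bsub>V\<^esub> s) = \<i>\<d>\<^bsub>V\<^esub> X" .
  have "(FArr F r' \<cdot>\<^bsub>V\<^esub> s) \<cdot>\<^bsub>V\<^esub> (r \<cdot>\<^bsub>V\<^esub> FArr F s') = FArr F r' \<cdot>\<^bsub>V\<^esub> (s \<cdot>\<^bsub>V\<^esub> r) \<cdot>\<^bsub>V\<^esub> FArr F s'"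
    using V.comp_assoc[OF rS s R] V.comp_assoc[OF S r s] by simp
  also have "\<dots> = (FArr F r' \<cdot>\<^bsub>V\<^esub> FArr F s') \<cdot>\<^bsub>V\<^esub> (FArr F r' \<cdot>\<^bsub>V\<^esub> FArr F s')"
    using SR[symmetric] V.comp_assoc[OF S R S] V.comp_assoc[OF V.comp_hom[OF S R] S R] by simp
  also have "\<dots> = \<i>\<d>\<^bsub>V\<^esub> (FObj F B)" using RS V.comp_id_left[OF V.id_hom] map_obj[OF B(1)] by simp
  finally have 2: "(FArr F r' \<cdot>\<^bsub>V\<^esub> s) \<cdot>\<^bsub>V\<^esub> (r \<cdot>\<^bsub>V\<^esub> FArr F s') = \<i>\<d>\<^bsub>V\<^esub> (FObj F B)" .
  show ?thesis
    using V.isomorphicI[OF Rs rS 1 2] B(1) V.hom_obj(1)[OF s] by (auto simp: ess_image_def)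
qed

lemma map_tensor_isomorphic:
  "A \<in> Obj D \<Longrightarrow> B \<in> Obj D \<Longrightarrow> isomorphic V (FObj F A \<otimes>\<^bsub>V\<^esub> FObj F B) (FObj F (A \<otimes>\<^bsub>D\<^esub> B))"
  using mult_hom mult_iso V.iso_isomorphic by blast

lemma ess_image_tensor:
  assumes "X \<in> E" "Y \<in> E" shows "X \<otimes>\<^bsub>V\<^esub> Y \<in> E"
proof -
  obtain A B where AB: "A \<in> Obj D" "B \<in> Obj D" "isomorphic V X (FObj F A)" "isomorphic V Y (FObj F B)"
    using assms by (auto simp: ess_image_def)
  have "isomorphic V (X \<otimes>\<^bsub>V\<^esub> Y) (FObj F (A \<otimes>\<^bsub>D\<^esub> B))"
    by (rule V.isomorphic_trans[OF V.isomorphic_tensor[OF AB(3,4)] map_tensor_isomorphic[OF AB(1,2)]])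
  then show ?thesis
    by (rule ess_image_isomorphic[OF map_ess_image[OF D.tensor_obj[OF AB(1,2)]] V.isomorphic_sym])
qed

lemma map_biproduct:
  assumes B: "biproduct D X Y B i j p q"
  shows "biproduct V (FObj F X) (FObj F Y) (FObj F B) (FArr F i) (FArr F j) (FArr F p) (FArr F q)"
proof -
  have B1: "B \<in> Obj D" "i \<in> hom D X B" "j \<in> hom D Y B" "p \<in> hom D B X" "q \<in> hom D B Y"
    and B2: "p \<cdot>\<^bsub>D\<^esub> i = \<i>\<d>\<^bsub>D\<^esub> X" "q \<cdot>\<^bsub>D\<^esub> j = \<i>\<d>\<^bsub>D\<^esub> Y" "q \<cdot>\<^bsub>D\<^esub> i = \<zero>\<^bsub>D\<^esub> X Y"
      "p \<cdot>\<^bsub>D\<^esub> j = \<zero>\<^bsub>D\<^esub> Y X" "(i \<cdot>\<^bsub>D\<^esub> p) \<oplus>\<^bsub>D\<^esub> (j \<cdot>\<^bsub>D\<^esub> q) = \<i>\<d>\<^bsub>D\<^esub> B"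
    using B by (auto simp: biproduct_def)
  have obj: "X \<in> Obj D" "Y \<in> Obj D" using B1 D.hom_obj by auto
  have "(FArr F i \<cdot>\<^bsub>V\<^esub> FArr F p) \<oplus>\<^bsub>V\<^esub> (FArr F j \<cdot>\<^bsub>V\<^esub> FArr F q) = \<i>\<d>\<^bsub>V\<^esub> (FObj F B)"
    using map_comp[OF B1(4,2)] map_comp[OF B1(5,3)] B2(5) map_id[OF B1(1)]
      map_add[OF D.comp_hom[OF B1(4,2)] D.comp_hom[OF B1(5,3)]] by simp
  then show ?thesis
    using B1 map_hom map_obj map_comp[OF B1(2,4)] map_comp[OF B1(3,5)] map_comp[OF B1(2,5)]
      map_comp[OF B1(3,4)] obj
    by (auto simp: biproduct_def B2 map_id map_zero)
qed

lemma ess_image_biproduct: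
  assumes "X \<in> E" "Y \<in> E" and B: "biproduct V X Y B i j p q"
  shows "B \<in> E"
proof -
  obtain X' Y' where X': "X' \<in> Obj D" "Y' \<in> Obj D" "isomorphic V X (FObj F X')" "isomorphic V Y (FObj F Y')"
    using assms by (auto simp: ess_image_def)
  obtain B' i' j' p' q' where B': "biproduct D X' Y' B' i' j' p' q'" using D.ex_biproduct X' by blast
  obtain f g where f: "f \<in> hom V X (FObj F X')" "g \<in> hom V (FObj F X') X" "g \<cdot>\<^bsub>V\<^esub> f = \<i>\<d>\<^bsub>V\<^esub> X"
    using X'(3) by (rule V.isomorphicE)
  obtain h k where h: "h \<in> hom V Y (FObj F Y')" "k \<in> hom V (FObj F Y') Y" "k \<cdot>\<^bsub>V\<^esub> h = \<i>\<d>\<^bsub>V\<^esub> Y"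
    using X'(4) by (rule V.isomorphicE)
  obtain s r where "s \<in> hom V B (FObj F B')" "r \<in> hom V (FObj F B') B" "r \<cdot>\<^bsub>V\<^esub> s = \<i>\<d>\<^bsub>V\<^esub> B"
    using V.biproduct_retract[OF B map_biproduct[OF B'] f h] by blast
  moreover have "B' \<in> Obj D" using B' by (simp add: biproduct_def)
  ultimately show ?thesis using ess_image_retract by blast
qed

text \<open>As \<open>Ext1\<close> has \<open>Ext1_zero\<close> as its only element, the class of
  the sequence is \<open>Ext1_zero\<close>. Since the sequence lies in its own class, it is
  equivalent to a biproduct sequence, whose injection transports to a section.\<close>

lemma short_exact_split:
  assumes A: "A \<in> E" and B: "B \<in> E" and i: "i \<in> hom V B X" and q: "q \<in> hom V X A"
    and ex: "short_exact V i q"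
  shows "X \<in> E" "\<exists>s\<in>hom V A X. q \<cdot>\<^bsub>V\<^esub> s = \<i>\<d>\<^bsub>V\<^esub> A"
proof -
  have e: "(i, q) \<in> extensions V A B" using ex i q by (auto simp: extensions_def hom_def)
  have X: "X \<in> Obj V" using i V.hom_obj by blast
  \<comment> \<open>Reflexivity of the equivalence, via the identity of \<open>X\<close>, places the
    sequence in its own class.\<close>
  have "((i, q), (i, q)) \<in> ext_rel V A B"
  proof -
    have "iso_arr V (\<i>\<d>\<^bsub>V\<^esub> X)" using V.iso_arrI[OF V.id_hom V.id_hom] X V.comp_id_left[OF V.id_hom] by simp
    moreover have "\<i>\<d>\<^bsub>V\<^esub> X \<in> hom V (Cod V i) (Cod V i)" using i X V.id_hom by (auto simp: hom_def)
    ultimately show ?thesis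
      using e V.comp_id_left[OF i] V.comp_id_right[OF q] by (auto simp: ext_rel_def)
  qed
  moreover have "ext_rel V A B `` {(i, q)} \<in> Ext1 V A B" using e by (auto simp: Ext1_def quotient_def)
  ultimately have "(i, q) \<in> Ext1_zero V A B" using Ext1_ess_image[OF A B] by blast
  then obtain Z i' j p q' where bp: "biproduct V B A Z i' j p q'"
    and rel: "((i', q'), (i, q)) \<in> ext_rel V A B" by (auto simp: Ext1_zero_def)
  have b: "i' \<in> hom V B Z" "j \<in> hom V A Z" "q' \<in> hom V Z A" "q' \<cdot>\<^bsub>V\<^esub> j = \<i>\<d>\<^bsub>V\<^esub> A"
    using bp by (auto simp: biproduct_def)
  obtain f where f: "f \<in> hom V Z X" "iso_arr V f" "q \<cdot>\<^bsub>V\<^esub> f = q'"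
    using rel b(1) i by (auto simp: ext_rel_def hom_def)
  show "X \<in> E"
    using ess_image_biproduct[OF B A bp] ess_image_isomorphic V.iso_isomorphic[OF f(1,2)] by blast
  have "q \<cdot>\<^bsub>V\<^esub> f \<cdot>\<^bsub>V\<^esub> j = \<i>\<d>\<^bsub>V\<^esub> A" using V.comp_assoc[OF b(2) f(1) q] f(3) b(4) by simp
  then show "\<exists>s\<in>hom V A X. q \<cdot>\<^bsub>V\<^esub> s = \<i>\<d>\<^bsub>V\<^esub> A" using V.comp_hom[OF b(2) f(1)] by blast
qed

lemma unit_map_isomorphic: "isomorphic V \<one>\<^bsub>V\<^esub> (FObj F \<one>\<^bsub>D\<^esub>)"
  using unit_hom unit_iso V.iso_isomorphic by blast

lemma unit_not_zero_D: "\<not> zero_obj D \<one>\<^bsub>D\<^esub>"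
  using V.zero_obj_isomorphic[OF V.isomorphic_sym[OF unit_map_isomorphic]] V.unit_not_zero
    zero_obj_map_iff[OF D.unit_obj] by blast

lemma tensor_not_zero:
  assumes "A \<in> Obj D" "B \<in> Obj D" "\<not> zero_obj D A" "\<not> zero_obj D B"
  shows "\<not> zero_obj D (A \<otimes>\<^bsub>D\<^esub> B)"
proof
  assume "zero_obj D (A \<otimes>\<^bsub>D\<^esub> B)"
  then have "zero_obj V (FObj F A \<otimes>\<^bsub>V\<^esub> FObj F B)"
    using V.zero_obj_isomorphic[OF V.isomorphic_sym[OF map_tensor_isomorphic[OF assms(1,2)]]]
      zero_obj_map_iff[OF D.tensor_obj[OF assms(1,2)]] by blast
  then show False
    using V.tensor_no_zero_divisors[OF map_obj[OF assms(1)] map_obj[OF assms(2)]]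
      zero_obj_map_iff[OF assms(1)] zero_obj_map_iff[OF assms(2)] assms(3,4) by blast
qed

lemma tensor_map_isomorphic:
  assumes "X \<in> Obj V" "A \<in> Obj D" "B \<in> Obj D"
  shows "isomorphic V ((X \<otimes>\<^bsub>V\<^esub> FObj F A) \<otimes>\<^bsub>V\<^esub> FObj F B) (X \<otimes>\<^bsub>V\<^esub> FObj F (A \<otimes>\<^bsub>D\<^esub> B))"
  by (rule V.isomorphic_trans[OF V.isomorphic_assoc[OF assms(1) map_obj[OF assms(2)] map_obj[OF assms(3)]]
    V.isomorphic_tensor[OF V.isomorphic_refl[OF assms(1)] map_tensor_isomorphic[OF assms(2,3)]]])

lemma tensor_map_isomorphic':
  assumes "X \<in> Obj V" "A \<in> Obj D" "B \<in> Obj D"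
  shows "isomorphic V ((X \<otimes>\<^bsub>V\<^esub> FObj F A) \<otimes>\<^bsub>V\<^esub> FObj F B) (X \<otimes>\<^bsub>V\<^esub> FObj F (B \<otimes>\<^bsub>D\<^esub> A))"
proof -
  have "isomorphic V (X \<otimes>\<^bsub>V\<^esub> (FObj F B \<otimes>\<^bsub>V\<^esub> FObj F A)) ((X \<otimes>\<^bsub>V\<^esub> FObj F A) \<otimes>\<^bsub>V\<^esub> FObj F B)"
    by (rule V.isomorphic_swap_right[OF assms(1) map_obj[OF assms(3)] map_obj[OF assms(2)]])
  moreover have "isomorphic V (X \<otimes>\<^bsub>V\<^esub> (FObj F B \<otimes>\<^bsub>V\<^esub> FObj F A)) (X \<otimes>\<^bsub>V\<^esub> FObj F (B \<otimes>\<^bsub>D\<^esub> A))"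
    by (rule V.isomorphic_tensor[OF V.isomorphic_refl[OF assms(1)] map_tensor_isomorphic[OF assms(3,2)]])
  ultimately show ?thesis by (rule V.isomorphic_trans[OF V.isomorphic_sym])
qed

lemma tensor_map_ess_image:
  assumes "X \<in> Obj V" "A \<in> Obj D" "B \<in> Obj D" "X \<otimes>\<^bsub>V\<^esub> FObj F A \<in> E"
  shows "X \<otimes>\<^bsub>V\<^esub> FObj F (A \<otimes>\<^bsub>D\<^esub> B) \<in> E" "X \<otimes>\<^bsub>V\<^esub> FObj F (B \<otimes>\<^bsub>D\<^esub> A) \<in> E"
  by (rule ess_image_isomorphic[OF ess_image_tensor[OF assms(4) map_ess_image[OF assms(3)]]
      tensor_map_isomorphic[OF assms(1-3)]],
    rule ess_image_isomorphic[OF ess_image_tensor[OF assms(4) map_ess_image[OF assms(3)]]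
      tensor_map_isomorphic'[OF assms(1-3)]])

text \<open>Relates tensoring after \<open>F\<close> to tensoring before \<open>F\<close>. As
  \<open>n\<close> and \<open>FMult\<close> are invertible, monicity or epicness of the image of the
  tensored arrow passes to the tensored image.\<close>

lemma map_tensor_id:
  assumes f: "f \<in> hom D X X'" and A: "A \<in> Obj D"
  obtains n where "n \<in> hom V (FObj F (X' \<otimes>\<^bsub>D\<^esub> A)) (FObj F X' \<otimes>\<^bsub>V\<^esub> FObj F A)" "iso_arr V n"
    "FArr F f \<boxtimes>\<^bsub>V\<^esub> \<i>\<d>\<^bsub>V\<^esub> (FObj F A) = n \<cdot>\<^bsub>V\<^esub> FArr F (f \<boxtimes>\<^bsub>D\<^esub> \<i>\<d>\<^bsub>D\<^esub> A) \<cdot>\<^bsub>V\<^esub> FMult F X A"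
proof -
  have X: "X \<in> Obj D" "X' \<in> Obj D" using D.hom_obj f by auto
  note m = mult_hom[OF X(2) A]
  obtain n where n: "n \<in> hom V (FObj F (X' \<otimes>\<^bsub>D\<^esub> A)) (FObj F X' \<otimes>\<^bsub>V\<^esub> FObj F A)"
    "n \<cdot>\<^bsub>V\<^esub> FMult F X' A = \<i>\<d>\<^bsub>V\<^esub> (FObj F X' \<otimes>\<^bsub>V\<^esub> FObj F A)"
    "FMult F X' A \<cdot>\<^bsub>V\<^esub> n = \<i>\<d>\<^bsub>V\<^esub> (FObj F (X' \<otimes>\<^bsub>D\<^esub> A))"
    using mult_iso[OF X(2) A] m by (rule V.iso_arrE)
  have g: "FArr F f \<boxtimes>\<^bsub>V\<^esub> \<i>\<d>\<^bsub>V\<^esub> (FObj F A) \<in> hom V (FObj F X \<otimes>\<^bsub>V\<^esub> FObj F A) (FObj F X' \<otimes>\<^bsub>V\<^esub> FObj F A)"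
    using V.tensor_hom map_hom[OF f] V.id_hom map_obj[OF A] by blast
  have "FMult F X' A \<cdot>\<^bsub>V\<^esub> (FArr F f \<boxtimes>\<^bsub>V\<^esub> \<i>\<d>\<^bsub>V\<^esub> (FObj F A)) = FArr F (f \<boxtimes>\<^bsub>D\<^esub> \<i>\<d>\<^bsub>D\<^esub> A) \<cdot>\<^bsub>V\<^esub> FMult F X A"
    using mult_natural[OF f D.id_hom[OF A]] map_id[OF A] by simp
  then have "FArr F f \<boxtimes>\<^bsub>V\<^esub> \<i>\<d>\<^bsub>V\<^esub> (FObj F A) = n \<cdot>\<^bsub>V\<^esub> FArr F (f \<boxtimes>\<^bsub>D\<^esub> \<i>\<d>\<^bsub>D\<^esub> A) \<cdot>\<^bsub>V\<^esub> FMult F X A"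
    using V.comp_assoc[OF g m n(1)] n(2) V.comp_id_left[OF g] by simp
  then show ?thesis using that n(1) V.iso_arrI[OF n(1) m n(3,2)] by blast
qed

text \<open>The coevaluation tensored with \<open>A\<close> splits in \<open>D\<close>, so its image
  is monic. After passing through the structure isomorphisms, the nonzero factor
  \<open>FObj F A\<close> can be cancelled in \<open>V\<close>.\<close>

lemma map_coev_monic:
  assumes d: "is_dual D A A' ev coev" and A: "\<not> zero_obj D A"
  shows "monic V (FArr F coev)"
proof -
  have o: "A \<in> Obj D" "A' \<in> Obj D" "coev \<in> hom D \<one>\<^bsub>D\<^esub> (A \<otimes>\<^bsub>D\<^esub> A')" using d by (auto simp: is_dual_def)
  let ?c = "coev \<boxtimes>\<^bsub>D\<^esub> \<i>\<d>\<^bsub>D\<^esub> A"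
  have c: "?c \<in> hom D (\<one>\<^bsub>D\<^esub> \<otimes>\<^bsub>D\<^esub> A) ((A \<otimes>\<^bsub>D\<^esub> A') \<otimes>\<^bsub>D\<^esub> A)" using o D.tensor_hom D.id_hom by blast
  obtain g where g: "g \<in> hom D ((A \<otimes>\<^bsub>D\<^esub> A') \<otimes>\<^bsub>D\<^esub> A) (\<one>\<^bsub>D\<^esub> \<otimes>\<^bsub>D\<^esub> A)"
    "g \<cdot>\<^bsub>D\<^esub> ?c = \<i>\<d>\<^bsub>D\<^esub> (\<one>\<^bsub>D\<^esub> \<otimes>\<^bsub>D\<^esub> A)" using D.dual_unit_split[OF d] by blast
  have m: "monic V (FArr F ?c)"
    using V.split_monic[OF map_hom[OF c] map_hom[OF g(1)]] map_comp[OF c g(1)] g(2) map_id o by simp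
  obtain n where n: "n \<in> hom V (FObj F ((A \<otimes>\<^bsub>D\<^esub> A') \<otimes>\<^bsub>D\<^esub> A)) (FObj F (A \<otimes>\<^bsub>D\<^esub> A') \<otimes>\<^bsub>V\<^esub> FObj F A)" "iso_arr V n"
    "FArr F coev \<boxtimes>\<^bsub>V\<^esub> \<i>\<d>\<^bsub>V\<^esub> (FObj F A) = n \<cdot>\<^bsub>V\<^esub> FArr F ?c \<cdot>\<^bsub>V\<^esub> FMult F \<one>\<^bsub>D\<^esub> A"
    using o(3,1) by (rule map_tensor_id)
  note mu = mult_hom[OF D.unit_obj o(1)]
  have "monic V (FArr F ?c \<cdot>\<^bsub>V\<^esub> FMult F \<one>\<^bsub>D\<^esub> A)"
    by (rule V.monic_comp[OF V.iso_monic[OF mult_iso[OF D.unit_obj o(1)] mu] mu m map_hom[OF c]])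
  then have "monic V (FArr F coev \<boxtimes>\<^bsub>V\<^esub> \<i>\<d>\<^bsub>V\<^esub> (FObj F A))"
    using V.monic_comp[OF _ V.comp_hom[OF mu map_hom[OF c]] V.iso_monic[OF n(2,1)] n(1)] n(3) by simp
  then show ?thesis
    using V.monic_tensor_cancel[OF map_hom[OF o(3)]] map_obj zero_obj_map_iff A o(1) by blast
qed

lemma map_ev_epic:
  assumes d: "is_dual D A A' ev coev" and A: "\<not> zero_obj D A"
  shows "epic V (FArr F ev)"
proof -
  have o: "A \<in> Obj D" "A' \<in> Obj D" "coev \<in> hom D \<one>\<^bsub>D\<^esub> (A \<otimes>\<^bsub>D\<^esub> A')" "ev \<in> hom D (A' \<otimes>\<^bsub>D\<^esub> A) \<one>\<^bsub>D\<^esub>"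
    using d by (auto simp: is_dual_def)
  \<comment> \<open>The evaluation splits after tensoring with \<open>A'\<close>, so it is
    \<open>A'\<close> that has to be cancelled. Were it zero, the monic image of the coevaluation
    would embed the unit into a zero object.\<close>
  have A': "\<not> zero_obj D A'"
  proof
    assume "zero_obj D A'"
    then have "zero_obj V (FObj F (A \<otimes>\<^bsub>D\<^esub> A'))"
      using D.zero_obj_tensor_right zero_obj_map_iff o(1,2) D.tensor_obj by blast
    then have "zero_obj V (FObj F \<one>\<^bsub>D\<^esub>)"
      using V.zero_obj_monic[OF map_coev_monic[OF d A] map_hom[OF o(3)]] V.zero_obj_hom(2) map_hom[OF o(3)]
      by blast
    then show False using unit_not_zero_D zero_obj_map_iff[OF D.unit_obj] by blast
  qed
  let ?c = "ev \<boxtimes>\<^bsub>D\<^esub> \<i>\<d>\<^bsub>D\<^esub> A'"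
  have c: "?c \<in> hom D ((A' \<otimes>\<^bsub>D\<^esub> A) \<otimes>\<^bsub>D\<^esub> A') (\<one>\<^bsub>D\<^esub> \<otimes>\<^bsub>D\<^esub> A')" using o D.tensor_hom D.id_hom by blast
  obtain g where g: "g \<in> hom D (\<one>\<^bsub>D\<^esub> \<otimes>\<^bsub>D\<^esub> A') ((A' \<otimes>\<^bsub>D\<^esub> A) \<otimes>\<^bsub>D\<^esub> A')"
    "?c \<cdot>\<^bsub>D\<^esub> g = \<i>\<d>\<^bsub>D\<^esub> (\<one>\<^bsub>D\<^esub> \<otimes>\<^bsub>D\<^esub> A')" using D.dual_counit_split[OF d] by blast
  have m: "epic V (FArr F ?c)"
    using V.split_epic[OF map_hom[OF c] map_hom[OF g(1)]] map_comp[OF g(1) c] g(2) map_id o by simp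
  obtain n where n: "n \<in> hom V (FObj F (\<one>\<^bsub>D\<^esub> \<otimes>\<^bsub>D\<^esub> A')) (FObj F \<one>\<^bsub>D\<^esub> \<otimes>\<^bsub>V\<^esub> FObj F A')" "iso_arr V n"
    "FArr F ev \<boxtimes>\<^bsub>V\<^esub> \<i>\<d>\<^bsub>V\<^esub> (FObj F A') = n \<cdot>\<^bsub>V\<^esub> FArr F ?c \<cdot>\<^bsub>V\<^esub> FMult F (A' \<otimes>\<^bsub>D\<^esub> A) A'"
    using o(4,2) by (rule map_tensor_id)
  have oo: "A' \<otimes>\<^bsub>D\<^esub> A \<in> Obj D" using o D.tensor_obj by blast
  note mu = mult_hom[OF oo o(2)]
  have "epic V (FArr F ?c \<cdot>\<^bsub>V\<^esub> FMult F (A' \<otimes>\<^bsub>D\<^esub> A) A')"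
    by (rule V.epic_comp[OF V.iso_epic[OF mult_iso[OF oo o(2)] mu] mu m map_hom[OF c]])
  then have "epic V (FArr F ev \<boxtimes>\<^bsub>V\<^esub> \<i>\<d>\<^bsub>V\<^esub> (FObj F A'))"
    using V.epic_comp[OF _ V.comp_hom[OF mu map_hom[OF c]] V.iso_epic[OF n(2,1)] n(1)] n(3) by simp
  then show ?thesis
    using V.epic_tensor_cancel[OF map_hom[OF o(4)]] map_obj zero_obj_map_iff A' o(2) by blast
qed

lemma simple_tensor_ess_image:
  assumes im: "\<And>X. X \<in> Obj V \<Longrightarrow> \<exists>P\<in>Obj D. \<exists>Q\<in>Obj D. \<exists>f\<in>hom D P Q. \<exists>m\<in>hom V X (FObj F Q). is_image V (FArr F f) m"
    and sp: "\<And>X Y e. e \<in> hom V X Y \<Longrightarrow> epic V e \<Longrightarrow>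
      \<exists>T\<in>Obj D. \<not> zero_obj D T \<and> split_epi V (e \<boxtimes>\<^bsub>V\<^esub> \<i>\<d>\<^bsub>V\<^esub> (FObj F T))"
    and X: "X \<in> Obj V"
  shows "\<exists>T\<in>E. \<not> zero_obj V T \<and> X \<otimes>\<^bsub>V\<^esub> T \<in> E"
proof -
  obtain P Q f m where f: "P \<in> Obj D" "Q \<in> Obj D" "f \<in> hom D P Q" "m \<in> hom V X (FObj F Q)"
    "is_image V (FArr F f) m" using im[OF X] by blast
  obtain e where e: "e \<in> hom V (FObj F P) X" "epic V e"
    using V.image_factor(2)[OF map_hom[OF f(3)] f(4,5)] by blast
  obtain T where T: "T \<in> Obj D" "\<not> zero_obj D T" "split_epi V (e \<boxtimes>\<^bsub>V\<^esub> \<i>\<d>\<^bsub>V\<^esub> (FObj F T))"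
    using sp[OF e] by blast
  let ?e = "e \<boxtimes>\<^bsub>V\<^esub> \<i>\<d>\<^bsub>V\<^esub> (FObj F T)"
  have eT: "?e \<in> hom V (FObj F P \<otimes>\<^bsub>V\<^esub> FObj F T) (X \<otimes>\<^bsub>V\<^esub> FObj F T)"
    using e(1) V.tensor_hom V.id_hom map_obj[OF T(1)] by blast
  then obtain s where s: "s \<in> hom V (X \<otimes>\<^bsub>V\<^esub> FObj F T) (FObj F P \<otimes>\<^bsub>V\<^esub> FObj F T)"
    "?e \<cdot>\<^bsub>V\<^esub> s = \<i>\<d>\<^bsub>V\<^esub> (X \<otimes>\<^bsub>V\<^esub> FObj F T)" using T(3) by (auto simp: split_epi_def hom_def)
  obtain h k where h: "h \<in> hom V (FObj F P \<otimes>\<^bsub>V\<^esub> FObj F T) (FObj F (P \<otimes>\<^bsub>D\<^esub> T))"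
    "k \<in> hom V (FObj F (P \<otimes>\<^bsub>D\<^esub> T)) (FObj F P \<otimes>\<^bsub>V\<^esub> FObj F T)"
    "k \<cdot>\<^bsub>V\<^esub> h = \<i>\<d>\<^bsub>V\<^esub> (FObj F P \<otimes>\<^bsub>V\<^esub> FObj F T)"
    using map_tensor_isomorphic[OF f(1) T(1)] by (rule V.isomorphicE)
  have "X \<otimes>\<^bsub>V\<^esub> FObj F T \<in> E"
    using ess_image_retract[OF D.tensor_obj[OF f(1) T(1)] V.comp_hom[OF s(1) h(1)] V.comp_hom[OF h(2) eT]
      V.comp_retract[OF s(1) eT s(2) h]] .
  then show ?thesis using map_ess_image[OF T(1)] zero_obj_map_iff[OF T(1)] T(2) by blast
qed

text \<open>One splitting serves two purposes: membership of the middle term is the step of the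
  induction on length, and the section gives the splitting of epimorphisms.\<close>

lemma extension_tensor_map:
  assumes i: "i \<in> hom V X Y" and q: "q \<in> hom V Y Z" and ex: "short_exact V i q"
    and A: "A \<in> Obj D" "\<not> zero_obj D A" "X \<otimes>\<^bsub>V\<^esub> FObj F A \<in> E"
    and B: "B \<in> Obj D" "\<not> zero_obj D B" "Z \<otimes>\<^bsub>V\<^esub> FObj F B \<in> E"
  shows "\<exists>T\<in>Obj D. \<not> zero_obj D T \<and> Y \<otimes>\<^bsub>V\<^esub> FObj F T \<in> E \<and> split_epi V (q \<boxtimes>\<^bsub>V\<^esub> \<i>\<d>\<^bsub>V\<^esub> (FObj F T))"
proof -
  \<comment> \<open>\<open>A\<close> is adapted to the left end and \<open>B\<close> to the right
    end. Their tensor product is adapted to both, because the essential image is closed under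
    further tensoring, and it is nonzero.\<close>
  define T where "T = A \<otimes>\<^bsub>D\<^esub> B"
  have obj: "X \<in> Obj V" "Z \<in> Obj V" using i q V.hom_obj by auto
  have T: "T \<in> Obj D" "\<not> zero_obj D T" unfolding T_def using A B tensor_not_zero D.tensor_obj by auto
  have XZ: "X \<otimes>\<^bsub>V\<^esub> FObj F T \<in> E" "Z \<otimes>\<^bsub>V\<^esub> FObj F T \<in> E"
    unfolding T_def using tensor_map_ess_image A B obj by auto
  have iT: "i \<boxtimes>\<^bsub>V\<^esub> \<i>\<d>\<^bsub>V\<^esub> (FObj F T) \<in> hom V (X \<otimes>\<^bsub>V\<^esub> FObj F T) (Y \<otimes>\<^bsub>V\<^esub> FObj F T)"
    and qT: "q \<boxtimes>\<^bsub>V\<^esub> \<i>\<d>\<^bsub>V\<^esub> (FObj F T) \<in> hom V (Y \<otimes>\<^bsub>V\<^esub> FObj F T) (Z \<otimes>\<^bsub>V\<^esub> FObj F T)"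
    using i q V.tensor_hom V.id_hom map_obj[OF T(1)] by auto
  note S = short_exact_split[OF XZ(2,1) iT qT V.short_exact_tensor_right[OF i q ex map_obj[OF T(1)]]]
  have "split_epi V (q \<boxtimes>\<^bsub>V\<^esub> \<i>\<d>\<^bsub>V\<^esub> (FObj F T))"
    using S(2) qT by (auto simp: split_epi_def hom_def)
  then show ?thesis using T S(1) by blast
qed

section \<open>From simple objects to all objects, epimorphisms and images\<close>

context
  assumes simple: "\<And>X. simple_obj V X \<Longrightarrow> \<exists>T\<in>E. \<not> zero_obj V T \<and> X \<otimes>\<^bsub>V\<^esub> T \<in> E"
begin

text \<open>Replaces \<open>T\<close> by the image of an object of \<open>D\<close>, so that
  witnesses can be tensored and dualised in \<open>D\<close>.\<close>

lemma simple_tensor_map: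
  assumes "simple_obj V X"
  shows "\<exists>A\<in>Obj D. \<not> zero_obj D A \<and> X \<otimes>\<^bsub>V\<^esub> FObj F A \<in> E"
proof -
  have X: "X \<in> Obj V" using assms by (simp add: simple_obj_def)
  obtain T where T: "T \<in> E" "\<not> zero_obj V T" "X \<otimes>\<^bsub>V\<^esub> T \<in> E" using simple assms by blast
  obtain A where A: "A \<in> Obj D" "isomorphic V T (FObj F A)" using T(1) by (auto simp: ess_image_def)
  have "\<not> zero_obj D A"
    using V.zero_obj_isomorphic[OF V.isomorphic_sym[OF A(2)]] T(2) zero_obj_map_iff[OF A(1)] by blast
  moreover have "X \<otimes>\<^bsub>V\<^esub> FObj F A \<in> E"
    using ess_image_isomorphic[OF T(3)] V.isomorphic_tensor[OF V.isomorphic_refl[OF X] A(2)] by blast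
  ultimately show ?thesis using A(1) by blast
qed

lemma ex_tensor_map:
  assumes "X \<in> Obj V"
  shows "\<exists>A\<in>Obj D. \<not> zero_obj D A \<and> X \<otimes>\<^bsub>V\<^esub> FObj F A \<in> E"
proof -
  obtain n G i q where "zero_obj V (G 0) \<and> G n = X \<and>
    (\<forall>j<n. i j \<in> hom V (G j) (G (Suc j)) \<and> short_exact V (i j) (q j) \<and> simple_obj V (Cod V (q j)))"
    using V.objects_finite_length[OF assms] unfolding finite_length_def by (elim exE) (rule that)
  then have z: "zero_obj V (G 0)" and n: "G n = X"
    and st: "\<And>j. j < n \<Longrightarrow> i j \<in> hom V (G j) (G (Suc j)) \<and> short_exact V (i j) (q j) \<and> simple_obj V (Cod V (q j))"
    by auto
  \<comment> \<open>Induction along the composition series: each stage after the first is an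
    extension of a simple object by the preceding stage.\<close>
  have "j \<le> n \<Longrightarrow> \<exists>A\<in>Obj D. \<not> zero_obj D A \<and> G j \<otimes>\<^bsub>V\<^esub> FObj F A \<in> E" for j
  proof (induction j)
    case 0
    \<comment> \<open>At the bottom the unit serves as witness. The zero object \<open>?X\<close>
      lies in the essential image because zero arrows make it a retract of the image of the
      unit.\<close>
    let ?X = "G 0 \<otimes>\<^bsub>V\<^esub> FObj F \<one>\<^bsub>D\<^esub>"
    have o: "FObj F \<one>\<^bsub>D\<^esub> \<in> Obj V" by (rule map_obj[OF D.unit_obj])
    have zX: "zero_obj V ?X" using V.zero_obj_tensor_left[OF z o] .
    then have X: "?X \<in> Obj V" by (simp add: V.zero_obj_iff)
    have "\<zero>\<^bsub>V\<^esub> (FObj F \<one>\<^bsub>D\<^esub>) ?X \<cdot>\<^bsub>V\<^esub> \<zero>\<^bsub>V\<^esub> ?X (FObj F \<one>\<^bsub>D\<^esub>) = \<i>\<d>\<^bsub>V\<^esub> ?X"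
      using V.zero_comp[OF V.zero_hom[OF X o] X] zX by (simp add: V.zero_obj_iff)
    then have "?X \<in> E" by (rule ess_image_retract[OF D.unit_obj V.zero_hom[OF X o] V.zero_hom[OF o X]])
    then show ?case using unit_not_zero_D D.unit_obj by blast
  next
    case (Suc j)
    then have j: "j < n" by simp
    obtain A where A: "A \<in> Obj D" "\<not> zero_obj D A" "G j \<otimes>\<^bsub>V\<^esub> FObj F A \<in> E" using Suc by auto
    have i: "i j \<in> hom V (G j) (G (Suc j))" and ex: "short_exact V (i j) (q j)"
      and s: "simple_obj V (Cod V (q j))" using st[OF j] by auto
    \<comment> \<open>The series records only the codomain of \<open>q j\<close>; its domain is
      recovered from the fact that it is a cokernel of \<open>i j\<close>.\<close>
    have q: "q j \<in> hom V (G (Suc j)) (Cod V (q j))"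
      using V.is_cokernel_hom[OF _ i] ex by (simp add: short_exact_def)
    obtain B where B: "B \<in> Obj D" "\<not> zero_obj D B" "Cod V (q j) \<otimes>\<^bsub>V\<^esub> FObj F B \<in> E"
      using simple_tensor_map[OF s] by blast
    show ?case using extension_tensor_map[OF i q ex A B] by blast
  qed
  then show ?thesis using n by blast
qed

lemma epic_tensor_split:
  assumes e: "e \<in> hom V X Y" "epic V e"
  shows "\<exists>T\<in>Obj D. \<not> zero_obj D T \<and> split_epi V (e \<boxtimes>\<^bsub>V\<^esub> \<i>\<d>\<^bsub>V\<^esub> (FObj F T))"
proof -
  obtain K k where k: "k \<in> hom V K X" "is_kernel V e k" using e(1) by (rule V.kernelE)
  have ex: "short_exact V k e"
    using k V.epic_cokernel_of_kernel[OF e(2,1) k] by (simp add: short_exact_def)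
  obtain A where "A \<in> Obj D" "\<not> zero_obj D A" "K \<otimes>\<^bsub>V\<^esub> FObj F A \<in> E"
    using ex_tensor_map V.hom_obj(1)[OF k(1)] by blast
  moreover obtain B where "B \<in> Obj D" "\<not> zero_obj D B" "Y \<otimes>\<^bsub>V\<^esub> FObj F B \<in> E"
    using ex_tensor_map V.hom_obj(2)[OF e(1)] by blast
  ultimately show ?thesis using extension_tensor_map[OF k(1) e(1) ex] by blast
qed

lemma ex_image:
  assumes X: "X \<in> Obj V"
  shows "\<exists>P\<in>Obj D. \<exists>Q\<in>Obj D. \<exists>f\<in>hom D P Q. \<exists>m\<in>hom V X (FObj F Q). is_image V (FArr F f) m"
proof -
  obtain A where A: "A \<in> Obj D" "\<not> zero_obj D A" "X \<otimes>\<^bsub>V\<^esub> FObj F A \<in> E"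
    using ex_tensor_map[OF X] by blast
  obtain A' ev coev where d: "is_dual D A A' ev coev" using D.ex_dual A(1) by blast
  have o: "A' \<in> Obj D" "coev \<in> hom D \<one>\<^bsub>D\<^esub> (A \<otimes>\<^bsub>D\<^esub> A')" "ev \<in> hom D (A' \<otimes>\<^bsub>D\<^esub> A) \<one>\<^bsub>D\<^esub>"
    using d by (auto simp: is_dual_def)
  have "isomorphic V X (X \<otimes>\<^bsub>V\<^esub> FObj F \<one>\<^bsub>D\<^esub>)"
    using V.isomorphic_tensor[OF V.isomorphic_refl[OF X] unit_map_isomorphic] V.isomorphic_unit_right[OF X]
      V.isomorphic_sym V.isomorphic_trans by blast
  then obtain a a' where a: "a \<in> hom V X (X \<otimes>\<^bsub>V\<^esub> FObj F \<one>\<^bsub>D\<^esub>)" "a' \<in> hom V (X \<otimes>\<^bsub>V\<^esub> FObj F \<one>\<^bsub>D\<^esub>) X"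
    "a' \<cdot>\<^bsub>V\<^esub> a = \<i>\<d>\<^bsub>V\<^esub> X" "a \<cdot>\<^bsub>V\<^esub> a' = \<i>\<d>\<^bsub>V\<^esub> (X \<otimes>\<^bsub>V\<^esub> FObj F \<one>\<^bsub>D\<^esub>)"
    by (rule V.isomorphicE)
  \<comment> \<open>The coevaluation ends in \<open>A \<otimes> A'\<close> and the evaluation starts
    at \<open>A' \<otimes> A\<close>. \<open>Q\<close> and \<open>P\<close> represent
    \<open>X\<close> tensored with the images of these two objects.\<close>
  obtain Q where Q: "Q \<in> Obj D" "isomorphic V (X \<otimes>\<^bsub>V\<^esub> FObj F (A \<otimes>\<^bsub>D\<^esub> A')) (FObj F Q)"
    using tensor_map_ess_image(1)[OF X A(1) o(1) A(3)] by (auto simp: ess_image_def)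
  obtain c c' where c: "c \<in> hom V (X \<otimes>\<^bsub>V\<^esub> FObj F (A \<otimes>\<^bsub>D\<^esub> A')) (FObj F Q)"
    "c' \<in> hom V (FObj F Q) (X \<otimes>\<^bsub>V\<^esub> FObj F (A \<otimes>\<^bsub>D\<^esub> A'))"
    "c' \<cdot>\<^bsub>V\<^esub> c = \<i>\<d>\<^bsub>V\<^esub> (X \<otimes>\<^bsub>V\<^esub> FObj F (A \<otimes>\<^bsub>D\<^esub> A'))" using Q(2) by (rule V.isomorphicE)
  obtain P where P: "P \<in> Obj D" "isomorphic V (X \<otimes>\<^bsub>V\<^esub> FObj F (A' \<otimes>\<^bsub>D\<^esub> A)) (FObj F P)"
    using tensor_map_ess_image(2)[OF X A(1) o(1) A(3)] by (auto simp: ess_image_def)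
  obtain b b' where b: "b \<in> hom V (X \<otimes>\<^bsub>V\<^esub> FObj F (A' \<otimes>\<^bsub>D\<^esub> A)) (FObj F P)"
    "b' \<in> hom V (FObj F P) (X \<otimes>\<^bsub>V\<^esub> FObj F (A' \<otimes>\<^bsub>D\<^esub> A))"
    "b' \<cdot>\<^bsub>V\<^esub> b = \<i>\<d>\<^bsub>V\<^esub> (X \<otimes>\<^bsub>V\<^esub> FObj F (A' \<otimes>\<^bsub>D\<^esub> A))" using P(2) by (rule V.isomorphicE)
  let ?u = "\<i>\<d>\<^bsub>V\<^esub> X \<boxtimes>\<^bsub>V\<^esub> FArr F coev" and ?v = "\<i>\<d>\<^bsub>V\<^esub> X \<boxtimes>\<^bsub>V\<^esub> FArr F ev"
  have u: "?u \<in> hom V (X \<otimes>\<^bsub>V\<^esub> FObj F \<one>\<^bsub>D\<^esub>) (X \<otimes>\<^bsub>V\<^esub> FObj F (A \<otimes>\<^bsub>D\<^esub> A'))" "monic V ?u"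
    using V.tensor_hom[OF V.id_hom[OF X] map_hom[OF o(2)]]
      V.monic_tensor_left[OF map_coev_monic[OF d A(2)] map_hom[OF o(2)] X] by auto
  have v: "?v \<in> hom V (X \<otimes>\<^bsub>V\<^esub> FObj F (A' \<otimes>\<^bsub>D\<^esub> A)) (X \<otimes>\<^bsub>V\<^esub> FObj F \<one>\<^bsub>D\<^esub>)" "epic V ?v"
    using V.tensor_hom[OF V.id_hom[OF X] map_hom[OF o(3)]]
      V.epic_tensor_left[OF map_ev_epic[OF d A(2)] map_hom[OF o(3)] X] by auto
  \<comment> \<open>\<open>m\<close> embeds \<open>X\<close> by the coevaluation and
    \<open>e\<close> projects onto \<open>X\<close> by the evaluation, both conjugated with the
    chosen isomorphisms. The composite \<open>m\<close> after \<open>e\<close> runs between images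
    of objects of \<open>D\<close>, so fullness lifts it to \<open>f\<close>, and \<open>m\<close>
    is its image.\<close>
  define m where "m = c \<cdot>\<^bsub>V\<^esub> ?u \<cdot>\<^bsub>V\<^esub> a"
  define e where "e = a' \<cdot>\<^bsub>V\<^esub> ?v \<cdot>\<^bsub>V\<^esub> b'"
  have m: "m \<in> hom V X (FObj F Q)" "monic V m"
    unfolding m_def using V.comp_hom[OF V.comp_hom[OF a(1) u(1)] c(1)]
      V.monic_comp[OF V.monic_comp[OF V.split_monic[OF a(1-3)] a(1) u(2,1)] V.comp_hom[OF a(1) u(1)]
        V.split_monic[OF c] c(1)] by auto
  have e: "e \<in> hom V (FObj F P) X" "epic V e"
    unfolding e_def using V.comp_hom[OF V.comp_hom[OF b(2) v(1)] a(2)]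
      V.epic_comp[OF V.epic_comp[OF V.split_epic[OF b(2,1,3)] b(2) v(2,1)] V.comp_hom[OF b(2) v(1)]
        V.split_epic[OF a(2,1,3)] a(2)] by auto
  obtain f where "f \<in> hom D P Q" "FArr F f = m \<cdot>\<^bsub>V\<^esub> e"
    using full[OF P(1) Q(1) V.comp_hom[OF e(1) m(1)]] by blast
  then show ?thesis using V.is_imageI[OF m(1) e(1) m(2) e(2)] P(1) Q(1) m(1) by metis
qed

end

end

theorem proposition3p2p1:
  fixes D :: "('k::field, 'o, 'm) monoidal_category"
    and V :: "('k, 'p, 'n) monoidal_category"
    and I :: "('o, 'm, 'p, 'n) monoidal_functor"
  assumes "additive_category D" and "karoubian_category D"
    and "rigid_symmetric_monoidal_category D"
    and "tensor_category V"
    and "linear_symmetric_monoidal_functor D V I"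
    and "fully_faithful D V I"
    and "\<And>T\<^sub>1 T\<^sub>2. \<lbrakk>T\<^sub>1 \<in> ess_image D V I; T\<^sub>2 \<in> ess_image D V I\<rbrakk>
      \<Longrightarrow> Ext1 V T\<^sub>1 T\<^sub>2 = {Ext1_zero V T\<^sub>1 T\<^sub>2}"
  shows "((\<forall>X \<in> Obj V. \<exists>P \<in> Obj D. \<exists>Q \<in> Obj D. \<exists>f \<in> hom D P Q.
             \<exists>m \<in> hom V X (FObj I Q). is_image V (FArr I f) m) \<and>
          (\<forall>X \<in> Obj V. \<forall>Y \<in> Obj V. \<forall>e \<in> hom V X Y. epic V e \<longrightarrow>
             (\<exists>T \<in> Obj D. \<not> zero_obj D T \<and>
                split_epi V (e \<boxtimes>\<^bsub>V\<^esub> \<i>\<d>\<^bsub>V\<^esub> (FObj I T)))))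
         \<longleftrightarrow>
         (\<forall>X. simple_obj V X \<longrightarrow>
             (\<exists>T \<in> ess_image D V I. \<not> zero_obj V T \<and> X \<otimes>\<^bsub>V\<^esub> T \<in> ess_image D V I))"
    (is "?im \<and> ?split \<longleftrightarrow> ?simple")
proof -
  interpret tensor_embedding D V I
    by (intro tensor_embedding.intro tensor_embedding_axioms.intro assms)
  show ?thesis
  proof
    assume *: "?im \<and> ?split"
    have "\<exists>T\<in>Obj D. \<not> zero_obj D T \<and> split_epi V (e \<boxtimes>\<^bsub>V\<^esub> \<i>\<d>\<^bsub>V\<^esub> (FObj I T))"
      if "e \<in> hom V X Y" "epic V e" for X Y e
      using * that V.hom_obj[OF that(1)] by blast
    moreover have "X \<in> Obj V" if "simple_obj V X" for X using that by (simp add: simple_obj_def)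
    ultimately show ?simple using simple_tensor_ess_image * by blast
  next
    assume ?simple
    then have s: "\<And>X. simple_obj V X \<Longrightarrow> \<exists>T\<in>E. \<not> zero_obj V T \<and> X \<otimes>\<^bsub>V\<^esub> T \<in> E" by blast
    show "?im \<and> ?split" using ex_image[OF s] epic_tensor_split[OF s] by blast
  qed
qed

end
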